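(* Let $\mathcal{P}$ be a simple thin polyomino and let $K$ be a field. Then the polyomino ideal $I_{\mathcal{P}}\subset S=K[x_a\mid a\in V(\mathcal{P})]$ is a Knutson ideal.
   Context: $\mathbb{N}$ is the set of nonnegative integers, and $(i,j)\le (k,l)$ in $\mathbb{N}^2$ means $i\le k$ and $j\le l$. For $a=(i,j)\le b=(k,l)$ put $[a,b]=\{m\in\mathbb{N}^2: a\le m\le b\}$; it is a proper interval if $i<k$ and $j<l$. The diagonal vertices of a proper interval are $a$ (lower-left) and $b$ (upper-right), and its anti-diagonal vertices are $(i,l)$ (upper-left) and $(k,j)$ (lower-right). A cell is $C=[a,a+(1,1)]$; $V(C)$ is the set of its four vertices and its edges are the four pairs of adjacent vertices. For a finite collection of cells $\mathcal{P}$, $V(\mathcal{P})=\bigcup_{C\in\mathcal{P}}V(C)$. A path of cells from $C$ to $D$ is a sequence of distinct cells $C=C_1,\dots,C_m=D$ such that $C_i\cap C_{i+1}$ is an edge of both for all $i$. A polyomino is a non-empty finite collection of cells in $(\mathbb{N}\setminus\{0\})\times(\mathbb{N}\setminus\{0\})$ such that any two of its cells are joined by a path of cells of the collection. $\mathcal{P}$ is simple if any two cells not in $\mathcal{P}$ are joined by a path of cells not in $\mathcal{P}$. $\mathcal{P}$ is thin if it does not contain four cells forming a $2\times 2$ square. An inner interval of $\mathcal{P}$ is a proper interval $[a,b]$ with $a,b\in V(\mathcal{P})$ all of whose cells belong to $\mathcal{P}$. $I_{\mathcal{P}}$ is the ideal of $S=K[x_a\mid a\in V(\mathcal{P})]$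 generated by all binomials $x_ax_b-x_cx_d$, where $[a,b]$ ranges over the inner intervals of $\mathcal{P}$ and $c,d$ are the anti-diagonal vertices of $[a,b]$. Knutson ideals: let $f\in S$ be such that $\operatorname{in}_<(f)$ is a square-free monomial for some monomial order $<$ on $S$. $\mathcal{C}_f$ is the smallest set of ideals of $S$ such that: (1) $(f)\in\mathcal{C}_f$; (2) if $I\in\mathcal{C}_f$ and $J$ is any ideal of $S$, then $I:J\in\mathcal{C}_f$; (3) if $I,J\in\mathcal{C}_f$, then $I+J\in\mathcal{C}_f$ and $I\cap J\in\mathcal{C}_f$. An ideal is a Knutson ideal if it lies in $\mathcal{C}_f$ for some such $f$. *)

theory Defs
  imports "HOL-Algebra.Ideal" "HOL-Library.Poly_Mapping"
begin

section \<open>Polyominoes\<close>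

type_synonym point = "nat \<times> nat"

text \<open>The order on points is the componentwise one, whose intervals are written out here as
  products of intervals of natural numbers.\<close>

definition interval :: "point \<Rightarrow> point \<Rightarrow> point set" where
  "interval a b = {fst a..fst b} \<times> {snd a..snd b}"

definition proper_interval :: "point \<Rightarrow> point \<Rightarrow> bool" where
  "proper_interval a b \<longleftrightarrow> fst a < fst b \<and> snd a < snd b"

text \<open>A cell, being a set of lattice points, is equal to the set of its four vertices.\<close>

definition cell :: "point \<Rightarrow> point set" where
  "cell a = interval a (fst a + 1, snd a + 1)"

definition cells :: "point set set" where
  "cells = range cell"

definition adjacent :: "point \<Rightarrow> point \<Rightarrow> bool" where
  "adjacent p q \<longleftrightarrow>
     (snd p = snd q \<and> (fst q = fst p + 1 \<or> fst p = fst q + 1)) \<or>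
     (fst p = fst q \<and> (snd q = snd p + 1 \<or> snd p = snd q + 1))"

definition edges :: "point set \<Rightarrow> point set set" where
  "edges C = {{p, q} | p q. p \<in> C \<and> q \<in> C \<and> adjacent p q}"

definition vertices :: "point set set \<Rightarrow> point set" where
  "vertices P = \<Union>P"

definition cell_path :: "point set list \<Rightarrow> point set \<Rightarrow> point set \<Rightarrow> bool" where
  "cell_path cs C D \<longleftrightarrow>
     cs \<noteq> [] \<and> hd cs = C \<and> last cs = D \<and> set cs \<subseteq> cells \<and> distinct cs \<and>
     successively (\<lambda>A B. A \<inter> B \<in> edges A \<and> A \<inter> B \<in> edges B) cs"

definition path_connected_cells :: "point set set \<Rightarrow> bool" where
  "path_connected_cells Q \<longleftrightarrow>
     (\<forall>C\<in>Q. \<forall>D\<in>Q. \<exists>cs. cell_path cs C D \<and> set cs \<subseteq> Q)"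

definition polyomino :: "point set set \<Rightarrow> bool" where
  "polyomino P \<longleftrightarrow>
     P \<noteq> {} \<and> finite P \<and> P \<subseteq> cell ` ({1..} \<times> {1..}) \<and> path_connected_cells P"

text \<open>The cells outside \<open>P\<close> include those touching the coordinate axes, which a polyomino never
  contains; hence the outside of a polyomino is not cut apart by the boundary of the quadrant.\<close>

definition simple_polyomino :: "point set set \<Rightarrow> bool" where
  "simple_polyomino P \<longleftrightarrow> path_connected_cells (cells - P)"

definition thin_polyomino :: "point set set \<Rightarrow> bool" where
  "thin_polyomino P \<longleftrightarrow>
     \<not> (\<exists>i j. {cell (i, j), cell (i + 1, j), cell (i, j + 1), cell (i + 1, j + 1)} \<subseteq> P)"

definition inner_interval :: "point set set \<Rightarrow> point \<Rightarrow> point \<Rightarrow> bool" where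
  "inner_interval P a b \<longleftrightarrow>
     proper_interval a b \<and> a \<in> vertices P \<and> b \<in> vertices P \<and>
     (\<forall>C\<in>cells. C \<subseteq> interval a b \<longrightarrow> C \<in> P)"

section \<open>Polynomial rings\<close>

text \<open>Polynomials are finitely supported maps from exponent vectors to coefficients. The ring of
  polynomials in the variables \<open>V\<close> consists of those using only exponent vectors supported
  in \<open>V\<close>.\<close>

type_synonym 'v monom = "'v \<Rightarrow>\<^sub>0 nat"
type_synonym ('v, 'k) mpoly = "('v \<Rightarrow>\<^sub>0 nat) \<Rightarrow>\<^sub>0 'k"

definition monomials :: "'v set \<Rightarrow> 'v monom set" where
  "monomials V = {m. Poly_Mapping.keys m \<subseteq> V}"

definition poly_ring :: "'v set \<Rightarrow> ('v, 'k::field) mpoly ring" where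
  "poly_ring V = \<lparr>carrier = {p. Poly_Mapping.keys p \<subseteq> monomials V},
     mult = (*), one = 1, zero = 0, add = (+)\<rparr>"

definition var :: "'v \<Rightarrow> ('v, 'k::field) mpoly" where
  "var v = Poly_Mapping.single (Poly_Mapping.single v 1) 1"

lemma monomials_add:
  assumes "m \<in> monomials V" "n \<in> monomials V"
  shows "m + n \<in> monomials V"
  using assms Poly_Mapping.keys_add[of m n] unfolding monomials_def by blast

lemma cring_poly_ring: "cring (poly_ring V :: ('v, 'k::field) mpoly ring)"
proof (intro cringI abelian_groupI comm_monoidI)
  let ?R = "poly_ring V :: ('v, 'k) mpoly ring"
  fix x y z assume x: "x \<in> carrier ?R" and y: "y \<in> carrier ?R"
  show "x \<oplus>\<^bsub>?R\<^esub> y \<in> carrier ?R"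
    using x y Poly_Mapping.keys_add[of x y] by (auto simp: poly_ring_def)
  show "x \<otimes>\<^bsub>?R\<^esub> y \<in> carrier ?R"
    using x y keys_mult[of x y] monomials_add[where V = V] by (fastforce simp: poly_ring_def)
  show "(x \<oplus>\<^bsub>?R\<^esub> y) \<otimes>\<^bsub>?R\<^esub> z = x \<otimes>\<^bsub>?R\<^esub> z \<oplus>\<^bsub>?R\<^esub> y \<otimes>\<^bsub>?R\<^esub> z"
    by (simp add: poly_ring_def distrib_right)
next
  let ?R = "poly_ring V :: ('v, 'k) mpoly ring"
  fix x assume "x \<in> carrier ?R"
  then show "\<exists>y\<in>carrier ?R. y \<oplus>\<^bsub>?R\<^esub> x = \<zero>\<^bsub>?R\<^esub>"
    by (intro bexI[of _ "- x"]) (auto simp: poly_ring_def)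
qed (auto simp: poly_ring_def monomials_def algebra_simps)

definition polyomino_ideal :: "point set set \<Rightarrow> (point, 'k::field) mpoly set" where
  "polyomino_ideal P =
     Idl\<^bsub>poly_ring (vertices P)\<^esub>
       {var a * var b - var (fst a, snd b) * var (fst b, snd a) | a b. inner_interval P a b}"

section \<open>Knutson ideals\<close>

definition monomial_order :: "'v set \<Rightarrow> 'v monom rel \<Rightarrow> bool" where
  "monomial_order V r \<longleftrightarrow>
     linear_order_on (monomials V) r \<and>
     (\<forall>m\<in>monomials V. (0, m) \<in> r) \<and>
     (\<forall>m n u. (m, n) \<in> r \<longrightarrow> u \<in> monomials V \<longrightarrow> (m + u, n + u) \<in> r)"

text \<open>This is meaningful for \<open>f \<noteq> 0\<close> only. The leading coefficient is disregarded: rescaling \<open>f\<close>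
  by a unit does not change the ideal generated by \<open>f\<close>.\<close>

definition initial_monomial :: "'v monom rel \<Rightarrow> ('v, 'k::field) mpoly \<Rightarrow> 'v monom" where
  "initial_monomial r f =
     (THE m. m \<in> Poly_Mapping.keys f \<and> (\<forall>n\<in>Poly_Mapping.keys f. (n, m) \<in> r))"

definition squarefree_monomial :: "'v monom \<Rightarrow> bool" where
  "squarefree_monomial m \<longleftrightarrow> (\<forall>v. Poly_Mapping.lookup m v \<le> 1)"

definition colon_ideal :: "('a, 'b) ring_scheme \<Rightarrow> 'a set \<Rightarrow> 'a set \<Rightarrow> 'a set" where
  "colon_ideal R I J = {x \<in> carrier R. \<forall>y\<in>J. x \<otimes>\<^bsub>R\<^esub> y \<in> I}"

inductive_set knutson_family :: "('a, 'b) ring_scheme \<Rightarrow> 'a \<Rightarrow> 'a set set"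
  for R :: "('a, 'b) ring_scheme" and f :: 'a where
  principal: "Idl\<^bsub>R\<^esub> {f} \<in> knutson_family R f"
| colon: "I \<in> knutson_family R f \<Longrightarrow> ideal J R \<Longrightarrow> colon_ideal R I J \<in> knutson_family R f"
| sum: "I \<in> knutson_family R f \<Longrightarrow> J \<in> knutson_family R f \<Longrightarrow>
    I <+>\<^bsub>R\<^esub> J \<in> knutson_family R f"
| inter: "I \<in> knutson_family R f \<Longrightarrow> J \<in> knutson_family R f \<Longrightarrow>
    I \<inter> J \<in> knutson_family R f"

definition knutson_ideal :: "'v set \<Rightarrow> ('v, 'k::field) mpoly set \<Rightarrow> bool" where
  "knutson_ideal V I \<longleftrightarrow>
     (\<exists>r f. monomial_order V r \<and> f \<in> carrier (poly_ring V) \<and> f \<noteq> 0 \<and>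
        squarefree_monomial (initial_monomial r f) \<and> I \<in> knutson_family (poly_ring V) f)"

end

theory Submission
  imports Defs "HOL-Library.Product_Lexorder"
begin

text \<open>
  Cut the polyomino into its maximal horizontal strips and, separately, into its maximal vertical
  strips, strips of a single cell included, and let \<open>F s\<close> be the inner 2-minor spanned by the four
  corners of the strip \<open>s\<close>. The polynomial \<open>f\<close> is the product of \<open>F s\<close> over all strips but one. If the
  initial monomial of \<open>F s\<close> is the antidiagonal one for horizontal \<open>s\<close> and the diagonal one for
  vertical \<open>s\<close>, then a variable occurs in these monomials as often as one leaves the polyomino when
  walking clockwise around the vertex; so at most once, since a simple polyomino has no two cells
  that touch in that vertex only. A monomial order with these initial monomials comes from a weight
  on the vertices, that is, from a function on the cells with negative sums over the horizontal and
  positive sums over the vertical strips. It exists because strips and cells form a tree and one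
  strip was left out.

  Every \<open>(F s)\<close> is of the form \<open>(f) : (g)\<close>, so the sum \<open>J\<close> of these ideals is in the family. Again since
  strips and cells form a tree, \<open>J\<close> contains a monomial multiple of each generator of the polyomino
  ideal, and the polyomino ideal is \<open>J : (x)\<close> for a monomial \<open>x\<close> because it is saturated with respect
  to the variables. Saturation follows by removing the cells one at a time: a leaf of the tree which
  is reached by a walk with as many and as late turns as possible has a vertex \<open>v\<close> such that any
  other vertex in its row and any other vertex in its column are opposite corners of an inner
  interval, so that swaps raise the exponent of \<open>x\<^sub>v\<close> to a value determined by the degree.

  Cells are identified with their lower-left vertices, and \<open>A\<close> is the set of cells of the polyomino.
\<close>

section \<open>Winding numbers of closed cell walks\<close>

definition connected_grid :: "point set \<Rightarrow> bool" where
  "connected_grid A \<longleftrightarrow>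
     (\<forall>S\<subseteq>A. S \<noteq> {} \<longrightarrow> (\<forall>p\<in>S. \<forall>q\<in>A. adjacent p q \<longrightarrow> q \<in> S) \<longrightarrow> S = A)"

lemma adjacent_sym: "adjacent p q \<Longrightarrow> adjacent q p"
  unfolding adjacent_def by auto

lemma cell_iff: "p \<in> cell c \<longleftrightarrow> fst c \<le> fst p \<and> fst p \<le> fst c + 1 \<and> snd c \<le> snd p \<and> snd p \<le> snd c + 1"
  by (cases p) (auto simp: cell_def interval_def)

lemma inj_cell: "inj cell"
proof (rule injI)
  fix c d assume e: "cell c = cell d"
  have "c \<in> cell c" "(fst c + 1, snd c + 1) \<in> cell c" by (auto simp: cell_iff)
  then have "c \<in> cell d" "(fst c + 1, snd c + 1) \<in> cell d" using e by auto
  then show "c = d" by (auto simp: cell_iff prod_eq_iff)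
qed

lemma adjacent_if_edge:
  assumes "cell c \<inter> cell d \<in> edges (cell c)"
  shows "adjacent c d"
proof -
  obtain p q where pq: "cell c \<inter> cell d = {p, q}" "adjacent p q"
    using assms unfolding edges_def by auto
  have m: "r \<in> cell c \<and> r \<in> cell d \<longleftrightarrow> r = p \<or> r = q" for r using pq(1) by blast
  obtain i j k l where [simp]: "c = (i, j)" "d = (k, l)" by (cases c, cases d)
  obtain a b a' b' where [simp]: "p = (a, b)" "q = (a', b')" by (cases p, cases q)
  have M: "(i \<le> u \<and> u \<le> i+1 \<and> j \<le> v \<and> v \<le> j+1) \<and> (k \<le> u \<and> u \<le> k+1 \<and> l \<le> v \<and> v \<le> l+1)
     \<longleftrightarrow> (u = a \<and> v = b) \<or> (u = a' \<and> v = b')" for u v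
    using m[of "(u,v)"] by (simp add: cell_iff)
  have p: "i \<le> a" "a \<le> i+1" "j \<le> b" "b \<le> j+1" "k \<le> a" "a \<le> k+1" "l \<le> b" "b \<le> l+1"
    using M[of a b] by auto
  have q: "i \<le> a'" "a' \<le> i+1" "j \<le> b'" "b' \<le> j+1" "k \<le> a'" "a' \<le> k+1" "l \<le> b'" "b' \<le> l+1"
    using M[of a' b'] by auto
  have ad: "b = b' \<and> (a' = a + 1 \<or> a = a' + 1) \<or> a = a' \<and> (b' = b+1 \<or> b = b'+1)"
    using pq(2) by (auto simp: adjacent_def)
  show ?thesis
  proof (cases "c = d")
    case True
    then show ?thesis using M[of i j] M[of "i+1" j] M[of i "j+1"] M[of "i+1" "j+1"] by auto
  next
    case False
    then show ?thesis using p q ad unfolding adjacent_def by auto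
  qed
qed

lemma connected_grid_if_path_connected:
  assumes "path_connected_cells Q"
  shows "connected_grid {c. cell c \<in> Q}"
  unfolding connected_grid_def
proof (intro allI impI)
  fix S assume S: "S \<subseteq> {c. cell c \<in> Q}" "S \<noteq> {}"
    and cl: "\<forall>p\<in>S. \<forall>q\<in>{c. cell c \<in> Q}. adjacent p q \<longrightarrow> q \<in> S"
  have ind: "\<lbrakk>successively (\<lambda>A B. A \<inter> B \<in> edges A \<and> A \<inter> B \<in> edges B) cs; set cs \<subseteq> Q;
     set cs \<subseteq> cells; cs \<noteq> []; hd cs \<in> cell ` S\<rbrakk> \<Longrightarrow> last cs \<in> cell ` S" for cs
  proof (induction cs)
    case (Cons C cs)
    show ?case
    proof (cases cs)
      case Nil then show ?thesis using Cons by simp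
    next
      case (Cons D ds)
      obtain c d where cd: "C = cell c" "c \<in> S" "D = cell d"
        using Cons.prems Cons by (auto simp: cells_def)
      have "adjacent c d" using Cons.prems(1) adjacent_if_edge Cons cd by auto
      moreover have "d \<in> {c. cell c \<in> Q}" using cd Cons.prems(2) Cons by auto
      ultimately have "d \<in> S" using cl cd(2) by blast
      then show ?thesis using Cons.IH Cons.prems Cons cd by auto
    qed
  qed simp
  show "S = {c. cell c \<in> Q}"
  proof (rule antisym[OF S(1)], rule subsetI)
    fix d assume d: "d \<in> {c. cell c \<in> Q}"
    obtain c where c: "c \<in> S" using S by auto
    obtain cs where "cell_path cs (cell c) (cell d)" "set cs \<subseteq> Q"
      using assms c S d unfolding path_connected_cells_def by blast
    then have "cell d \<in> cell ` S" using ind[of cs] c by (auto simp: cell_path_def)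
    then show "d \<in> S" using inj_cell by (auto dest: injD)
  qed
qed

fun step_sum :: "(point \<Rightarrow> point \<Rightarrow> int) \<Rightarrow> point list \<Rightarrow> int" where
  "step_sum g (p # q # ws) = g p q + step_sum g (q # ws)"
| "step_sum g _ = 0"

lemma step_sum_telescope: "ws \<noteq> [] \<Longrightarrow> step_sum (\<lambda>p q. h q - h p) ws = h (last ws) - h (hd ws)"
  by (induction ws rule: induct_list012) auto

lemma step_sum_diff: "step_sum (\<lambda>p q. g p q - h p q) ws = step_sum g ws - step_sum h ws"
  by (induction ws rule: induct_list012) auto

lemma step_sum_cong: "successively (\<lambda>p q. g p q = h p q) ws \<Longrightarrow> step_sum g ws = step_sum h ws"
  by (induction ws rule: induct_list012) auto

lemma step_sum_zero: "successively (\<lambda>p q. g p q = 0) ws \<Longrightarrow> step_sum g ws = 0"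
  by (induction ws rule: induct_list012) auto

definition up_cross :: "nat \<Rightarrow> nat \<Rightarrow> point \<Rightarrow> point \<Rightarrow> int" where
  "up_cross i j p q = of_bool (fst p = i) * (of_bool (j \<le> snd q) - of_bool (j \<le> snd p))"

definition right_cross :: "nat \<Rightarrow> nat \<Rightarrow> point \<Rightarrow> point \<Rightarrow> int" where
  "right_cross i j p q = of_bool (snd q = j) * (of_bool (i \<le> fst q) - of_bool (i \<le> fst p))"

text \<open>The number of times, counted with sign, that a closed walk of cells crosses the horizontal ray
  from the lattice point \<open>(i, j)\<close> to the right.\<close>

definition winding :: "point list \<Rightarrow> nat \<Rightarrow> nat \<Rightarrow> int" where
  "winding ws i j =
     step_sum (\<lambda>p q. of_bool (i \<le> fst p) * (of_bool (j \<le> snd q) - of_bool (j \<le> snd p))) ws"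

lemma winding_right: "winding ws i j - winding ws (Suc i) j = step_sum (up_cross i j) ws"
  unfolding winding_def step_sum_diff[symmetric] up_cross_def
  by (rule arg_cong2[where f = step_sum]) (auto simp: fun_eq_iff)

lemma winding_up:
  assumes "ws \<noteq> []" "hd ws = last ws" "successively adjacent ws"
  shows "winding ws i (Suc j) - winding ws i j = step_sum (right_cross i j) ws"
proof -
  let ?h = "\<lambda>p. of_bool (i \<le> fst p \<and> snd p = j) :: int"
  have "step_sum (\<lambda>p q. ?h q - ?h p) ws = 0"
    using step_sum_telescope[of ws ?h] assms by simp
  moreover have "step_sum (\<lambda>p q. (?h q - ?h p) -
      (of_bool (i \<le> fst p) * (of_bool (j \<le> snd q) - of_bool (j \<le> snd p)) -
       of_bool (i \<le> fst p) * (of_bool (Suc j \<le> snd q) - of_bool (Suc j \<le> snd p)))) ws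
     = step_sum (right_cross i j) ws"
    by (rule step_sum_cong, rule successively_mono[OF assms(3)])
      (auto simp: right_cross_def adjacent_def)
  ultimately show ?thesis
    unfolding winding_def by (simp add: step_sum_diff)
qed

lemma up_cross_zero:
  assumes "successively adjacent ws" "(i, j) \<notin> set ws \<or> (i, j - 1) \<notin> set ws \<or> j = 0"
  shows "step_sum (up_cross i j) ws = 0"
proof (rule step_sum_zero, rule successively_mono[OF assms(1)])
  fix p q assume pq: "p \<in> set ws" "q \<in> set ws" "adjacent p q"
  have "(p = (i, j) \<and> q = (i, j - 1) \<or> q = (i, j) \<and> p = (i, j - 1)) \<and> j \<noteq> 0" if "up_cross i j p q \<noteq> 0"
    using that pq(3) by (auto simp: up_cross_def adjacent_def prod_eq_iff of_bool_def split: if_splits)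
  then show "up_cross i j p q = 0" using assms(2) pq(1,2) by blast
qed

lemma right_cross_zero:
  assumes "successively adjacent ws" "(i, j) \<notin> set ws \<or> (i - 1, j) \<notin> set ws \<or> i = 0"
  shows "step_sum (right_cross i j) ws = 0"
proof (rule step_sum_zero, rule successively_mono[OF assms(1)])
  fix p q assume pq: "p \<in> set ws" "q \<in> set ws" "adjacent p q"
  have "(p = (i, j) \<and> q = (i - 1, j) \<or> q = (i, j) \<and> p = (i - 1, j)) \<and> i \<noteq> 0" if "right_cross i j p q \<noteq> 0"
    using that pq(3) by (auto simp: right_cross_def adjacent_def prod_eq_iff of_bool_def split: if_splits)
  then show "right_cross i j p q = 0" using assms(2) pq(1,2) by blast
qed

lemma winding_bottom: "winding ws i 0 = 0"
  unfolding winding_def by (rule step_sum_zero) (auto simp: successively_conv_nth)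

lemma winding_cell:
  assumes "ws \<noteq> []" "hd ws = last ws" "successively adjacent ws" "(i, j) \<notin> set ws"
  shows "winding ws (Suc i) j = winding ws i j" "winding ws i (Suc j) = winding ws i j"
    "winding ws (Suc i) (Suc j) = winding ws i j"
proof -
  show "winding ws (Suc i) j = winding ws i j"
    using winding_right[of ws i j] up_cross_zero[of ws i j] assms by auto
  show "winding ws i (Suc j) = winding ws i j"
    using winding_up[of ws i j] right_cross_zero[of ws i j] assms by auto
  then show "winding ws (Suc i) (Suc j) = winding ws i j"
    using winding_right[of ws i "Suc j"] up_cross_zero[of ws i "Suc j"] assms by auto
qed

lemma winding_complement:
  assumes ws: "ws \<noteq> []" "hd ws = last ws" "successively adjacent ws" "set ws \<subseteq> A"
    and conn: "connected_grid (- A)" and pos: "A \<subseteq> {1..} \<times> {1..}" and ij: "(i, j) \<notin> A"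
  shows "winding ws i j = 0"
proof -
  let ?S = "{c. c \<notin> A \<and> winding ws (fst c) (snd c) = 0}"
  have "?S = - A"
  proof (rule conn[unfolded connected_grid_def, rule_format])
    have "(0,0) \<in> ?S" using pos by (auto simp: winding_bottom)
    then show "?S \<noteq> {}" by blast
    fix p q assume p: "p \<in> ?S" and q: "q \<in> - A" and a: "adjacent p q"
    have w: "winding ws (Suc (fst r)) (snd r) = winding ws (fst r) (snd r)"
       "winding ws (fst r) (Suc (snd r)) = winding ws (fst r) (snd r)" if "r \<notin> A" for r
      using that ws(4) winding_cell[OF ws(1-3), of "fst r" "snd r"] by (cases r; auto)+
    show "q \<in> ?S" using w[of p] w[of q] p q a unfolding adjacent_def by auto
  qed auto
  then have "(i, j) \<in> ?S" using ij by blast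
  then show ?thesis by simp
qed

definition thin_grid :: "point set \<Rightarrow> bool" where
  "thin_grid A \<longleftrightarrow> (\<forall>i j. \<not> {(i, j), (Suc i, j), (i, Suc j), (Suc i, Suc j)} \<subseteq> A)"

lemma winding_zero:
  assumes ws: "ws \<noteq> []" "hd ws = last ws" "successively adjacent ws" "set ws \<subseteq> A"
    and conn: "connected_grid (- A)" and pos: "A \<subseteq> {1..} \<times> {1..}" and thin: "thin_grid A"
  shows "winding ws i j = 0"
proof (cases "i = 0 \<or> j = 0")
  case True
  then show ?thesis using winding_complement[OF ws conn pos, of i j] pos by auto
next
  case False
  then obtain i' j' where [simp]: "i = Suc i'" "j = Suc j'" by (meson not0_implies_Suc)
  have c: "winding ws (Suc k) l = 0 \<and> winding ws k (Suc l) = 0 \<and> winding ws (Suc k) (Suc l) = 0 \<and>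
     winding ws k l = 0" if "(k, l) \<notin> A" for k l
    using that winding_cell[OF ws(1-3), of k l] winding_complement[OF ws conn pos that] ws(4) by auto
  have "(i', j') \<notin> A \<or> (Suc i', j') \<notin> A \<or> (i', Suc j') \<notin> A \<or> (Suc i', Suc j') \<notin> A"
    using thin by (auto simp: thin_grid_def)
  then show ?thesis using c by auto
qed

lemma cross_cycle:
  assumes "adjacent p q" "distinct (p # q # xs)" "xs \<noteq> []" "successively adjacent (p # q # xs @ [p])"
    and conn: "connected_grid (- A)" and pos: "A \<subseteq> {1..} \<times> {1..}" and thin: "thin_grid A"
    and sub: "set (p # q # xs) \<subseteq> A"
  shows False
proof -
  let ?ws = "p # q # xs @ [p]"
  have nb: "successively (\<lambda>u v. \<not> (u = p \<and> v = q) \<and> \<not> (u = q \<and> v = p)) (q # xs @ [p])"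
  proof -
    have "successively (\<lambda>u v. \<not> (u = p \<and> v = q) \<and> \<not> (u = q \<and> v = p)) (q # xs)"
      by (rule successively_mono[where P = "\<lambda>_ _. True"]) (use assms(2) in \<open>auto simp: successively_conv_nth\<close>)
    then have "successively (\<lambda>u v. \<not> (u = p \<and> v = q) \<and> \<not> (u = q \<and> v = p)) ((q # xs) @ [p])"
      unfolding successively_append_iff using assms(2,3) by auto
    then show ?thesis by simp
  qed
  have ad: "successively adjacent (q # xs @ [p])" using assms(4) by simp
  have nb': "successively (\<lambda>u v. adjacent u v \<and> \<not> (u = p \<and> v = q) \<and> \<not> (u = q \<and> v = p)) (q # xs @ [p])"
    using nb ad by (auto simp: successively_conv_nth)
  have W: "winding ?ws i j = 0" for i j
    by (rule winding_zero[OF _ _ assms(4) _ conn pos thin]) (use sub in auto)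
  have U: "step_sum (up_cross i j) ?ws = 0" for i j
    using winding_right[of ?ws i j] W by simp
  have R: "step_sum (right_cross i j) ?ws = 0" for i j
    using winding_up[of ?ws i j, OF _ _ assms(4)] W by simp
  have "\<exists>i j. (\<forall>u v. adjacent u v \<and> \<not> (u = p \<and> v = q) \<and> \<not> (u = q \<and> v = p) \<longrightarrow> up_cross i j u v = 0) \<and> up_cross i j p q \<noteq> 0
    \<or> (\<forall>u v. adjacent u v \<and> \<not> (u = p \<and> v = q) \<and> \<not> (u = q \<and> v = p) \<longrightarrow> right_cross i j u v = 0) \<and> right_cross i j p q \<noteq> 0"
  proof (cases "fst p = fst q")
    case True
    show ?thesis
      by (rule exI[of _ "fst p"], rule exI[of _ "max (snd p) (snd q)"], rule disjI1)
        (use True assms(1) in \<open>auto simp: adjacent_def up_cross_def prod_eq_iff\<close>)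
  next
    case False
    show ?thesis
      by (rule exI[of _ "max (fst p) (fst q)"], rule exI[of _ "snd p"], rule disjI2)
        (use False assms(1) in \<open>auto simp: adjacent_def right_cross_def prod_eq_iff\<close>)
  qed
  then obtain i j where "(\<forall>u v. adjacent u v \<and> \<not> (u = p \<and> v = q) \<and> \<not> (u = q \<and> v = p) \<longrightarrow> up_cross i j u v = 0) \<and> up_cross i j p q \<noteq> 0
    \<or> (\<forall>u v. adjacent u v \<and> \<not> (u = p \<and> v = q) \<and> \<not> (u = q \<and> v = p) \<longrightarrow> right_cross i j u v = 0) \<and> right_cross i j p q \<noteq> 0"
    by blast
  then show False
  proof
    assume a: "(\<forall>u v. adjacent u v \<and> \<not> (u = p \<and> v = q) \<and> \<not> (u = q \<and> v = p) \<longrightarrow> up_cross i j u v = 0) \<and> up_cross i j p q \<noteq> 0"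
    have "step_sum (up_cross i j) (q # xs @ [p]) = 0"
      by (rule step_sum_zero, rule successively_mono[OF nb']) (use a in auto)
    then show False using U[of i j] a by simp
  next
    assume a: "(\<forall>u v. adjacent u v \<and> \<not> (u = p \<and> v = q) \<and> \<not> (u = q \<and> v = p) \<longrightarrow> right_cross i j u v = 0) \<and> right_cross i j p q \<noteq> 0"
    have "step_sum (right_cross i j) (q # xs @ [p]) = 0"
      by (rule step_sum_zero, rule successively_mono[OF nb']) (use a in auto)
    then show False using R[of i j] a by simp
  qed
qed


lemma connected_grid_walk:
  assumes "connected_grid A" "p \<in> A" "q \<in> A"
  obtains ws where "ws \<noteq> []" "hd ws = p" "last ws = q" "set ws \<subseteq> A" "successively adjacent ws"
proof -
  let ?W = "\<lambda>q ws. ws \<noteq> [] \<and> hd ws = p \<and> last ws = q \<and> set ws \<subseteq> A \<and> successively adjacent ws"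
  have "{q. \<exists>ws. ?W q ws} = A"
  proof (rule assms(1)[unfolded connected_grid_def, rule_format])
    show "{q. \<exists>ws. ?W q ws} \<subseteq> A"
      using last_in_set by fastforce
    have "?W p [p]" using assms(2) by simp
    then show "{q. \<exists>ws. ?W q ws} \<noteq> {}" by blast
    fix r s assume "r \<in> {q. \<exists>ws. ?W q ws}" "s \<in> A" "adjacent r s"
    then obtain ws where "?W r ws" by blast
    then have "?W s (ws @ [s])" using \<open>s \<in> A\<close> \<open>adjacent r s\<close>
      by (auto simp: successively_append_iff)
    then show "s \<in> {q. \<exists>ws. ?W q ws}" by blast
  qed
  then show thesis using that assms(3) by blast
qed

lemma step_sum_snoc: "xs \<noteq> [] \<Longrightarrow> step_sum g (xs @ [z]) = step_sum g xs + g (last xs) z"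
  by (induction xs rule: induct_list012) auto

lemma diagonal_neighbour:
  assumes "connected_grid A" "connected_grid (- A)" and A: "(i, j) \<in> A" "(Suc i, Suc j) \<in> A"
  shows "(Suc i, j) \<in> A \<or> (i, Suc j) \<in> A"
proof (rule ccontr)
  assume "\<not> ?thesis"
  then have nA: "(Suc i, j) \<notin> A" "(i, Suc j) \<notin> A" by auto
  obtain xs where xs: "xs \<noteq> []" "hd xs = (Suc i, Suc j)" "last xs = (i, j)" "set xs \<subseteq> A"
    "successively adjacent xs"
    using connected_grid_walk[OF assms(1) A(2,1)] .
  let ?Z = "(i, Suc j)"
  let ?ws = "?Z # xs @ [?Z]"
  have Z: "?Z \<notin> set xs" using xs nA by auto
  have xs': "successively (\<lambda>p q. adjacent p q \<and> p \<noteq> ?Z \<and> q \<noteq> ?Z) xs"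
    by (rule successively_mono[OF xs(5)]) (use Z in auto)
  have ad: "successively adjacent ?ws"
    using xs by (auto simp: successively_Cons successively_append_iff adjacent_def)
  have "step_sum (up_cross i (Suc (Suc j))) xs = 0"
    by (rule step_sum_zero, rule successively_mono[OF xs'])
      (auto simp: up_cross_def adjacent_def of_bool_def prod_eq_iff split: if_splits)
  then have "step_sum (up_cross i (Suc (Suc j))) ?ws = 0"
    using xs by (cases xs) (auto simp: step_sum_snoc up_cross_def simp flip: append_Cons)
  then have 1: "winding ?ws i (Suc (Suc j)) = winding ?ws (Suc i) (Suc (Suc j))"
    using winding_right[of ?ws i "Suc (Suc j)"] by simp
  have "step_sum (right_cross (Suc i) (Suc j)) xs = 0"
    by (rule step_sum_zero, rule successively_mono[OF xs'])
      (auto simp: right_cross_def adjacent_def of_bool_def prod_eq_iff split: if_splits)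
  then have "step_sum (right_cross (Suc i) (Suc j)) ?ws = 1"
    using xs by (cases xs) (auto simp: step_sum_snoc right_cross_def simp flip: append_Cons)
  then have 2: "winding ?ws (Suc i) (Suc (Suc j)) = winding ?ws (Suc i) (Suc j) + 1"
    using winding_up[of ?ws "Suc i" "Suc j"] ad by simp
  let ?S = "{c. c \<notin> A \<and> winding ?ws (fst c) (Suc (snd c)) = winding ?ws (Suc i) (Suc j)}"
  have "?S = - A"
  proof (rule assms(2)[unfolded connected_grid_def, rule_format])
    have "(Suc i, j) \<in> ?S" using nA by simp
    then show "?S \<noteq> {}" by blast
    fix p q assume p: "p \<in> ?S" and q: "q \<in> - A" and a: "adjacent p q"
    have w: "winding ?ws (Suc k) l = winding ?ws k l"
       "winding ?ws k (Suc l) = winding ?ws k l"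
       "winding ?ws (Suc k) (Suc l) = winding ?ws k l" if "(k, l) \<notin> A" "(k, l) \<noteq> ?Z" for k l
      using winding_cell[of ?ws k l] ad that xs(4) by auto
    obtain k l k' l' where [simp]: "p = (k, l)" "q = (k', l')" by (cases p, cases q)
    have "q \<in> ?S" if "p \<noteq> ?Z" "q \<noteq> ?Z"
      using w[of k l] w[of k' l'] p q a that unfolding adjacent_def by auto
    moreover have "q \<in> ?S" if "p = ?Z"
    proof -
      have "q = (i, Suc (Suc j)) \<or> i \<noteq> 0 \<and> q = (i - 1, Suc j)"
        using a that A q by (auto simp: adjacent_def)
      then show ?thesis using w[of k' l'] p q that by auto
    qed
    moreover have "q \<in> ?S" if "q = ?Z"
    proof -
      have "p = (i, Suc (Suc j)) \<or> i \<noteq> 0 \<and> p = (i - 1, Suc j)"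
        using a that A p by (auto simp: adjacent_def)
      then show ?thesis using w[of k l] p q that by auto
    qed
    ultimately show "q \<in> ?S" by blast
  qed auto
  then have "?Z \<in> ?S" using nA by blast
  then show False using 1 2 by simp
qed

lemma antidiagonal_neighbour:
  assumes "connected_grid A" "connected_grid (- A)" and A: "(i, Suc j) \<in> A" "(Suc i, j) \<in> A"
  shows "(i, j) \<in> A \<or> (Suc i, Suc j) \<in> A"
proof (rule ccontr)
  assume "\<not> ?thesis"
  then have nA: "(i, j) \<notin> A" "(Suc i, Suc j) \<notin> A" by auto
  obtain xs where xs: "xs \<noteq> []" "hd xs = (i, Suc j)" "last xs = (Suc i, j)" "set xs \<subseteq> A"
    "successively adjacent xs"
    using connected_grid_walk[OF assms(1) A(1,2)] .
  let ?Z = "(Suc i, Suc j)"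
  let ?ws = "?Z # xs @ [?Z]"
  have Z: "?Z \<notin> set xs" using xs nA by auto
  have xs': "successively (\<lambda>p q. adjacent p q \<and> p \<noteq> ?Z \<and> q \<noteq> ?Z) xs"
    by (rule successively_mono[OF xs(5)]) (use Z in auto)
  have ad: "successively adjacent ?ws"
    using xs by (auto simp: successively_Cons successively_append_iff adjacent_def)
  have "step_sum (up_cross (Suc i) (Suc (Suc j))) xs = 0"
    by (rule step_sum_zero, rule successively_mono[OF xs'])
      (auto simp: up_cross_def adjacent_def of_bool_def prod_eq_iff split: if_splits)
  then have "step_sum (up_cross (Suc i) (Suc (Suc j))) ?ws = 0"
    using xs by (cases xs) (auto simp: step_sum_snoc up_cross_def simp flip: append_Cons)
  then have 1: "winding ?ws (Suc i) (Suc (Suc j)) = winding ?ws (Suc (Suc i)) (Suc (Suc j))"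
    using winding_right[of ?ws "Suc i" "Suc (Suc j)"] by simp
  have "step_sum (right_cross (Suc i) (Suc j)) xs = 0"
    by (rule step_sum_zero, rule successively_mono[OF xs'])
      (auto simp: right_cross_def adjacent_def of_bool_def prod_eq_iff split: if_splits)
  then have "step_sum (right_cross (Suc i) (Suc j)) ?ws = - 1"
    using xs by (cases xs) (auto simp: step_sum_snoc right_cross_def simp flip: append_Cons)
  then have 2: "winding ?ws (Suc i) (Suc (Suc j)) = winding ?ws (Suc i) (Suc j) - 1"
    using winding_up[of ?ws "Suc i" "Suc j"] ad by simp
  let ?S = "{c. c \<notin> A \<and> winding ?ws (Suc (fst c)) (Suc (snd c)) = winding ?ws (Suc i) (Suc j)}"
  have "?S = - A"
  proof (rule assms(2)[unfolded connected_grid_def, rule_format])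
    have "(i, j) \<in> ?S" using nA by simp
    then show "?S \<noteq> {}" by blast
    fix p q assume p: "p \<in> ?S" and q: "q \<in> - A" and a: "adjacent p q"
    have w: "winding ?ws (Suc k) l = winding ?ws k l"
       "winding ?ws k (Suc l) = winding ?ws k l"
       "winding ?ws (Suc k) (Suc l) = winding ?ws k l" if "(k, l) \<notin> A" "(k, l) \<noteq> ?Z" for k l
      using winding_cell[of ?ws k l] ad that xs(4) by auto
    obtain k l k' l' where [simp]: "p = (k, l)" "q = (k', l')" by (cases p, cases q)
    have "q \<in> ?S" if "p \<noteq> ?Z" "q \<noteq> ?Z"
      using w[of k l] w[of k' l'] p q a that unfolding adjacent_def by auto
    moreover have "q \<in> ?S" if "p = ?Z"
    proof -
      have "q = (Suc i, Suc (Suc j)) \<or> q = (Suc (Suc i), Suc j)"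
        using a that A q by (auto simp: adjacent_def)
      then show ?thesis using w[of k' l'] p q that by auto
    qed
    moreover have "q \<in> ?S" if "q = ?Z"
    proof -
      have "p = (Suc i, Suc (Suc j)) \<or> p = (Suc (Suc i), Suc j)"
        using a that A p by (auto simp: adjacent_def)
      then show ?thesis using w[of k l] p q that by auto
    qed
    ultimately show "q \<in> ?S" by blast
  qed auto
  then have "?Z \<in> ?S" using nA by blast
  then show False using 1 2 by simp
qed

text \<open>Walks are lists with the current position at the head.\<close>

fun reduced_walk :: "point set \<Rightarrow> point list \<Rightarrow> bool" where
  "reduced_walk A [] \<longleftrightarrow> False"
| "reduced_walk A [p] \<longleftrightarrow> p \<in> A"
| "reduced_walk A [p, q] \<longleftrightarrow> p \<in> A \<and> q \<in> A \<and> adjacent p q"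
| "reduced_walk A (p # q # r # ws) \<longleftrightarrow> p \<in> A \<and> adjacent p q \<and> p \<noteq> r \<and> reduced_walk A (q # r # ws)"

lemma reduced_walk_subset: "reduced_walk A ws \<Longrightarrow> set ws \<subseteq> A"
  by (induction A ws rule: reduced_walk.induct) auto

lemma reduced_walk_mono: "reduced_walk A ws \<Longrightarrow> A \<subseteq> B \<Longrightarrow> reduced_walk B ws"
  by (induction A ws rule: reduced_walk.induct) auto

lemma reduced_walk_adjacent: "reduced_walk A ws \<Longrightarrow> successively adjacent ws"
  by (induction A ws rule: reduced_walk.induct) auto

lemma reduced_walk_Cons: "reduced_walk A (p # ws) \<Longrightarrow> ws \<noteq> [] \<Longrightarrow> reduced_walk A ws"
  by (cases "(A, p # ws)" rule: reduced_walk.cases) auto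

lemma reduced_walk_distinct:
  assumes conn: "connected_grid (- A)" and pos: "A \<subseteq> {1..} \<times> {1..}" and thin: "thin_grid A"
  shows "reduced_walk A ws \<Longrightarrow> distinct ws"
proof (induction ws)
  case (Cons p ws)
  show ?case
  proof (cases "ws = []")
    case False
    then have rw: "reduced_walk A ws" using Cons.prems reduced_walk_Cons by blast
    then have d: "distinct ws" using Cons.IH by blast
    have "p \<notin> set ws"
    proof
      assume "p \<in> set ws"
      then obtain xs ys where e: "ws = xs @ p # ys" "p \<notin> set xs"
        by (meson split_list_first)
      have ad: "successively adjacent (p # xs @ p # ys)"
        using reduced_walk_adjacent[OF Cons.prems] e by simp
      obtain q xs' where q: "xs = q # xs'"
        using ad by (cases xs) (auto simp: adjacent_def)
      have ne: "xs' \<noteq> []" using Cons.prems e q by auto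
      have ad': "successively adjacent (p # q # xs' @ [p])"
        using ad q successively_append_iff[of adjacent "p # q # xs' @ [p]" ys] by simp
      have dd: "distinct (p # q # xs')" using d e q by auto
      have sub: "set (p # q # xs') \<subseteq> A" using reduced_walk_subset[OF Cons.prems] e q by auto
      show False
        by (rule cross_cycle[OF _ dd ne ad' conn pos thin sub]) (use ad' in simp)
    qed
    then show ?thesis using d by simp
  qed simp
qed simp

definition tree_grid :: "point set \<Rightarrow> bool" where
  "tree_grid A \<longleftrightarrow> finite A \<and> A \<noteq> {} \<and> A \<subseteq> {1..} \<times> {1..} \<and> connected_grid A \<and>
     (\<forall>ws. reduced_walk A ws \<longrightarrow> distinct ws) \<and>
     (\<forall>i j. (i, j) \<in> A \<longrightarrow> (Suc i, Suc j) \<in> A \<longrightarrow> (Suc i, j) \<in> A \<or> (i, Suc j) \<in> A) \<and>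
     (\<forall>i j. (i, Suc j) \<in> A \<longrightarrow> (Suc i, j) \<in> A \<longrightarrow> (i, j) \<in> A \<or> (Suc i, Suc j) \<in> A)"

lemma tree_grid_polyomino:
  assumes "polyomino P" "simple_polyomino P" "thin_polyomino P"
  shows "tree_grid {c. cell c \<in> P}"
proof -
  let ?A = "{c. cell c \<in> P}"
  have P: "P \<noteq> {}" "finite P" "P \<subseteq> cell ` ({1..} \<times> {1..})" "path_connected_cells P"
    using assms(1) unfolding polyomino_def by auto
  have c: "connected_grid ?A" using connected_grid_if_path_connected[OF P(4)] .
  have "{c. cell c \<in> cells - P} = - ?A" by (auto simp: cells_def)
  then have c': "connected_grid (- ?A)"
    using connected_grid_if_path_connected assms(2) unfolding simple_polyomino_def by metis
  have fin: "finite ?A" using finite_vimageI[OF P(2) inj_cell] by (simp add: vimage_def)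
  have ne: "?A \<noteq> {}" using P(1,3) by blast
  have pos: "?A \<subseteq> {1..} \<times> {1..}"
  proof
    fix x assume "x \<in> ?A"
    then obtain y where "cell x = cell y" "y \<in> {1..} \<times> {1..}" using P(3) by blast
    then show "x \<in> {1..} \<times> {1..}" using inj_cell by (auto dest: injD)
  qed
  have thin: "thin_grid ?A"
    using assms(3) unfolding thin_polyomino_def thin_grid_def by auto
  show ?thesis
    unfolding tree_grid_def
    using fin ne pos c reduced_walk_distinct[OF c' pos thin]
      diagonal_neighbour[OF c c'] antidiagonal_neighbour[OF c c'] by blast
qed

section \<open>Leaves at the end of maximal walks\<close>

definition is_turn :: "point \<Rightarrow> point \<Rightarrow> point \<Rightarrow> bool" where
  "is_turn p q r \<longleftrightarrow> fst p \<noteq> fst r \<and> snd p \<noteq> snd r"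

fun turns :: "point list \<Rightarrow> nat" where
  "turns (p # q # r # ws) = of_bool (is_turn p q r) + turns (q # r # ws)"
| "turns _ = 0"

fun last_turn :: "point list \<Rightarrow> nat" where
  "last_turn (p # q # r # ws) = (if is_turn p q r then length (r # ws) else last_turn (q # r # ws))"
| "last_turn _ = 0"

definition vconn :: "point set \<Rightarrow> point \<Rightarrow> point \<Rightarrow> bool" where
  "vconn A p q \<longleftrightarrow> fst p = fst q \<and>
     (\<forall>k. min (snd p) (snd q) \<le> k \<longrightarrow> k \<le> max (snd p) (snd q) \<longrightarrow> (fst p, k) \<in> A)"

lemma vconn_sym: "vconn A p q \<Longrightarrow> vconn A q p"
  unfolding vconn_def by (auto simp: min.commute max.commute)

lemma vconn_trans:
  assumes "vconn A p q" "vconn A q r" shows "vconn A p r"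
  unfolding vconn_def
proof (intro conjI allI impI)
  show "fst p = fst r" using assms unfolding vconn_def by simp
  fix k assume "min (snd p) (snd r) \<le> k" "k \<le> max (snd p) (snd r)"
  then have "min (snd p) (snd q) \<le> k \<and> k \<le> max (snd p) (snd q) \<or>
      min (snd q) (snd r) \<le> k \<and> k \<le> max (snd q) (snd r)" by linarith
  then show "(fst p, k) \<in> A" using assms unfolding vconn_def by metis
qed

lemma vconn_in: "vconn A p q \<Longrightarrow> p \<in> A" "vconn A p q \<Longrightarrow> q \<in> A"
  unfolding vconn_def by (cases p; cases q; auto)+

lemma vconn_refl: "p \<in> A \<Longrightarrow> vconn A p p"
  unfolding vconn_def by (cases p) auto

definition leaf :: "point set \<Rightarrow> point \<Rightarrow> point \<Rightarrow> bool" where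
  "leaf A c d \<longleftrightarrow> c \<in> A \<and> d \<in> A \<and> adjacent c d \<and> (\<forall>q\<in>A. adjacent c q \<longrightarrow> q = d)"

text \<open>On the side \<open>s\<close> of its vertical strip, the column of vertices at \<open>c\<close> does not continue beyond
  the end of the strip.\<close>

definition free_side :: "point set \<Rightarrow> point \<Rightarrow> nat \<Rightarrow> bool" where
  "free_side A c s \<longleftrightarrow> (s = Suc (fst c) \<or> fst c = Suc s) \<and>
     (\<forall>m m'. (m' = Suc m \<or> m = Suc m') \<longrightarrow> vconn A c (fst c, m) \<longrightarrow> (fst c, m') \<notin> A \<longrightarrow>
        (s, m) \<in> A \<longrightarrow> (s, m') \<notin> A)"

lemma run_decomposition:
  "reduced_walk A ((x, y) # (x, y') # ws) \<Longrightarrow>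
   \<exists>e us. reduced_walk A ((x, e) # us) \<and> vconn A (x, y) (x, e) \<and>
     (us = [] \<or> snd (hd us) = e) \<and>
     turns ((x, y) # (x, y') # ws) = turns ((x, e) # us) + of_bool (us \<noteq> []) \<and>
     last_turn ((x, y) # (x, y') # ws) = length us"
proof (induction ws arbitrary: y y')
  case Nil
  then have "vconn A (x, y) (x, y')" by (auto simp: vconn_def adjacent_def le_Suc_eq max_def min_def)
  then show ?case using Nil
    by (intro exI[of _ y'] exI[of _ "[]"]) auto
next
  case (Cons r ws)
  have v: "vconn A (x, y) (x, y')"
  proof -
    have "(x, y') \<in> A" using reduced_walk_subset[OF Cons.prems] by simp
    then show ?thesis using Cons.prems by (auto simp: vconn_def adjacent_def le_Suc_eq max_def min_def)
  qed
  show ?case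
  proof (cases "fst r = x")
    case True
    then obtain z where r: "r = (x, z)" by (cases r) auto
    have "reduced_walk A ((x, y') # (x, z) # ws)" using Cons.prems r by simp
    from Cons.IH[OF this] obtain e us where e: "reduced_walk A ((x, e) # us)" "vconn A (x, y') (x, e)"
      "us = [] \<or> snd (hd us) = e"
      "turns ((x, y') # (x, z) # ws) = turns ((x, e) # us) + of_bool (us \<noteq> [])"
      "last_turn ((x, y') # (x, z) # ws) = length us" by blast
    show ?thesis
      by (rule exI[of _ e], rule exI[of _ us]) (use e r vconn_trans[OF v e(2)] in \<open>auto simp: is_turn_def\<close>)
  next
    case False
    have rw: "reduced_walk A ((x, y') # r # ws)" using Cons.prems by simp
    then have "adjacent (x, y') r" using reduced_walk_adjacent by fastforce
    then have "snd r = y'" using False by (auto simp: adjacent_def)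
    moreover have "y \<noteq> y'" using Cons.prems by (auto simp: adjacent_def)
    ultimately show ?thesis
      by (intro exI[of _ y'] exI[of _ "r # ws"]) (use rw v False in \<open>auto simp: is_turn_def\<close>)
  qed
qed

lemma reduced_walk_extend:
  "reduced_walk A (q # ws) \<Longrightarrow> p \<in> A \<Longrightarrow> adjacent p q \<Longrightarrow> (ws \<noteq> [] \<Longrightarrow> p \<noteq> hd ws) \<Longrightarrow>
    reduced_walk A (p # q # ws)"
  by (cases ws) auto

lemma extend_vertical:
  assumes "reduced_walk A ((x, e) # us)" "us = [] \<or> snd (hd us) = e"
    "vconn A (x, e) (x, m)" "m \<noteq> e"
  shows "\<exists>k vs. reduced_walk A ((x, m) # (x, k) # vs) \<and> k \<noteq> m \<and>
     turns ((x, m) # (x, k) # vs) = turns ((x, e) # us) + of_bool (us \<noteq> [])"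
proof (cases "e < m")
  case True
  then obtain n where n: "m = Suc (e + n)" using less_iff_Suc_add by auto
  have A: "(x, e + k) \<in> A" if "k \<le> Suc n" for k
    using assms(3) that n unfolding vconn_def by auto
  have "n' \<le> n \<Longrightarrow> \<exists>vs. reduced_walk A ((x, Suc (e + n')) # (x, e + n') # vs) \<and>
     turns ((x, Suc (e + n')) # (x, e + n') # vs) = turns ((x, e) # us) + of_bool (us \<noteq> [])" for n'
  proof (induction n')
    case 0
    have "reduced_walk A ((x, Suc e) # (x, e) # us)"
      using assms(1,2) A[of 1] by (cases us) (auto simp: adjacent_def)
    moreover have "turns ((x, Suc e) # (x, e) # us) = turns ((x, e) # us) + of_bool (us \<noteq> [])"
      using assms(2) reduced_walk_adjacent[OF assms(1)]
      by (cases us) (auto simp: is_turn_def adjacent_def)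
    ultimately show ?case by auto
  next
    case (Suc n')
    then obtain vs where vs: "reduced_walk A ((x, Suc (e + n')) # (x, e + n') # vs)"
     "turns ((x, Suc (e + n')) # (x, e + n') # vs) = turns ((x, e) # us) + of_bool (us \<noteq> [])" by auto
    show ?case
      by (rule exI[of _ "(x, e + n') # vs"]) (use vs Suc.prems A[of "Suc (Suc n')"] in \<open>auto simp: adjacent_def is_turn_def\<close>)
  qed
  from this[of n] show ?thesis using n by fastforce
next
  case False
  then obtain n where n: "e = Suc (m + n)" using assms(4) less_iff_Suc_add by (metis add_Suc linorder_less_linear)
  have A: "(x, m + k) \<in> A" if "k \<le> Suc n" for k
    using assms(3) that n unfolding vconn_def by auto
  have "n' \<le> n \<Longrightarrow> \<exists>vs. reduced_walk A ((x, m + (n - n')) # (x, Suc (m + (n - n'))) # vs) \<and>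
     turns ((x, m + (n - n')) # (x, Suc (m + (n - n'))) # vs) = turns ((x, e) # us) + of_bool (us \<noteq> [])" for n'
  proof (induction n')
    case 0
    have "reduced_walk A ((x, m + n) # (x, e) # us)"
      using assms(1,2) A[of n] n by (cases us) (auto simp: adjacent_def)
    moreover have "turns ((x, m + n) # (x, e) # us) = turns ((x, e) # us) + of_bool (us \<noteq> [])"
      using assms(2) reduced_walk_adjacent[OF assms(1)] n
      by (cases us) (auto simp: is_turn_def adjacent_def)
    ultimately show ?case using n by auto
  next
    case (Suc n')
    then obtain vs where vs: "reduced_walk A ((x, m + (n - n')) # (x, Suc (m + (n - n'))) # vs)"
     "turns ((x, m + (n - n')) # (x, Suc (m + (n - n'))) # vs) = turns ((x, e) # us) + of_bool (us \<noteq> [])" by auto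
    obtain k where k: "n - n' = Suc k" "n - Suc n' = k" using Suc.prems by (metis Suc_diff_Suc Suc_le_lessD)
    have "k \<le> n" using k by linarith
    then show ?case
      by (intro exI[of _ "(x, Suc (m + (n - n'))) # vs"]) (use vs k A[of k] in \<open>auto simp: adjacent_def is_turn_def\<close>)
  qed
  from this[of n] show ?thesis by fastforce
qed

definition maximal_walk :: "point set \<Rightarrow> point list \<Rightarrow> bool" where
  "maximal_walk A ws \<longleftrightarrow> reduced_walk A ws \<and>
     (\<forall>vs. reduced_walk A vs \<longrightarrow> (turns vs, last_turn vs, length vs) \<le> (turns ws, last_turn ws, length ws))"

lemma maximal_walk_free_side:
  assumes max: "maximal_walk A ((x, y) # (x, y') # ws)" and pos: "A \<subseteq> {1..} \<times> {1..}"
  shows "\<exists>s. free_side A (x, y) s"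
proof (rule ccontr)
  assume no: "\<not> ?thesis"
  let ?w = "(x, y) # (x, y') # ws"
  have rw: "reduced_walk A ?w" and mx: "\<And>vs. reduced_walk A vs \<Longrightarrow>
    turns vs < turns ?w \<or> turns vs = turns ?w \<and> last_turn vs \<le> last_turn ?w"
    using max unfolding maximal_walk_def by (auto simp: less_eq_prod_def)
  have x: "x \<noteq> 0" using reduced_walk_subset[OF rw] pos by auto
  obtain e us where e: "reduced_walk A ((x, e) # us)" "vconn A (x, y) (x, e)" "us = [] \<or> snd (hd us) = e"
     "turns ?w = turns ((x, e) # us) + of_bool (us \<noteq> [])" "last_turn ?w = length us"
    using run_decomposition[OF rw] by blast
  have side: "us \<noteq> [] \<and> hd us = (s, e)" if s: "s = Suc x \<or> x = Suc s" for s
  proof -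
    obtain m m' where m: "m' = Suc m \<or> m = Suc m'" "vconn A (x, y) (x, m)" "(s, m) \<in> A" "(s, m') \<in> A"
    proof -
      have "\<not> free_side A (x, y) s" using no by blast
      then show thesis using that s unfolding free_side_def fst_conv by blast
    qed
    have "m = e"
    proof (rule ccontr)
      assume "m \<noteq> e"
      obtain k vs where k: "reduced_walk A ((x, m) # (x, k) # vs)" "k \<noteq> m"
        "turns ((x, m) # (x, k) # vs) = turns ((x, e) # us) + of_bool (us \<noteq> [])"
        using extend_vertical[OF e(1,3) vconn_trans[OF vconn_sym[OF e(2)] m(2)] \<open>m \<noteq> e\<close>] by blast
      have "reduced_walk A ((s, m) # (x, m) # (x, k) # vs)"
        using k m s by (auto simp: adjacent_def)
      from mx[OF this] show False using k e(4) s by (auto simp: is_turn_def)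
    qed
    show ?thesis
    proof (rule ccontr)
      assume n: "\<not> ?thesis"
      have r1: "reduced_walk A ((s, e) # (x, e) # us)"
        by (rule reduced_walk_extend[OF e(1)]) (use m \<open>m = e\<close> s n in \<open>auto simp: adjacent_def\<close>)
      have r2: "reduced_walk A ((s, m') # (s, e) # (x, e) # us)"
        using r1 m \<open>m = e\<close> s by (auto simp: adjacent_def)
      have "turns ((s, e) # (x, e) # us) = turns ((x, e) # us)"
        using e(3) by (cases us) (auto simp: is_turn_def)
      then show False using mx[OF r2] e(4,5) m(1) \<open>m = e\<close> s n by (auto simp: is_turn_def split: if_splits)
    qed
  qed
  from side[of "Suc x"] side[of "x - 1"] x show False by auto
qed

lemma reduced_walk_swap: "reduced_walk A ws \<Longrightarrow> reduced_walk (prod.swap ` A) (map prod.swap ws)"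
  by (induction A ws rule: reduced_walk.induct) (auto simp: adjacent_def prod.swap_def prod_eq_iff)

lemma turns_swap: "turns (map prod.swap ws) = turns ws"
  by (induction ws rule: turns.induct) (auto simp: is_turn_def)

lemma last_turn_swap: "last_turn (map prod.swap ws) = last_turn ws"
  by (induction ws rule: last_turn.induct) (auto simp: is_turn_def)

lemma swap_swap_image: "prod.swap ` prod.swap ` A = A"
  by (auto simp: image_image)

lemma maximal_walk_swap:
  assumes "maximal_walk A ws" shows "maximal_walk (prod.swap ` A) (map prod.swap ws)"
  unfolding maximal_walk_def
proof (intro conjI allI impI)
  show "reduced_walk (prod.swap ` A) (map prod.swap ws)"
    using assms reduced_walk_swap unfolding maximal_walk_def by blast
  fix vs assume "reduced_walk (prod.swap ` A) vs"
  then have "reduced_walk A (map prod.swap vs)"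
    using reduced_walk_swap[of "prod.swap ` A" vs] by (simp add: swap_swap_image)
  then show "(turns vs, last_turn vs, length vs) \<le>
     (turns (map prod.swap ws), last_turn (map prod.swap ws), length (map prod.swap ws))"
    using assms unfolding maximal_walk_def by (metis turns_swap last_turn_swap length_map)
qed

lemma maximal_walk_exists:
  assumes "finite A" "\<And>ws. reduced_walk A ws \<Longrightarrow> distinct ws" "A \<noteq> {}"
  obtains ws where "maximal_walk A ws"
proof -
  let ?W = "{ws. reduced_walk A ws}" and ?f = "\<lambda>ws. (turns ws, last_turn ws, length ws)"
  have "?W \<subseteq> {ws. set ws \<subseteq> A \<and> length ws \<le> card A}"
  proof safe
    fix ws p assume "reduced_walk A ws" "p \<in> set ws"
    then show "p \<in> A" using reduced_walk_subset by blast
  next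
    fix ws assume r: "reduced_walk A ws"
    show "length ws \<le> card A"
      using card_mono[OF assms(1) reduced_walk_subset[OF r]] distinct_card[OF assms(2)[OF r]] by simp
  qed
  then have fin: "finite ?W" using finite_lists_length_le[OF assms(1)] finite_subset by blast
  obtain p where "p \<in> A" using assms(3) by blast
  then have "reduced_walk A [p]" by simp
  then have ne: "?f ` ?W \<noteq> {}" by blast
  obtain ws where "ws \<in> ?W" "?f ws = Max (?f ` ?W)"
    using Max_in[OF finite_imageI[OF fin] ne] by (metis (no_types, lifting) imageE)
  then have "maximal_walk A ws"
    unfolding maximal_walk_def using Max_ge[OF finite_imageI[OF fin, of ?f]] by auto
  then show thesis using that by blast
qed

lemma good_leaf:
  assumes A: "tree_grid A" and two: "A \<noteq> {c0}" "c0 \<in> A"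
  obtains c d where "leaf A c d"
    "fst c = fst d \<and> (\<exists>s. free_side A c s) \<or>
     snd c = snd d \<and> (\<exists>s. free_side (prod.swap ` A) (prod.swap c) s)"
proof -
  have A': "finite A" "A \<noteq> {}" "\<And>ws. reduced_walk A ws \<Longrightarrow> distinct ws" "A \<subseteq> {1..} \<times> {1..}"
    "connected_grid A" using A unfolding tree_grid_def by blast+
  obtain w where w: "maximal_walk A w" using maximal_walk_exists[OF A'(1,3,2)] .
  then have rw: "reduced_walk A w" and mx: "\<And>vs. reduced_walk A vs \<Longrightarrow>
    (turns vs, last_turn vs, length vs) \<le> (turns w, last_turn w, length w)"
    unfolding maximal_walk_def by auto
  obtain p q where pq: "p \<in> A" "q \<in> A" "adjacent p q"
    using A'(5)[unfolded connected_grid_def, rule_format, of "{c0}"] two by blast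
  then have "reduced_walk A [p, q]" by simp
  from mx[OF this] have "turns w \<noteq> 0 \<or> last_turn w \<noteq> 0 \<or> length w \<ge> 2" by (auto simp: less_eq_prod_def)
  then obtain c d ws where e: "w = c # d # ws"
    using rw by (cases w rule: turns.cases) auto
  have d: "adjacent c d" using reduced_walk_adjacent[OF rw] e by auto
  have leaf: "leaf A c d"
    unfolding leaf_def
  proof (intro conjI ballI impI)
    show "c \<in> A" "d \<in> A" using reduced_walk_subset[OF rw] e by auto
    show "adjacent c d" using d .
    fix q assume q: "q \<in> A" "adjacent c q"
    show "q = d"
    proof (rule ccontr)
      assume "q \<noteq> d"
      then have "reduced_walk A (q # w)" using rw q e adjacent_sym by auto
      from mx[OF this] show False using e by (auto split: if_splits simp: of_bool_def)
    qed
  qed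
  show thesis
  proof (cases "fst c = fst d")
    case True
    then have "\<exists>s. free_side A c s"
      using maximal_walk_free_side[of A "fst c" "snd c" "snd d" ws] w e A'(4) by (metis prod.collapse)
    then show thesis using that leaf True by blast
  next
    case False
    then have s: "snd c = snd d" using d by (auto simp: adjacent_def)
    have "maximal_walk (prod.swap ` A) ((snd c, fst c) # (snd c, fst d) # map prod.swap ws)"
      using maximal_walk_swap[OF w] e s by (simp add: prod.swap_def)
    then have "\<exists>t. free_side (prod.swap ` A) (snd c, fst c) t"
      by (rule maximal_walk_free_side) (use A'(4) in auto)
    then show thesis using that leaf s by (simp add: prod.swap_def)
  qed
qed

lemma connected_grid_remove_leaf:
  assumes "connected_grid A" "leaf A c d"
  shows "connected_grid (A - {c})"
  unfolding connected_grid_def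
proof (intro allI impI)
  fix S assume S: "S \<subseteq> A - {c}" "S \<noteq> {}" and cl: "\<forall>p\<in>S. \<forall>q\<in>A - {c}. adjacent p q \<longrightarrow> q \<in> S"
  have l: "c \<in> A" "adjacent c d" "\<And>q. q \<in> A \<Longrightarrow> adjacent c q \<Longrightarrow> q = d"
    using assms(2) unfolding leaf_def by blast+
  show "S = A - {c}"
  proof (cases "d \<in> S")
    case True
    have "insert c S = A"
      by (rule assms(1)[unfolded connected_grid_def, rule_format]) (use S cl l True in auto)
    then show ?thesis using S by blast
  next
    case False
    have "S = A"
    proof (rule assms(1)[unfolded connected_grid_def, rule_format])
      fix p q assume pq: "p \<in> S" "q \<in> A" "adjacent p q"
      then have "q \<noteq> c" using l(3)[of p] adjacent_sym S False by blast
      then show "q \<in> S" using cl pq by blast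
    qed (use S in auto)
    then show ?thesis using S l by blast
  qed
qed

lemma tree_grid_remove_leaf:
  assumes A: "tree_grid A" and l: "leaf A c d"
  shows "tree_grid (A - {c})"
proof -
  have u: "q = q'" if "q \<in> A" "q' \<in> A" "adjacent c q" "adjacent c q'" for q q'
    using l that unfolding leaf_def by blast
  have d: "d \<in> A - {c}" using l unfolding leaf_def adjacent_def by auto
  have "(Suc i, j) \<in> A - {c} \<or> (i, Suc j) \<in> A - {c}"
    if "(i, j) \<in> A - {c}" "(Suc i, Suc j) \<in> A - {c}" for i j
  proof -
    have "c \<noteq> (Suc i, j)" "c \<noteq> (i, Suc j)"
      using u[of "(i, j)" "(Suc i, Suc j)"] that by (auto simp: adjacent_def)
    then show ?thesis using A that unfolding tree_grid_def by blast
  qed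
  moreover have "(i, j) \<in> A - {c} \<or> (Suc i, Suc j) \<in> A - {c}"
    if "(i, Suc j) \<in> A - {c}" "(Suc i, j) \<in> A - {c}" for i j
  proof -
    have "c \<noteq> (i, j)" "c \<noteq> (Suc i, Suc j)"
      using u[of "(i, Suc j)" "(Suc i, j)"] that by (auto simp: adjacent_def)
    then show ?thesis using A that unfolding tree_grid_def by blast
  qed
  moreover have "connected_grid (A - {c})"
    using connected_grid_remove_leaf l A unfolding tree_grid_def by blast
  moreover have "distinct ws" if "reduced_walk (A - {c}) ws" for ws
    using that reduced_walk_mono[of "A - {c}" ws A] A unfolding tree_grid_def by blast
  moreover have "finite (A - {c})" "A - {c} \<noteq> {}" "A - {c} \<subseteq> {1..} \<times> {1..}"
    using A d unfolding tree_grid_def by auto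
  ultimately show ?thesis unfolding tree_grid_def by blast
qed

section \<open>Strips of a tree-like polyomino\<close>

definition vstrip :: "point set \<Rightarrow> point \<Rightarrow> point set" where
  "vstrip A p = {q. vconn A p q}"

definition vstrips :: "point set \<Rightarrow> point set set" where
  "vstrips A = vstrip A ` A"

definition hstrips :: "point set \<Rightarrow> point set set" where
  "hstrips A = (`) prod.swap ` vstrips (prod.swap ` A)"

inductive strip_tree :: "'a set set \<Rightarrow> 'a set set \<Rightarrow> bool" where
  single_cell: "strip_tree {{c}} {{c}}"
| vertical: "strip_tree H V \<Longrightarrow> c \<notin> \<Union>H \<Longrightarrow> s \<in> V \<Longrightarrow>
    strip_tree (insert {c} H) (insert (insert c s) (V - {s}))"
| horizontal: "strip_tree H V \<Longrightarrow> c \<notin> \<Union>H \<Longrightarrow> s \<in> H \<Longrightarrow>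
    strip_tree (insert (insert c s) (H - {s})) (insert {c} V)"

lemma strip_tree_Union: "strip_tree H V \<Longrightarrow> \<Union>H = \<Union>V"
  by (induction rule: strip_tree.induct) auto

lemma strip_tree_finite: "strip_tree H V \<Longrightarrow> finite H \<and> finite V \<and> (\<forall>s\<in>H \<union> V. finite s)"
  by (induction rule: strip_tree.induct) auto

lemma strip_tree_sum_eq:
  fixes y :: "'a \<Rightarrow> 'b::comm_monoid_add"
  shows "strip_tree H V \<Longrightarrow> (\<Sum>s\<in>H. sum y s) = (\<Sum>s\<in>V. sum y s)"
proof (induction rule: strip_tree.induct)
  case (vertical H V c s)
  have V: "c \<notin> \<Union>V" and fin: "finite H" "finite V" "finite s"
    using strip_tree_Union[OF vertical.hyps(1)] strip_tree_finite[OF vertical.hyps(1)] vertical.hyps(2,3) by auto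
  have "(\<Sum>s\<in>insert {c} H. sum y s) = y c + (\<Sum>s\<in>H. sum y s)"
    using vertical fin by (subst sum.insert) auto
  also have "\<dots> = y c + (sum y s + (\<Sum>s\<in>V - {s}. sum y s))"
    using vertical fin by (simp add: sum.remove)
  also have "\<dots> = sum y (insert c s) + (\<Sum>s\<in>V - {s}. sum y s)"
    using V vertical.hyps(3) fin by (subst sum.insert) (auto simp: add.assoc)
  also have "\<dots> = (\<Sum>s\<in>insert (insert c s) (V - {s}). sum y s)"
    using V fin by (subst sum.insert) auto
  finally show ?case .
next
  case (horizontal H V c s)
  have V: "c \<notin> \<Union>V" and fin: "finite H" "finite V" "finite s"
    using strip_tree_Union[OF horizontal.hyps(1)] strip_tree_finite[OF horizontal.hyps(1)] horizontal.hyps(2,3) by auto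
  have "(\<Sum>s\<in>insert {c} V. sum y s) = y c + (\<Sum>s\<in>V. sum y s)"
    using V fin by (subst sum.insert) auto
  also have "\<dots> = y c + (sum y s + (\<Sum>s\<in>H - {s}. sum y s))"
    using horizontal fin by (simp add: sum.remove flip: horizontal.IH)
  also have "\<dots> = sum y (insert c s) + (\<Sum>s\<in>H - {s}. sum y s)"
    using horizontal.hyps(2,3) fin by (subst sum.insert) (auto simp: add.assoc)
  also have "\<dots> = (\<Sum>s\<in>insert (insert c s) (H - {s}). sum y s)"
    using horizontal.hyps(2) fin by (subst sum.insert) auto
  finally show ?case by simp
qed simp

lemma strip_tree_balanced:
  fixes tH tV :: "'a set \<Rightarrow> int"
  shows "strip_tree H V \<Longrightarrow> sum tH H = sum tV V \<Longrightarrow>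
    \<exists>D. (\<forall>s\<in>H. sum D s = tH s) \<and> (\<forall>s\<in>V. sum D s = tV s)"
proof (induction arbitrary: tH tV rule: strip_tree.induct)
  case (single_cell c)
  then show ?case by (intro exI[of _ "\<lambda>_. tH {c}"]) auto
next
  case (vertical H V c s)
  have V: "c \<notin> \<Union>V" and fin: "finite H" "finite V" "finite s"
    using strip_tree_Union[OF vertical.hyps(1)] strip_tree_finite[OF vertical.hyps(1)] vertical.hyps(2,3) by auto
  let ?tV = "tV(s := tV (insert c s) - tH {c})"
  have "sum tH (insert {c} H) = tH {c} + sum tH H"
    using vertical fin by (subst sum.insert) auto
  moreover have "sum tV (insert (insert c s) (V - {s})) = tV (insert c s) + sum tV (V - {s})"
    using V fin by (subst sum.insert) auto
  moreover have "sum ?tV V = ?tV s + sum ?tV (V - {s})"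
    using vertical fin by (simp add: sum.remove)
  moreover have "sum ?tV (V - {s}) = sum tV (V - {s})" by (rule sum.cong) auto
  ultimately have "sum tH H = sum ?tV V" using vertical.prems by simp
  from vertical.IH[OF this] obtain D where D: "\<forall>s\<in>H. sum D s = tH s" "\<forall>s\<in>V. sum D s = ?tV s"
    by blast
  let ?D = "D(c := tH {c})"
  have eq: "sum ?D t = sum D t" if "c \<notin> t" for t
    by (rule sum.cong) (use that in auto)
  have "sum ?D (insert c s) = tV (insert c s)"
    using V vertical.hyps(3) fin D(2) eq[of s] by (subst sum.insert) auto
  moreover have "sum ?D t = tH t" if "t \<in> H" for t
    using that eq[of t] vertical.hyps(2) D(1) by auto
  moreover have "sum ?D t = tV t" if "t \<in> V - {s}" for t
    using that eq[of t] V D(2) by auto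
  ultimately show ?case by (intro exI[of _ ?D]) auto
next
  case (horizontal H V c s)
  have V: "c \<notin> \<Union>V" and fin: "finite H" "finite V" "finite s"
    using strip_tree_Union[OF horizontal.hyps(1)] strip_tree_finite[OF horizontal.hyps(1)] horizontal.hyps(2,3) by auto
  let ?tH = "tH(s := tH (insert c s) - tV {c})"
  have "sum tV (insert {c} V) = tV {c} + sum tV V"
    using V fin by (subst sum.insert) auto
  moreover have "sum tH (insert (insert c s) (H - {s})) = tH (insert c s) + sum tH (H - {s})"
    using horizontal.hyps(2) fin by (subst sum.insert) auto
  moreover have "sum ?tH H = ?tH s + sum ?tH (H - {s})"
    using horizontal fin by (simp add: sum.remove)
  moreover have "sum ?tH (H - {s}) = sum tH (H - {s})" by (rule sum.cong) auto
  ultimately have "sum ?tH H = sum tV V" using horizontal.prems by simp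
  from horizontal.IH[OF this] obtain D where D: "\<forall>s\<in>H. sum D s = ?tH s" "\<forall>s\<in>V. sum D s = tV s"
    by blast
  let ?D = "D(c := tV {c})"
  have eq: "sum ?D t = sum D t" if "c \<notin> t" for t
    by (rule sum.cong) (use that in auto)
  have "sum ?D (insert c s) = tH (insert c s)"
    using horizontal.hyps(2,3) fin D(1) eq[of s] by (subst sum.insert) auto
  moreover have "sum ?D t = tV t" if "t \<in> V" for t
    using that eq[of t] V D(2) by auto
  moreover have "sum ?D t = tH t" if "t \<in> H - {s}" for t
    using that eq[of t] horizontal.hyps(2) D(1) by auto
  ultimately show ?case by (intro exI[of _ ?D]) auto
qed

lemma strip_tree_generate:
  fixes y :: "'a \<Rightarrow> 'b::ab_group_add"
  assumes "\<And>u v. u \<in> G \<Longrightarrow> v \<in> G \<Longrightarrow> u - v \<in> G"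
  shows "strip_tree H V \<Longrightarrow> (\<And>s. s \<in> H \<union> V \<Longrightarrow> sum y s \<in> G) \<Longrightarrow> c \<in> \<Union>H \<Longrightarrow> y c \<in> G"
proof (induction arbitrary: c rule: strip_tree.induct)
  case (single_cell c')
  from single_cell(1)[of "{c'}"] single_cell(2) show ?case by simp
next
  case (vertical H V c' s)
  have V: "c' \<notin> \<Union>V" and fin: "finite s"
    using strip_tree_Union[OF vertical.hyps(1)] strip_tree_finite[OF vertical.hyps(1)] vertical.hyps(2,3) by auto
  have y: "y c' \<in> G" using vertical.prems(1)[of "{c'}"] by simp
  have "sum y (insert c' s) = y c' + sum y s"
    using V vertical.hyps(3) fin by (subst sum.insert) auto
  then have "sum y s \<in> G" using assms[OF vertical.prems(1)[of "insert c' s"] y] by simp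
  then have "sum y t \<in> G" if "t \<in> H \<union> V" for t using that vertical.prems(1) by blast
  then show ?case using vertical.IH vertical.prems(2) y by blast
next
  case (horizontal H V c' s)
  have fin: "finite s"
    using strip_tree_finite[OF horizontal.hyps(1)] horizontal.hyps(3) by auto
  have y: "y c' \<in> G" using horizontal.prems(1)[of "{c'}"] by simp
  have "sum y (insert c' s) = y c' + sum y s"
    using horizontal.hyps(2,3) fin by (subst sum.insert) auto
  then have "sum y s \<in> G" using assms[OF horizontal.prems(1)[of "insert c' s"] y] by simp
  then have "sum y t \<in> G" if "t \<in> H \<union> V" for t using that horizontal.prems(1) by blast
  then show ?case using horizontal.IH horizontal.prems(2) y horizontal.hyps(3) by blast
qed

lemma vconn_remove_leaf:
  assumes l: "leaf A c d" and pq: "p \<noteq> c" "q \<noteq> c"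
  shows "vconn (A - {c}) p q \<longleftrightarrow> vconn A p q"
proof
  assume v: "vconn A p q"
  have "c \<noteq> (fst p, k)" if k: "min (snd p) (snd q) \<le> k" "k \<le> max (snd p) (snd q)" for k
  proof
    assume c: "c = (fst p, k)"
    have f: "fst p = fst q" using v by (simp add: vconn_def)
    have kk: "min (snd p) (snd q) < k \<and> k < max (snd p) (snd q)"
      using k pq c f by (auto simp: prod_eq_iff min_def max_def split: if_splits)
    then obtain k' where [simp]: "k = Suc k'" by (cases k) auto
    have "(fst p, k') \<in> A" "(fst p, Suc k) \<in> A" using v kk unfolding vconn_def by auto
    moreover have "adjacent c (fst p, k')" "adjacent c (fst p, Suc k)" using c by (auto simp: adjacent_def)
    ultimately have "d = (fst p, k')" "d = (fst p, Suc k)" using l unfolding leaf_def by blast+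
    then show False by simp
  qed
  then show "vconn (A - {c}) p q" using v unfolding vconn_def by auto
qed (auto simp: vconn_def)

lemma vstrip_remove_leaf_horizontal:
  assumes l: "leaf A c d" and h: "snd c = snd d"
  shows "vstrips A = insert {c} (vstrips (A - {c}))"
proof -
  have c: "c \<in> A" using l by (simp add: leaf_def)
  have nc: "\<not> vconn A c p" if "p \<noteq> c" for p
  proof
    assume v: "vconn A c p"
    then have f: "fst p = fst c" "snd p \<noteq> snd c" using that by (auto simp: vconn_def prod_eq_iff)
    let ?k = "if snd p < snd c then snd c - 1 else Suc (snd c)"
    have "min (snd c) (snd p) \<le> ?k \<and> ?k \<le> max (snd c) (snd p)" using f by auto
    then have "(fst c, ?k) \<in> A" using v unfolding vconn_def by blast
    moreover have "adjacent c (fst c, ?k)" using f by (auto simp: adjacent_def)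
    ultimately have "d = (fst c, ?k)" using l unfolding leaf_def by blast
    then show False using h f by (auto split: if_splits)
  qed
  have "vstrip A c = {c}" using nc vconn_refl[OF c] by (auto simp: vstrip_def)
  moreover have "vstrip A p = vstrip (A - {c}) p" if "p \<in> A - {c}" for p
  proof -
    have "p \<noteq> c" using that by blast
    have "vconn A p q \<longleftrightarrow> vconn (A - {c}) p q" for q
      using vconn_remove_leaf[OF l \<open>p \<noteq> c\<close>, of q] nc[OF \<open>p \<noteq> c\<close>] vconn_sym vconn_in(2)
      by (cases "q = c") blast+
    then show ?thesis by (simp add: vstrip_def)
  qed
  moreover have "A = insert c (A - {c})" using c by blast
  ultimately show ?thesis unfolding vstrips_def by (metis (no_types, lifting) image_cong image_insert)
qed

lemma vstrip_remove_leaf_vertical: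
  assumes l: "leaf A c d" and h: "fst c = fst d"
  shows "vstrips A = insert (insert c (vstrip (A - {c}) d)) (vstrips (A - {c}) - {vstrip (A - {c}) d})"
proof -
  let ?s = "vstrip (A - {c}) d"
  have c: "c \<in> A" and d: "d \<in> A" "d \<noteq> c" and ad: "adjacent c d"
    using l unfolding leaf_def by (auto simp: adjacent_def)
  have cd: "vconn A c d"
    using h ad c d by (cases c; cases d) (auto simp: vconn_def adjacent_def le_Suc_eq max_def min_def)
  have s: "q \<in> ?s \<longleftrightarrow> q \<noteq> c \<and> vconn A c q" for q
  proof (cases "q = c")
    case True
    then show ?thesis using vconn_in(2)[of "A - {c}" d c] by (auto simp: vstrip_def)
  next
    case False
    then show ?thesis
      using vconn_remove_leaf[OF l d(2) False] vconn_trans[OF cd, of q] vconn_trans[OF vconn_sym[OF cd], of q]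
      by (auto simp: vstrip_def)
  qed
  have cs: "vstrip A c = insert c ?s"
    using s vconn_refl[OF c] by (auto simp: vstrip_def)
  have in_s: "vstrip A p = insert c ?s" "vstrip (A - {c}) p = ?s" if "p \<in> ?s" for p
  proof -
    have "vconn A c p" "vconn (A - {c}) d p" using that s by (auto simp: vstrip_def)
    then have "vconn A p q \<longleftrightarrow> vconn A c q" "vconn (A - {c}) p q \<longleftrightarrow> vconn (A - {c}) d q" for q
      by (metis vconn_trans vconn_sym)+
    then have "vstrip A p = vstrip A c" "vstrip (A - {c}) p = ?s" by (simp_all add: vstrip_def)
    then show "vstrip A p = insert c ?s" "vstrip (A - {c}) p = ?s" by (simp_all only: cs)
  qed
  have out: "vstrip A p = vstrip (A - {c}) p" "vstrip (A - {c}) p \<noteq> ?s" if "p \<in> A - {c}" "p \<notin> ?s" for p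
  proof -
    have p: "p \<noteq> c" "\<not> vconn A c p" using that s by auto
    have "vconn A p q \<longleftrightarrow> vconn (A - {c}) p q" for q
      using vconn_remove_leaf[OF l p(1), of q] p(2) vconn_sym vconn_in(2) by (cases "q = c") blast+
    then show "vstrip A p = vstrip (A - {c}) p" by (simp add: vstrip_def)
    have "p \<in> vstrip (A - {c}) p" using that vconn_refl by (auto simp: vstrip_def)
    then show "vstrip (A - {c}) p \<noteq> ?s" using that by blast
  qed
  have sA: "?s \<subseteq> A - {c}" using vconn_in(2)[of "A - {c}" d] by (auto simp: vstrip_def)
  have dS: "d \<in> ?s" using s d cd by blast
  have A: "A = insert c (?s \<union> ((A - {c}) - ?s))" using c sA by blast
  have 1: "vstrips A = insert (insert c ?s) (vstrip A ` ?s \<union> vstrip A ` ((A - {c}) - ?s))"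
    unfolding vstrips_def by (subst (2) A) (auto simp: cs)
  have 2: "vstrip A ` ?s = {insert c ?s}" using in_s(1) dS by blast
  have 3: "vstrip A ` ((A - {c}) - ?s) = vstrip (A - {c}) ` ((A - {c}) - ?s)"
    using out(1) by (intro image_cong) auto
  have "vstrips (A - {c}) = vstrip (A - {c}) ` ?s \<union> vstrip (A - {c}) ` ((A - {c}) - ?s)"
    unfolding vstrips_def using sA by blast
  moreover have "vstrip (A - {c}) ` ?s = {?s}" using in_s(2) dS by blast
  ultimately have "vstrips (A - {c}) - {?s} = vstrip (A - {c}) ` ((A - {c}) - ?s)"
    using out(2) by auto
  then show ?thesis using 1 2 3 by simp
qed

lemma leaf_swap: "leaf A c d \<Longrightarrow> leaf (prod.swap ` A) (prod.swap c) (prod.swap d)"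
  unfolding leaf_def adjacent_def by auto

lemma swap_image_remove: "prod.swap ` (A - {c}) = prod.swap ` A - {prod.swap c}"
  by (auto simp: prod.swap_def)

lemma Union_vstrips: "\<Union>(vstrips A) = A"
  unfolding vstrips_def vstrip_def using vconn_refl vconn_in by blast

lemma Union_hstrips: "\<Union>(hstrips A) = A"
  unfolding hstrips_def
  by (metis Union_vstrips image_Union swap_swap_image)

lemma inj_image_swap: "inj ((`) prod.swap)"
  by (metis injI swap_swap_image)

lemma strip_tree_grid: "tree_grid A \<Longrightarrow> strip_tree (hstrips A) (vstrips A)"
proof (induction "card A" arbitrary: A rule: less_induct)
  case less
  have fin: "finite A" "A \<noteq> {}" using less.prems unfolding tree_grid_def by auto
  obtain c0 where c0: "c0 \<in> A" using fin by blast
  show ?case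
  proof (cases "A = {c0}")
    case True
    have "vstrips {p} = {{p}}" for p
      unfolding vstrips_def using vconn_refl[of p "{p}"] vconn_in(2)[of "{p}" p] by (auto simp: vstrip_def)
    then show ?thesis using strip_tree.single_cell by (simp add: True hstrips_def)
  next
    case False
    obtain c d where l: "leaf A c d" and dir: "fst c = fst d \<or> snd c = snd d"
      using good_leaf[OF less.prems False c0] by metis
    have c: "c \<in> A" using l by (simp add: leaf_def)
    let ?A = "A - {c}"
    have IH: "strip_tree (hstrips ?A) (vstrips ?A)"
      using less.hyps[of ?A] tree_grid_remove_leaf[OF less.prems l] fin c
      by (metis card_Diff1_less)
    have d: "d \<in> ?A" using l by (auto simp: leaf_def adjacent_def)
    note ls = leaf_swap[OF l]
    show ?thesis
    proof (cases "fst c = fst d")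
      case True
      have "hstrips A = insert {c} (hstrips ?A)"
        unfolding hstrips_def using vstrip_remove_leaf_horizontal[OF ls] True
        by (simp add: swap_image_remove)
      moreover have "vstrip ?A d \<in> vstrips ?A" using d by (simp add: vstrips_def)
      ultimately show ?thesis
        using strip_tree.vertical[OF IH, of c "vstrip ?A d"] vstrip_remove_leaf_vertical[OF l True]
        by (simp add: Union_hstrips)
    next
      case False
      then have h: "snd c = snd d" using dir by blast
      let ?s = "vstrip (prod.swap ` ?A) (prod.swap d)"
      have "vstrips (prod.swap ` A) = insert (insert (prod.swap c) ?s) (vstrips (prod.swap ` ?A) - {?s})"
        using vstrip_remove_leaf_vertical[OF ls] h by (simp add: swap_image_remove)
      then have "hstrips A = insert (insert c (prod.swap ` ?s)) (hstrips ?A - {prod.swap ` ?s})"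
        unfolding hstrips_def by (simp add: image_set_diff[OF inj_image_swap])
      moreover have "prod.swap ` ?s \<in> hstrips ?A"
        using d unfolding hstrips_def vstrips_def by blast
      ultimately show ?thesis
        using strip_tree.horizontal[OF IH, of c "prod.swap ` ?s"] vstrip_remove_leaf_horizontal[OF l h]
        by (simp add: Union_hstrips)
    qed
  qed
qed

section \<open>Corners of strips\<close>

definition lo_corner :: "point set \<Rightarrow> point" where
  "lo_corner s = (Min (fst ` s), Min (snd ` s))"

definition hi_corner :: "point set \<Rightarrow> point" where
  "hi_corner s = (Suc (Max (fst ` s)), Suc (Max (snd ` s)))"

abbreviation "ul_corner s \<equiv> (fst (lo_corner s), snd (hi_corner s))"
abbreviation "lr_corner s \<equiv> (fst (hi_corner s), snd (lo_corner s))"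

lemma corners_box:
  assumes "a \<le> b" "c \<le> d"
  shows "lo_corner ({a..b} \<times> {c..d}) = (a, c)" "hi_corner ({a..b} \<times> {c..d}) = (Suc b, Suc d)"
  using assms by (auto simp: lo_corner_def hi_corner_def intro: Min_eqI Max_eqI)

lemma vstrips_box:
  assumes fin: "finite A" and pos: "A \<subseteq> {1..} \<times> {1..}" and s: "s \<in> vstrips A"
  obtains x m M where "1 \<le> m" "m \<le> M" "s = {x..x} \<times> {m..M}" "s \<subseteq> A" "(x, m - 1) \<notin> A"
    "(x, Suc M) \<notin> A" "\<And>p. p \<in> s \<Longrightarrow> vstrip A p = s"
proof -
  obtain x y where p: "(x, y) \<in> A" "s = vstrip A (x, y)"
    using s by (auto simp: vstrips_def)
  let ?S = "{k. vconn A (x, y) (x, k)}"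
  have "?S \<subseteq> snd ` A" using vconn_in(2) by force
  then have f: "finite ?S" using fin finite_surj by blast
  have y: "y \<in> ?S" using vconn_refl p by simp
  define m M where "m = Min ?S" and "M = Max ?S"
  have m: "vconn A (x, y) (x, m)" "m \<le> y" "\<And>k. k \<in> ?S \<Longrightarrow> m \<le> k"
    using Min_in[OF f] y Min_le[OF f] unfolding m_def by blast+
  have M: "vconn A (x, y) (x, M)" "y \<le> M" "\<And>k. k \<in> ?S \<Longrightarrow> k \<le> M"
    using Max_in[OF f] y Max_ge[OF f] unfolding M_def by blast+
  have A: "(x, k) \<in> A" if "m \<le> k" "k \<le> M" for k
    using m(1,2) M(1,2) that unfolding vconn_def by (cases "k \<le> y") auto
  have S: "k \<in> ?S" if "m \<le> k" "k \<le> M" for k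
    using A that m(2) M(2) by (auto simp: vconn_def)
  have sb: "s = {x..x} \<times> {m..M}"
  proof (rule Set.set_eqI)
    fix q :: point
    obtain a b where [simp]: "q = (a, b)" by (cases q)
    have "q \<in> s \<longleftrightarrow> a = x \<and> b \<in> ?S" using p(2) by (auto simp: vstrip_def vconn_def)
    then show "q \<in> s \<longleftrightarrow> q \<in> {x..x} \<times> {m..M}" using S[of b] m(3)[of b] M(3)[of b] by auto
  qed
  have m1: "1 \<le> m" using A[of m] m(2) M(2) pos by auto
  have "m - 1 \<notin> ?S" using m(3)[of "m - 1"] m1 by auto
  moreover have "m - 1 \<in> ?S" if "(x, m - 1) \<in> A"
  proof -
    have "(x, k) \<in> A" if "m - 1 \<le> k" "k \<le> y" for k
      using A[of k] that M(2) \<open>(x, m - 1) \<in> A\<close> by (cases "k = m - 1") auto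
    then show ?thesis using m(2) by (auto simp: vconn_def)
  qed
  ultimately have e1: "(x, m - 1) \<notin> A" by blast
  have "Suc M \<notin> ?S" using M(3)[of "Suc M"] by auto
  moreover have "Suc M \<in> ?S" if "(x, Suc M) \<in> A"
  proof -
    have "(x, k) \<in> A" if "y \<le> k" "k \<le> Suc M" for k
      using A[of k] that m(2) \<open>(x, Suc M) \<in> A\<close> by (cases "k = Suc M") auto
    then show ?thesis using M(2) by (auto simp: vconn_def)
  qed
  ultimately have e2: "(x, Suc M) \<notin> A" by blast
  have cl: "vstrip A q = s" if "q \<in> s" for q
  proof -
    have "vconn A (x, y) q" using that p by (simp add: vstrip_def)
    then have "vconn A q r \<longleftrightarrow> vconn A (x, y) r" for r by (metis vconn_trans vconn_sym)
    then show ?thesis using p by (simp add: vstrip_def)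
  qed
  show thesis
    by (rule that[of m M x, OF m1 _ sb _ e1 e2 cl]) (use m M sb A in auto)
qed

definition hstrip :: "point set \<Rightarrow> point \<Rightarrow> point set" where
  "hstrip A p = prod.swap ` vstrip (prod.swap ` A) (prod.swap p)"

lemma hstrips_box:
  assumes fin: "finite A" and pos: "A \<subseteq> {1..} \<times> {1..}" and s: "s \<in> hstrips A"
  obtains y m M where "1 \<le> m" "m \<le> M" "s = {m..M} \<times> {y..y}" "s \<subseteq> A" "(m - 1, y) \<notin> A"
    "(Suc M, y) \<notin> A" "\<And>p. p \<in> s \<Longrightarrow> hstrip A p = s"
proof -
  obtain t where t: "t \<in> vstrips (prod.swap ` A)" "s = prod.swap ` t"
    using s by (auto simp: hstrips_def)
  have "finite (prod.swap ` A)" "prod.swap ` A \<subseteq> {1..} \<times> {1..}" using fin pos by auto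
  from vstrips_box[OF this t(1)] obtain x m M where b: "1 \<le> m" "m \<le> M" "t = {x..x} \<times> {m..M}"
    "t \<subseteq> prod.swap ` A" "(x, m - 1) \<notin> prod.swap ` A" "(x, Suc M) \<notin> prod.swap ` A"
    "\<And>p. p \<in> t \<Longrightarrow> vstrip (prod.swap ` A) p = t" by metis
  have m: "(a, b) \<in> prod.swap ` A \<longleftrightarrow> (b, a) \<in> A" for a b by auto
  have s: "s = {m..M} \<times> {x..x}" unfolding t(2) b(3) by (rule product_swap)
  have "s \<subseteq> A" using b(4) t(2) swap_swap_image by (metis image_mono)
  moreover have "hstrip A p = s" if "p \<in> s" for p
    using b(7)[of "prod.swap p"] that t(2) by (auto simp: hstrip_def)
  ultimately show thesis using that[of m M x] b(1,2,5,6) s unfolding m by blast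
qed

lemma card_le_1_subset: "S \<subseteq> {x} \<Longrightarrow> (P \<or> S = {}) \<Longrightarrow> card S \<le> of_bool P"
  by (cases P) (auto simp: subset_singleton_iff)

text \<open>The corners counted at a vertex are the places in the clockwise cycle of the four cells around
  it where \<open>A\<close> is left; there is at most one because no two cells touch in that vertex only.\<close>

lemma corners_disjoint:
  assumes A: "tree_grid A"
  shows "card {s \<in> vstrips A. lo_corner s = v} + card {s \<in> vstrips A. hi_corner s = v} +
    card {s \<in> hstrips A. ul_corner s = v} + card {s \<in> hstrips A. lr_corner s = v} \<le> 1"
proof -
  have A': "finite A" "A \<subseteq> {1..} \<times> {1..}"
    and d: "\<And>i j. (i, j) \<in> A \<Longrightarrow> (Suc i, Suc j) \<in> A \<Longrightarrow> (Suc i, j) \<in> A \<or> (i, Suc j) \<in> A"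
    and a: "\<And>i j. (i, Suc j) \<in> A \<Longrightarrow> (Suc i, j) \<in> A \<Longrightarrow> (i, j) \<in> A \<or> (Suc i, Suc j) \<in> A"
    using A unfolding tree_grid_def by blast+
  obtain i' j' where v: "v = (i', j')" by (cases v)
  have V: "1 \<le> fst (lo_corner s) \<and> 1 \<le> snd (lo_corner s) \<and>
      (lo_corner s = (i, j) \<longrightarrow> s = vstrip A (i, j) \<and> (i, j) \<in> A \<and> (i, j - 1) \<notin> A) \<and>
      (hi_corner s = (Suc i, Suc j) \<longrightarrow> s = vstrip A (i, j) \<and> (i, j) \<in> A \<and> (i, Suc j) \<notin> A)"
    if "s \<in> vstrips A" for s i j
  proof -
    from vstrips_box[OF A' that] obtain x m M where b: "1 \<le> m" "m \<le> M" "s = {x..x} \<times> {m..M}"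
      "s \<subseteq> A" "(x, m - 1) \<notin> A" "(x, Suc M) \<notin> A" "\<And>p. p \<in> s \<Longrightarrow> vstrip A p = s" by metis
    have c: "lo_corner s = (x, m)" "hi_corner s = (Suc x, Suc M)"
      unfolding b(3) using corners_box[OF order_refl b(2)] by blast+
    have "(x, m) \<in> s" "(x, M) \<in> s" using b by auto
    then show ?thesis using b(1,4,5,6) b(7)[of "(x, m)"] b(7)[of "(x, M)"] c A'(2) by auto
  qed
  have H: "1 \<le> fst (lo_corner s) \<and> 1 \<le> snd (lo_corner s) \<and>
      (ul_corner s = (i, Suc j) \<longrightarrow> s = hstrip A (i, j) \<and> (i, j) \<in> A \<and> (i - 1, j) \<notin> A) \<and>
      (lr_corner s = (Suc i, j) \<longrightarrow> s = hstrip A (i, j) \<and> (i, j) \<in> A \<and> (Suc i, j) \<notin> A)"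
    if "s \<in> hstrips A" for s i j
  proof -
    from hstrips_box[OF A' that] obtain y m M where b: "1 \<le> m" "m \<le> M" "s = {m..M} \<times> {y..y}"
      "s \<subseteq> A" "(m - 1, y) \<notin> A" "(Suc M, y) \<notin> A" "\<And>p. p \<in> s \<Longrightarrow> hstrip A p = s" by metis
    have c: "lo_corner s = (m, y)" "hi_corner s = (Suc M, Suc y)"
      unfolding b(3) using corners_box[OF b(2) order_refl] by blast+
    have "(m, y) \<in> s" "(M, y) \<in> s" using b by auto
    then show ?thesis using b(1,4,5,6) b(7)[of "(m, y)"] b(7)[of "(M, y)"] c A'(2) by auto
  qed
  have hi: "fst (hi_corner s) \<noteq> 0" "snd (hi_corner s) \<noteq> 0" for s by (auto simp: hi_corner_def)
  show ?thesis
  proof (cases "i' = 0 \<or> j' = 0")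
    case True
    have "lo_corner s \<noteq> v" "hi_corner s \<noteq> v" if "s \<in> vstrips A" for s
      using V[OF that, of 0 0] hi[of s] True v by auto
    moreover have "ul_corner s \<noteq> v" "lr_corner s \<noteq> v" if "s \<in> hstrips A" for s
      using H[OF that, of 0 0] hi[of s] True v by auto
    ultimately have "{s \<in> vstrips A. lo_corner s = v} = {}" "{s \<in> vstrips A. hi_corner s = v} = {}"
      "{s \<in> hstrips A. ul_corner s = v} = {}" "{s \<in> hstrips A. lr_corner s = v} = {}"
      by blast+
    then show ?thesis by (simp only: card.empty)
  next
    case False
    then obtain i j where [simp]: "i' = Suc i" "j' = Suc j" by (meson not0_implies_Suc)
    have 1: "card {s \<in> vstrips A. lo_corner s = v} \<le> of_bool ((Suc i, Suc j) \<in> A \<and> (Suc i, j) \<notin> A)"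
      by (rule card_le_1_subset[of _ "vstrip A (Suc i, Suc j)"]) (use V[of _ "Suc i" "Suc j"] v in auto)
    have 2: "card {s \<in> vstrips A. hi_corner s = v} \<le> of_bool ((i, j) \<in> A \<and> (i, Suc j) \<notin> A)"
      by (rule card_le_1_subset[of _ "vstrip A (i, j)"]) (use V[of _ i j] v in auto)
    have 3: "card {s \<in> hstrips A. ul_corner s = v} \<le> of_bool ((Suc i, j) \<in> A \<and> (i, j) \<notin> A)"
      by (rule card_le_1_subset[of _ "hstrip A (Suc i, j)"]) (use H[of _ "Suc i" j] v in auto)
    have 4: "card {s \<in> hstrips A. lr_corner s = v} \<le> of_bool ((i, Suc j) \<in> A \<and> (Suc i, Suc j) \<notin> A)"
      by (rule card_le_1_subset[of _ "hstrip A (i, Suc j)"]) (use H[of _ i "Suc j"] v in auto)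
    have "of_bool ((Suc i, Suc j) \<in> A \<and> (Suc i, j) \<notin> A) + of_bool ((i, j) \<in> A \<and> (i, Suc j) \<notin> A) +
      of_bool ((Suc i, j) \<in> A \<and> (i, j) \<notin> A) +
      of_bool ((i, Suc j) \<in> A \<and> (Suc i, Suc j) \<notin> A) \<le> (1 :: nat)"
      using d[of i j] a[of i j] by (auto simp: of_bool_def)
    then show ?thesis using 1 2 3 4 by linarith
  qed
qed

definition corner_sum :: "(point \<Rightarrow> int) \<Rightarrow> point \<Rightarrow> int" where
  "corner_sum D p = (\<Sum>i<fst p. \<Sum>j<snd p. D (i, j))"

lemma corner_sum_box:
  assumes "a \<le> b" "c \<le> d"
  shows "corner_sum D (b, d) + corner_sum D (a, c) - corner_sum D (a, d) - corner_sum D (b, c) =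
    sum D ({a..<b} \<times> {c..<d})"
proof -
  have 1: "(\<Sum>i<b. f i) - (\<Sum>i<a. f i) = (\<Sum>i=a..<b. f i)" for f :: "nat \<Rightarrow> int"
    using assms(1) sum_diff_nat_ivl[of 0 a b f] by (simp add: lessThan_atLeast0)
  have 2: "(\<Sum>i<d. f i) - (\<Sum>i<c. f i) = (\<Sum>i=c..<d. f i)" for f :: "nat \<Rightarrow> int"
    using assms(2) sum_diff_nat_ivl[of 0 c d f] by (simp add: lessThan_atLeast0)
  have "corner_sum D (b, d) + corner_sum D (a, c) - corner_sum D (a, d) - corner_sum D (b, c) =
    (\<Sum>i=a..<b. \<Sum>j<d. D (i, j)) - (\<Sum>i=a..<b. \<Sum>j<c. D (i, j))"
    unfolding corner_sum_def by (simp add: 1[symmetric])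
  also have "\<dots> = (\<Sum>i=a..<b. \<Sum>j=c..<d. D (i, j))"
    by (simp add: 2[symmetric] sum_subtractf)
  finally show ?thesis by (simp add: sum.cartesian_product)
qed

lemma corner_sum_corners:
  assumes "s = {a..b} \<times> {c..d}" "a \<le> b" "c \<le> d"
  shows "corner_sum D (lo_corner s) + corner_sum D (hi_corner s) -
    corner_sum D (ul_corner s) - corner_sum D (lr_corner s) = sum D s"
proof -
  have "s = {a..<Suc b} \<times> {c..<Suc d}" using assms by auto
  then show ?thesis
    using corner_sum_box[of a "Suc b" c "Suc d" D] assms corners_box[OF assms(2,3)] by (simp add: add.commute)
qed

lemma strip_weights:
  assumes A: "tree_grid A" and r: "r \<in> vstrips A"
  shows "\<exists>w :: point \<Rightarrow> int.
    (\<forall>s\<in>hstrips A. w (lo_corner s) + w (hi_corner s) < w (ul_corner s) + w (lr_corner s)) \<and>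
    (\<forall>s\<in>vstrips A - {r}. w (ul_corner s) + w (lr_corner s) < w (lo_corner s) + w (hi_corner s))"
proof -
  have A': "finite A" "A \<subseteq> {1..} \<times> {1..}" using A unfolding tree_grid_def by blast+
  have st: "strip_tree (hstrips A) (vstrips A)" using strip_tree_grid[OF A] .
  have fin: "finite (vstrips A)" using strip_tree_finite[OF st] by blast
  let ?tV = "(\<lambda>_. 1)(r := - int (card (hstrips A)) - int (card (vstrips A - {r})))"
  have "sum ?tV (vstrips A) = ?tV r + sum ?tV (vstrips A - {r})"
    using r fin by (simp add: sum.remove)
  moreover have "sum ?tV (vstrips A - {r}) = sum (\<lambda>_. 1) (vstrips A - {r})" by (rule sum.cong) auto
  ultimately have "sum (\<lambda>_. - 1) (hstrips A) = sum ?tV (vstrips A)" by simp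
  from strip_tree_balanced[OF st this] obtain D where D: "\<And>s. s \<in> hstrips A \<Longrightarrow> sum D s = - 1"
    "\<And>s. s \<in> vstrips A \<Longrightarrow> sum D s = ?tV s" by blast
  show ?thesis
  proof (rule exI[of _ "corner_sum D"], intro conjI ballI)
    fix s assume s: "s \<in> hstrips A"
    from hstrips_box[OF A' s] obtain y m M where "m \<le> M" "s = {m..M} \<times> {y..y}" by metis
    from corner_sum_corners[OF this(2) this(1), of D] D(1)[OF s]
    show "corner_sum D (lo_corner s) + corner_sum D (hi_corner s) <
      corner_sum D (ul_corner s) + corner_sum D (lr_corner s)" by simp
  next
    fix s assume s: "s \<in> vstrips A - {r}"
    from vstrips_box[OF A', of s] s obtain x m M where "m \<le> M" "s = {x..x} \<times> {m..M}" by (metis DiffD1)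
    from corner_sum_corners[OF this(2) _ this(1), of D] D(2)[of s] s
    show "corner_sum D (ul_corner s) + corner_sum D (lr_corner s) <
      corner_sum D (lo_corner s) + corner_sum D (hi_corner s)" by simp
  qed
qed

section \<open>Rectangle moves on monomials\<close>

definition rect :: "point set \<Rightarrow> point \<Rightarrow> point \<Rightarrow> bool" where
  "rect A p q \<longleftrightarrow> fst p \<noteq> fst q \<and> snd p \<noteq> snd q \<and>
     (\<forall>i j. min (fst p) (fst q) \<le> i \<longrightarrow> i < max (fst p) (fst q) \<longrightarrow>
        min (snd p) (snd q) \<le> j \<longrightarrow> j < max (snd p) (snd q) \<longrightarrow> (i, j) \<in> A)"

definition balanced :: "point set \<Rightarrow> (point \<Rightarrow> int) \<Rightarrow> bool" where
  "balanced A \<phi> \<longleftrightarrow>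
     (\<forall>p q. rect A p q \<longrightarrow> \<phi> p + \<phi> q = \<phi> (fst p, snd q) + \<phi> (fst q, snd p))"

definition weight :: "('v \<Rightarrow> int) \<Rightarrow> 'v monom \<Rightarrow> int" where
  "weight \<phi> m = (\<Sum>v\<in>Poly_Mapping.keys m. \<phi> v * int (Poly_Mapping.lookup m v))"

inductive swap_equiv :: "point set \<Rightarrow> point monom \<Rightarrow> point monom \<Rightarrow> bool" for A where
  swap_refl: "swap_equiv A a a"
| swap_sym: "swap_equiv A a b \<Longrightarrow> swap_equiv A b a"
| swap_trans: "swap_equiv A a b \<Longrightarrow> swap_equiv A b c \<Longrightarrow> swap_equiv A a c"
| swap_rect: "rect A p q \<Longrightarrow> swap_equiv A
    (u + (Poly_Mapping.single p 1 + Poly_Mapping.single q 1))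
    (u + (Poly_Mapping.single (fst p, snd q) 1 + Poly_Mapping.single (fst q, snd p) 1))"

lemma weight_superset:
  assumes "finite S" "Poly_Mapping.keys m \<subseteq> S"
  shows "weight \<phi> m = (\<Sum>v\<in>S. \<phi> v * int (Poly_Mapping.lookup m v))"
  unfolding weight_def by (rule sum.mono_neutral_left[OF assms]) (auto simp: in_keys_iff)

lemma weight_add: "weight \<phi> (a + b) = weight \<phi> a + weight \<phi> b"
proof -
  let ?S = "Poly_Mapping.keys a \<union> Poly_Mapping.keys b"
  have "finite ?S" by simp
  note * = weight_superset[OF this]
  show ?thesis
    using *[of "a + b"] *[of a] *[of b] Poly_Mapping.keys_add[of a b]
    by (simp add: lookup_add algebra_simps sum.distrib)
qed

lemma weight_single: "weight \<phi> (Poly_Mapping.single v k) = \<phi> v * int k"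
  unfolding weight_def by simp

lemma weight_cong: "(\<And>v. v \<in> Poly_Mapping.keys m \<Longrightarrow> \<phi> v = \<psi> v) \<Longrightarrow> weight \<phi> m = weight \<psi> m"
  unfolding weight_def by (rule sum.cong) auto

lemma swap_equiv_weight: "swap_equiv A a b \<Longrightarrow> balanced A \<phi> \<Longrightarrow> weight \<phi> a = weight \<phi> b"
proof (induction rule: swap_equiv.induct)
  case (swap_rect p q u)
  then have "\<phi> p + \<phi> q = \<phi> (fst p, snd q) + \<phi> (fst q, snd p)"
    unfolding balanced_def by blast
  then show ?case by (simp add: weight_add weight_single)
qed auto

lemma swap_equiv_add: "swap_equiv A a b \<Longrightarrow> swap_equiv A (a + u) (b + u)"
proof (induction rule: swap_equiv.induct)
  case (swap_rect p q w)
  then show ?case using swap_equiv.swap_rect[of A p q "w + u"] by (simp add: ac_simps)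
qed (auto intro: swap_equiv.intros)

lemma rect_mono: "rect B p q \<Longrightarrow> B \<subseteq> A \<Longrightarrow> rect A p q"
  unfolding rect_def by blast

lemma swap_equiv_mono: "swap_equiv B a b \<Longrightarrow> B \<subseteq> A \<Longrightarrow> swap_equiv A a b"
proof (induction rule: swap_equiv.induct)
  case (swap_rect p q u)
  then show ?case using swap_equiv.swap_rect rect_mono by blast
qed (auto intro: swap_equiv.intros)

lemma rect_corner_vertices:
  assumes "rect A p q"
  shows "p \<in> vertices (cell ` A)" "q \<in> vertices (cell ` A)"
    "(fst p, snd q) \<in> vertices (cell ` A)" "(fst q, snd p) \<in> vertices (cell ` A)"
proof -
  have v: "(a, b) \<in> vertices (cell ` A)" if "(i, j) \<in> A" "i \<le> a" "a \<le> Suc i" "j \<le> b" "b \<le> Suc j" for a b i j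
    using that unfolding vertices_def by (auto simp: cell_iff intro!: bexI[of _ "(i, j)"])
  have ab: "(a, b) \<in> vertices (cell ` A)" if "a = fst p \<or> a = fst q" "b = snd p \<or> b = snd q" for a b
  proof -
    let ?i = "if a = min (fst p) (fst q) then a else a - 1"
    let ?j = "if b = min (snd p) (snd q) then b else b - 1"
    have i: "min (fst p) (fst q) \<le> ?i \<and> ?i < max (fst p) (fst q) \<and> ?i \<le> a \<and> a \<le> Suc ?i"
      using that(1) assms unfolding rect_def by (auto simp: min_def max_def)
    have j: "min (snd p) (snd q) \<le> ?j \<and> ?j < max (snd p) (snd q) \<and> ?j \<le> b \<and> b \<le> Suc ?j"
      using that(2) assms unfolding rect_def by (auto simp: min_def max_def)
    have "(?i, ?j) \<in> A" using assms i j unfolding rect_def by blast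
    then show ?thesis using v i j by blast
  qed
  show "p \<in> vertices (cell ` A)" "q \<in> vertices (cell ` A)"
    "(fst p, snd q) \<in> vertices (cell ` A)" "(fst q, snd p) \<in> vertices (cell ` A)"
    using ab[of "fst p" "snd p"] ab[of "fst q" "snd q"] ab by auto
qed

text \<open>The monomials in the variables \<open>W\<close> that cannot be told apart by additive invariants of the
  rectangle moves are connected by such moves: the moves generate a saturated lattice ideal.\<close>

definition saturated :: "point set \<Rightarrow> point set \<Rightarrow> bool" where
  "saturated A W \<longleftrightarrow> (\<forall>a\<in>monomials W. \<forall>b\<in>monomials W.
     (\<forall>\<phi>. balanced A \<phi> \<longrightarrow> weight \<phi> a = weight \<phi> b) \<longrightarrow> swap_equiv A a b)"

definition peelable ::
  "point set \<Rightarrow> point set \<Rightarrow> point set \<Rightarrow> point \<Rightarrow> point \<Rightarrow> point set \<Rightarrow> (point \<Rightarrow> point) \<Rightarrow> bool" where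
  "peelable A B W v v' K g \<longleftrightarrow> B \<subseteq> A \<and> v \<noteq> v' \<and> v \<notin> W \<and> v' \<notin> W \<and> finite K \<and> K \<subseteq> W \<and> g ` K \<subseteq> W \<and>
     (\<forall>r\<in>K. rect A v' r \<and> {(fst v', snd r), (fst r, snd v')} = {v, g r}) \<and>
     balanced A (\<lambda>u. of_bool (u = v \<or> u = v')) \<and> balanced A (\<lambda>u. of_bool (u = v \<or> u \<in> K)) \<and>
     (\<exists>r0\<in>K. \<forall>\<phi>. balanced B \<phi> \<longrightarrow> balanced A (\<phi>(v := \<phi> r0, v' := \<phi> (g r0))))"

lemma in_monomials_iff: "m \<in> monomials V \<longleftrightarrow> (\<forall>v. v \<notin> V \<longrightarrow> Poly_Mapping.lookup m v = 0)"
  unfolding monomials_def by (auto simp: in_keys_iff)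

lemma single_split:
  assumes "Poly_Mapping.lookup m v \<noteq> 0"
  obtains n where "m = n + Poly_Mapping.single v (1::nat)"
proof
  show "m = (m - Poly_Mapping.single v 1) + Poly_Mapping.single v 1"
    using assms by (intro poly_mapping_eqI) (auto simp: lookup_add lookup_minus lookup_single when_def)
qed

lemma weight_of_bool:
  assumes "finite S" shows "weight (\<lambda>u. of_bool (u \<in> S)) m = (\<Sum>u\<in>S. int (Poly_Mapping.lookup m u))"
proof -
  have "weight (\<lambda>u. of_bool (u \<in> S)) m =
      (\<Sum>u\<in>S \<union> Poly_Mapping.keys m. of_bool (u \<in> S) * int (Poly_Mapping.lookup m u))"
    using assms by (intro weight_superset) auto
  also have "\<dots> = (\<Sum>u\<in>S. of_bool (u \<in> S) * int (Poly_Mapping.lookup m u))"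
    using assms by (intro sum.mono_neutral_right) auto
  also have "\<dots> = (\<Sum>u\<in>S. int (Poly_Mapping.lookup m u))" by (rule sum.cong) auto
  finally show ?thesis .
qed

lemma saturated_peel:
  assumes p: "peelable A B W v v' K g" and IH: "saturated B W"
  shows "saturated A (insert v (insert v' W))"
proof -
  let ?W = "insert v (insert v' W)"
  let ?l = "Poly_Mapping.lookup" and ?s = "\<lambda>v. Poly_Mapping.single v (1 :: nat)"
  have BA: "B \<subseteq> A" and vv: "v \<noteq> v'" "v \<notin> W" "v' \<notin> W" and K: "finite K" "K \<subseteq> W" "g ` K \<subseteq> W"
    and mv: "\<And>r. r \<in> K \<Longrightarrow> rect A v' r" "\<And>r. r \<in> K \<Longrightarrow> {(fst v', snd r), (fst r, snd v')} = {v, g r}"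
    and b1: "balanced A (\<lambda>u. of_bool (u = v \<or> u = v'))"
    and b2: "balanced A (\<lambda>u. of_bool (u = v \<or> u \<in> K))"
    using p unfolding peelable_def by auto
  obtain r0 where r0: "r0 \<in> K" "\<And>\<phi>. balanced B \<phi> \<Longrightarrow> balanced A (\<phi>(v := \<phi> r0, v' := \<phi> (g r0)))"
    using p unfolding peelable_def by blast
  have step: "swap_equiv A (u + (?s v' + ?s r)) (u + (?s v + ?s (g r)))" if "r \<in> K" for u r
  proof -
    have "?s (fst v', snd r) + ?s (fst r, snd v') = ?s v + ?s (g r)"
      using mv(2)[OF that] by (auto simp: doubleton_eq_iff add.commute)
    then show ?thesis using swap_equiv.swap_rect[OF mv(1)[OF that], of u] by simp
  qed
  have push: "\<exists>a1\<in>monomials ?W. swap_equiv A a a1 \<and> (?l a1 v' = 0 \<or> (\<forall>r\<in>K. ?l a1 r = 0))"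
    if "a \<in> monomials ?W" for a
    using that
  proof (induction "?l a v'" arbitrary: a)
    case 0
    then show ?case using swap_equiv.swap_refl by (metis)
  next
    case (Suc n)
    show ?case
    proof (cases "\<forall>r\<in>K. ?l a r = 0")
      case True
      then show ?thesis using Suc.prems swap_equiv.swap_refl by blast
    next
      case False
      then obtain r where r: "r \<in> K" "?l a r \<noteq> 0" by blast
      obtain u' where u': "a = u' + ?s v'" using single_split[of a v'] Suc.hyps(2) by (metis nat.distinct(1))
      have "r \<noteq> v'" using r K vv by blast
      then have "?l u' r \<noteq> 0" using r u' by (simp add: lookup_add lookup_single)
      from single_split[OF this] obtain u where u: "u' = u + ?s r" .
      have a: "a = u + (?s v' + ?s r)" using u u' by (simp add: ac_simps)
      let ?a = "u + (?s v + ?s (g r))"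
      have gr: "g r \<in> W" using r K by blast
      then have "g r \<noteq> v'" using vv by blast
      then have "n = ?l ?a v'" using Suc.hyps(2) a vv \<open>r \<noteq> v'\<close> by (simp add: lookup_add lookup_single)
      moreover have "?a \<in> monomials ?W"
        using Suc.prems gr unfolding in_monomials_iff a by (auto simp: lookup_add lookup_single when_def)
      ultimately obtain a1 where "a1 \<in> monomials ?W" "swap_equiv A ?a a1"
        "?l a1 v' = 0 \<or> (\<forall>r\<in>K. ?l a1 r = 0)" using Suc.hyps(1) by blast
      then show ?thesis using step[OF r(1), of u] a swap_equiv.swap_trans by blast
    qed
  qed
  show ?thesis
    unfolding saturated_def
  proof (intro ballI impI)
    fix a b assume ab: "a \<in> monomials ?W" "b \<in> monomials ?W"
      and eq: "\<forall>\<phi>. balanced A \<phi> \<longrightarrow> weight \<phi> a = weight \<phi> b"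
    obtain a1 where a1: "a1 \<in> monomials ?W" "swap_equiv A a a1" "?l a1 v' = 0 \<or> (\<forall>r\<in>K. ?l a1 r = 0)"
      using push[OF ab(1)] by blast
    obtain b1' where b1': "b1' \<in> monomials ?W" "swap_equiv A b b1'" "?l b1' v' = 0 \<or> (\<forall>r\<in>K. ?l b1' r = 0)"
      using push[OF ab(2)] by blast
    have eq1: "weight \<phi> a1 = weight \<phi> b1'" if "balanced A \<phi>" for \<phi>
      using eq that swap_equiv_weight[OF a1(2) that] swap_equiv_weight[OF b1'(2) that] by simp
    have w1: "weight (\<lambda>u. of_bool (u = v \<or> u = v')) m = int (?l m v) + int (?l m v')" for m
      using weight_of_bool[of "{v, v'}" m] vv by simp
    have w2: "weight (\<lambda>u. of_bool (u = v \<or> u \<in> K)) m = int (?l m v) + (\<Sum>u\<in>K. int (?l m u))" for m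
    proof -
      have "v \<notin> K" using vv K by blast
      then show ?thesis using weight_of_bool[of "insert v K" m] K(1) by simp
    qed
    have nn: "(\<Sum>u\<in>K. int (?l m u)) \<ge> 0" for m by (rule sum_nonneg) auto
    have z: "?l m v' = 0 \<or> (\<Sum>u\<in>K. int (?l m u)) = 0" if "?l m v' = 0 \<or> (\<forall>r\<in>K. ?l m r = 0)" for m
      using that by auto
    have v: "?l a1 v = ?l b1' v" "?l a1 v' = ?l b1' v'"
      using eq1[OF b1] eq1[OF b2] nn[of a1] nn[of b1'] z[OF a1(3)] z[OF b1'(3)] unfolding w1 w2 by linarith+
    define c where "c = Poly_Mapping.single v (?l a1 v) + Poly_Mapping.single v' (?l a1 v')"
    define ca where "ca = a1 - c"
    define cb where "cb = b1' - c"
    have ca: "a1 = ca + c" unfolding ca_def c_def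
      using vv by (intro poly_mapping_eqI) (auto simp: lookup_add lookup_minus lookup_single when_def)
    have cb: "b1' = cb + c" unfolding cb_def c_def
      using vv v by (intro poly_mapping_eqI) (auto simp: lookup_add lookup_minus lookup_single when_def)
    have cam: "ca \<in> monomials W" "cb \<in> monomials W"
      using a1(1) b1'(1) v vv unfolding ca_def cb_def c_def in_monomials_iff
      by (auto simp: lookup_add lookup_minus lookup_single when_def)
    have "weight \<phi> ca = weight \<phi> cb" if "balanced B \<phi>" for \<phi>
    proof -
      let ?\<phi> = "\<phi>(v := \<phi> r0, v' := \<phi> (g r0))"
      have "weight ?\<phi> ca = weight ?\<phi> cb"
        using eq1[OF r0(2)[OF that]] unfolding ca cb weight_add by simp
      moreover have "weight ?\<phi> m = weight \<phi> m" if "m \<in> monomials W" for m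
        by (rule weight_cong) (use that vv in \<open>auto simp: monomials_def\<close>)
      ultimately show ?thesis using cam by simp
    qed
    then have "swap_equiv B ca cb" using IH cam unfolding saturated_def by blast
    then have "swap_equiv A a1 b1'"
      unfolding ca cb by (intro swap_equiv_add swap_equiv_mono[OF _ BA])
    then show "swap_equiv A a b" using a1(2) b1'(2) swap_equiv.swap_trans swap_equiv.swap_sym by blast
  qed
qed

lemma rect_commute: "rect A p q \<longleftrightarrow> rect A q p"
  unfolding rect_def by (auto simp: min.commute max.commute)

lemma in_vertices_iff:
  "(a, b) \<in> vertices (cell ` A) \<longleftrightarrow> (\<exists>i j. (i, j) \<in> A \<and> i \<le> a \<and> a \<le> Suc i \<and> j \<le> b \<and> b \<le> Suc j)"
  unfolding vertices_def by (simp add: cell_iff Bex_def)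

lemma finite_vertices:
  assumes "finite A" shows "finite (vertices (cell ` A))"
  unfolding vertices_def cell_def interval_def using assms by auto

locale leaf_column =
  fixes A :: "point set" and x y s yt :: nat
  assumes fin: "finite A" and pos: "A \<subseteq> {1..} \<times> {1..}"
    and diag: "\<And>i j. (i, j) \<in> A \<Longrightarrow> (Suc i, Suc j) \<in> A \<Longrightarrow> (Suc i, j) \<in> A \<or> (i, Suc j) \<in> A"
    and antidiag: "\<And>i j. (i, Suc j) \<in> A \<Longrightarrow> (Suc i, j) \<in> A \<Longrightarrow> (i, j) \<in> A \<or> (Suc i, Suc j) \<in> A"
    and c: "(x, y) \<in> A" and right: "(Suc x, y) \<notin> A" and left: "(x - 1, y) \<notin> A"
    and beyond: "yt = Suc y \<and> (x, Suc y) \<notin> A \<or> yt = y \<and> (x, y - 1) \<notin> A"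
    and free: "free_side A (x, y) s"
begin

definition "xr = (if s = Suc x then Suc x else x)"
definition "xl = (if s = Suc x then x else Suc x)"

text \<open>The row \<open>r\<close> of vertices belongs to the vertical strip of the cell \<open>(x, y)\<close>.\<close>

definition "row r \<longleftrightarrow> (\<forall>j. min r yt \<le> j \<longrightarrow> j < max r yt \<longrightarrow> (x, j) \<in> A)"

lemma side: "s = Suc x \<or> x = Suc s"
  using free by (simp add: free_side_def)

lemma x_pos: "x \<noteq> 0" "y \<noteq> 0"
  using c pos by auto

lemma end_vertex:
  assumes "(i, j) \<in> A" "(i, j) \<noteq> (x, y)" "i \<le> a" "a \<le> Suc i" "j \<le> yt" "yt \<le> Suc j" "a = x \<or> a = Suc x"
  shows False
proof -
  obtain x0 where x0: "x = Suc x0" using x_pos by (cases x) auto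
  obtain y0 where y0: "y = Suc y0" using x_pos by (cases y) auto
  have i: "i = x0 \<or> i = Suc x0 \<or> i = Suc (Suc x0)" using assms(3,4,7) x0 by auto
  show False
  proof (cases "yt = Suc y")
    case True
    then have b: "(x, Suc y) \<notin> A" using beyond by auto
    have "j = y \<or> j = Suc y" using assms True by auto
    then show False
      using i assms(1,2) b right left c x0 diag[of x y] antidiag[of x0 y] by auto
  next
    case False
    then have b: "(x, y0) \<notin> A" "yt = y" using beyond y0 by auto
    have "j = y0 \<or> j = Suc y0" using assms b y0 by auto
    then show False
      using i assms(1,2) b right left c x0 y0 diag[of x0 y0] antidiag[of x y0] by auto
  qed
qed

lemma side_end: "(s, yt) \<notin> A" "yt = Suc k \<Longrightarrow> (s, k) \<notin> A"
  using end_vertex[of s yt xr] end_vertex[of s k xr] side by (auto simp: xr_def)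

lemma row_up:
  assumes "row r" "(s, r) \<in> A" shows "row (Suc r)"
proof -
  have "(x, r) \<in> A" if r: "yt \<le> r"
  proof (rule ccontr)
    assume n: "(x, r) \<notin> A"
    have "r \<noteq> yt" using side_end assms(2) by auto
    then have r: "yt < r" using r by simp
    then have "(x, yt) \<in> A" using assms(1) unfolding row_def by simp
    then have yt: "yt = y" using beyond by auto
    obtain m where m: "r = Suc m" using r by (cases r) auto
    have rm: "(x, j) \<in> A" if "y \<le> j" "j \<le> m" for j
      using assms(1) r that m yt unfolding row_def by auto
    then have v: "vconn A (x, y) (x, m)" using r m yt by (auto simp: vconn_def)
    have "(x, m) \<in> A" using rm r m yt by auto
    then have "(s, m) \<in> A"
      using side diag[of x m] antidiag[of s m] assms(2) m n by auto
    then show False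
      using free[unfolded free_side_def] v n assms(2) m by auto
  qed
  then show ?thesis using assms(1) unfolding row_def
    by (metis (no_types, lifting) less_Suc_eq_le le_less linorder_not_le max_def min_def)
qed

lemma row_down:
  assumes "row (Suc r)" "(s, r) \<in> A" shows "row r"
proof -
  have "(x, r) \<in> A" if r: "r < yt"
  proof (rule ccontr)
    assume n: "(x, r) \<notin> A"
    have "yt \<noteq> Suc r" using side_end(2)[of r] assms(2) by auto
    then have r: "Suc r < yt" using r by simp
    then have "(x, yt - 1) \<in> A" using assms(1) unfolding row_def by simp
    then have yt: "yt = Suc y" using beyond by auto
    have rm: "(x, j) \<in> A" if "Suc r \<le> j" "j \<le> y" for j
      using assms(1) r that yt unfolding row_def by auto
    then have v: "vconn A (x, y) (x, Suc r)" using r yt by (auto simp: vconn_def)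
    have "(x, Suc r) \<in> A" using rm r yt by auto
    then have "(s, Suc r) \<in> A"
      using side diag[of s r] antidiag[of x r] assms(2) n by auto
    then show False
      using free[unfolded free_side_def] v n assms(2) by auto
  qed
  then show ?thesis using assms(1) unfolding row_def
    by (metis (no_types, lifting) less_Suc_eq_le le_less linorder_not_le max_def min_def Suc_leI)
qed

lemma row_up_strip: "row r \<Longrightarrow> (x, r) \<in> A \<Longrightarrow> row (Suc r)"
  unfolding row_def by (auto simp: less_Suc_eq min_def max_def split: if_splits)

lemma row_down_strip: "row (Suc r) \<Longrightarrow> (x, r) \<in> A \<Longrightarrow> row r"
  unfolding row_def by (metis (no_types, lifting) less_Suc_eq_le le_less linorder_not_le max_def min_def Suc_leI)

lemma row_range:
  assumes "lo \<le> hi" "o' = x \<or> o' = s" "\<And>j. lo \<le> j \<Longrightarrow> j < hi \<Longrightarrow> (o', j) \<in> A"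
  shows "row lo \<longleftrightarrow> row hi"
  using assms(1,3)
proof (induction rule: dec_induct)
  case (step n)
  then show ?case using row_up row_up_strip row_down row_down_strip assms(2) by (metis less_SucI lessI)
qed simp

lemma row_rect:
  assumes "rect A p q" "fst p = xr" shows "row (snd p) \<longleftrightarrow> row (snd q)"
proof -
  let ?o = "if fst q < xr then xr - 1 else xr"
  have o: "?o = x \<or> ?o = s" using side by (auto simp: xr_def)
  have "(?o, j) \<in> A" if "min (snd p) (snd q) \<le> j" "j < max (snd p) (snd q)" for j
  proof -
    have "min (fst p) (fst q) \<le> ?o \<and> ?o < max (fst p) (fst q)"
      using assms unfolding rect_def by auto
    then show ?thesis using assms(1) that unfolding rect_def by blast
  qed
  then have "row (min (snd p) (snd q)) \<longleftrightarrow> row (max (snd p) (snd q))"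
    by (intro row_range[OF _ o]) auto
  then show ?thesis by (auto simp: min_def max_def split: if_splits)
qed

lemma rect_leaf:
  assumes "rect A p q"
  shows "rect (A - {(x, y)}) p q \<or>
     {fst p, fst q} = {x, Suc x} \<and> (\<exists>r. r \<noteq> yt \<and> row r \<and> {snd p, snd q} = {yt, r})"
proof (cases "min (fst p) (fst q) \<le> x \<and> x < max (fst p) (fst q) \<and>
    min (snd p) (snd q) \<le> y \<and> y < max (snd p) (snd q)")
  case False
  then show ?thesis using assms unfolding rect_def by blast
next
  case True
  have box: "(i, j) \<in> A" if "min (fst p) (fst q) \<le> i" "i < max (fst p) (fst q)"
    "min (snd p) (snd q) \<le> j" "j < max (snd p) (snd q)" for i j
    using assms that unfolding rect_def by blast
  define lo hi lo' hi' where "lo = min (fst p) (fst q)" "hi = max (fst p) (fst q)"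
    "lo' = min (snd p) (snd q)" "hi' = max (snd p) (snd q)"
  note lh = this
  have True': "lo \<le> x" "x < hi" "lo' \<le> y" "y < hi'" using True lh by auto
  have box': "(i, j) \<in> A" if "lo \<le> i" "i < hi" "lo' \<le> j" "j < hi'" for i j
    using box that lh by auto
  have "lo = x"
    using box'[of "x - 1" y] left True' by (cases "lo = x") auto
  moreover have "hi = Suc x"
    using box'[of "Suc x" y] right True' by (cases "hi = Suc x") auto
  ultimately have f: "{fst p, fst q} = {x, Suc x}" unfolding lh by (auto simp: min_def max_def split: if_splits)
  show ?thesis
  proof (cases "yt = Suc y")
    case t: True
    have "hi' = yt"
      using box'[of x "Suc y"] beyond t True' by (cases "hi' = Suc y") auto
    then have "row lo'" "lo' \<noteq> yt"
      unfolding row_def using box'[of x] True' by auto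
    moreover have "{snd p, snd q} = {yt, lo'}" using \<open>hi' = yt\<close> lh by (auto simp: min_def max_def)
    ultimately show ?thesis using f by blast
  next
    case False
    then have yt: "yt = y" "(x, y - 1) \<notin> A" using beyond by auto
    have "lo' = yt"
      using box'[of x "y - 1"] yt True' by (cases "lo' = y") auto
    then have "row hi'" "hi' \<noteq> yt"
      unfolding row_def using box'[of x] True' by auto
    moreover have "{snd p, snd q} = {yt, hi'}" using \<open>lo' = yt\<close> lh by (auto simp: min_def max_def)
    ultimately show ?thesis using f by blast
  qed
qed

lemma row_rect_row:
  assumes "row r" "row r'" "r \<noteq> r'" "r \<noteq> yt" "r' \<noteq> yt"
  shows "rect (A - {(x, y)}) (x, r) (Suc x, r')"
proof -
  have side: "r < yt" if "yt = Suc y" "row r" "r \<noteq> yt" for r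
    using that beyond unfolding row_def by (metis linorder_neqE_nat max.strict_order_iff min.strict_order_iff min_def nat_le_linear not_less_iff_gr_or_eq n_not_Suc_n)
  have side': "yt < r" if "yt = y" "row r" "r \<noteq> yt" for r
  proof (rule ccontr)
    assume "\<not> yt < r"
    then have "r < y" using that by simp
    then have "(x, y - 1) \<in> A" using that(1,2) unfolding row_def by auto
    then show False using beyond that(1) by auto
  qed
  have "(x, j) \<in> A - {(x, y)}" if j: "min r r' \<le> j" "j < max r r'" for j
  proof (cases "yt = Suc y")
    case True
    then have "r < yt" "r' < yt" using side assms by blast+
    then show ?thesis using assms(1,2) j True unfolding row_def by (auto simp: min_def max_def split: if_splits)
  next
    case False
    then have "yt = y" using beyond by blast
    then have "yt < r" "yt < r'" using side' assms by blast+
    then show ?thesis using assms(1,2) j \<open>yt = y\<close> unfolding row_def by (auto simp: min_def max_def split: if_splits)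
  qed
  then show ?thesis using assms(3) unfolding rect_def by (auto simp: less_Suc_eq_le)
qed

lemma peel:
  defines "v \<equiv> (xr, yt)" and "v' \<equiv> (xl, yt)"
  shows "v \<in> vertices (cell ` A)" "v' \<in> vertices (cell ` A)"
    "peelable A (A - {(x, y)}) (vertices (cell ` A) - {v, v'}) v v' ({xr} \<times> {r. r \<noteq> yt \<and> row r}) (\<lambda>u. (xl, snd u))"
proof -
  let ?B = "A - {(x, y)}" and ?V = "vertices (cell ` A)" and ?K = "{xr} \<times> {r. r \<noteq> yt \<and> row r}"
  have xx: "{xl, xr} = {x, Suc x}" "xl \<noteq> xr" by (auto simp: xl_def xr_def)
  have vB: "u \<noteq> v \<and> u \<noteq> v'" if "u \<in> vertices (cell ` ?B)" for u
  proof -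
    obtain a b where [simp]: "u = (a, b)" by (cases u)
    from that obtain i j where "(i, j) \<in> ?B" "i \<le> a" "a \<le> Suc i" "j \<le> b" "b \<le> Suc j"
      by (auto simp: in_vertices_iff)
    then show ?thesis using end_vertex[of i j a] by (auto simp: v_def v'_def xl_def xr_def)
  qed
  have rK: "rect A v' (xr, r)" if "row r" "r \<noteq> yt" for r
    using that unfolding rect_def v'_def row_def by (auto simp: xl_def xr_def min.commute max.commute less_Suc_eq_le)
  have y1: "row (if yt = Suc y then y else Suc y) \<and> (if yt = Suc y then y else Suc y) \<noteq> yt"
    using beyond c by (auto simp: row_def less_Suc_eq_le)
  let ?r1 = "if yt = Suc y then y else Suc y"
  have "rect A v' (xr, ?r1)" using rK y1 by blast
  from rect_corner_vertices[OF this] show v: "v \<in> ?V" "v' \<in> ?V"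
    by (auto simp: v_def v'_def)
  have K: "?K \<subseteq> ?V - {v, v'}" "(\<lambda>u. (xl, snd u)) ` ?K \<subseteq> ?V - {v, v'}"
    using rect_corner_vertices[OF rK] by (auto simp: v_def v'_def)
  have "balanced A (\<lambda>u. of_bool (u = v \<or> u = v'))"
    unfolding balanced_def
  proof (intro allI impI)
    fix p q assume r: "rect A p q"
    from rect_leaf[OF r] show "of_bool (p = v \<or> p = v') + of_bool (q = v \<or> q = v') =
      (of_bool ((fst p, snd q) = v \<or> (fst p, snd q) = v') +
        of_bool ((fst q, snd p) = v \<or> (fst q, snd p) = v') :: int)"
    proof
      assume "rect ?B p q"
      from rect_corner_vertices[OF this, THEN vB] show ?thesis by simp
    next
      have iff: "u = v \<or> u = v' \<longleftrightarrow> snd u = yt \<and> (fst u = x \<or> fst u = Suc x)" for u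
        using xx by (auto simp: v_def v'_def prod_eq_iff doubleton_eq_iff)
      assume "{fst p, fst q} = {x, Suc x} \<and> (\<exists>r. r \<noteq> yt \<and> row r \<and> {snd p, snd q} = {yt, r})"
      then show ?thesis unfolding iff by (auto simp: doubleton_eq_iff)
    qed
  qed
  moreover have "balanced A (\<lambda>u. of_bool (u = v \<or> u \<in> ?K))"
    unfolding balanced_def
  proof (intro allI impI)
    fix p q assume r: "rect A p q"
    have "row yt" by (simp add: row_def)
    then have iff: "u = v \<or> u \<in> ?K \<longleftrightarrow> fst u = xr \<and> row (snd u)" for u
      by (cases u) (auto simp: v_def)
    show "of_bool (p = v \<or> p \<in> ?K) + of_bool (q = v \<or> q \<in> ?K) =
      (of_bool ((fst p, snd q) = v \<or> (fst p, snd q) \<in> ?K) +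
        of_bool ((fst q, snd p) = v \<or> (fst q, snd p) \<in> ?K) :: int)"
      unfolding iff using row_rect[OF r] row_rect[of q p] r rect_commute[of A p q] by auto
  qed
  moreover have "\<exists>r0\<in>?K. \<forall>\<phi>. balanced ?B \<phi> \<longrightarrow> balanced A (\<phi>(v := \<phi> r0, v' := \<phi> (xl, snd r0)))"
  proof (rule bexI[of _ "(xr, ?r1)"], intro allI impI)
    show "(xr, ?r1) \<in> ?K" using y1 by blast
    fix \<phi> :: "point \<Rightarrow> int" assume \<phi>: "balanced ?B \<phi>"
    let ?\<phi> = "\<phi>(v := \<phi> (xr, ?r1), v' := \<phi> (xl, snd (xr, ?r1)))"
    show "balanced A ?\<phi>"
      unfolding balanced_def
    proof (intro allI impI)
      fix p q assume r: "rect A p q"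
      from rect_leaf[OF r] show "?\<phi> p + ?\<phi> q = ?\<phi> (fst p, snd q) + ?\<phi> (fst q, snd p)"
      proof
        assume rB: "rect ?B p q"
        then have "\<phi> p + \<phi> q = \<phi> (fst p, snd q) + \<phi> (fst q, snd p)"
          using \<phi> unfolding balanced_def by blast
        then show ?thesis using rect_corner_vertices[OF rB, THEN vB] by simp
      next
        assume "{fst p, fst q} = {x, Suc x} \<and> (\<exists>r. r \<noteq> yt \<and> row r \<and> {snd p, snd q} = {yt, r})"
        then obtain r where f: "{fst p, fst q} = {x, Suc x}" and r: "r \<noteq> yt" "row r" "{snd p, snd q} = {yt, r}"
          by blast
        have yt: "?\<phi> (a, yt) = \<phi> (a, ?r1)" if "a = x \<or> a = Suc x" for a
          using that xx by (auto simp: v_def v'_def doubleton_eq_iff)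
        have nyt: "?\<phi> (a, r) = \<phi> (a, r)" for a using r by (auto simp: v_def v'_def)
        have "\<phi> (x, ?r1) + \<phi> (Suc x, r) = \<phi> (x, r) + \<phi> (Suc x, ?r1)"
        proof (cases "?r1 = r")
          case False
          have "rect ?B (x, ?r1) (Suc x, r)" using row_rect_row[of ?r1 r] y1 r False by blast
          then show ?thesis using \<phi> unfolding balanced_def by fastforce
        qed simp
        then have E: "?\<phi> (x, yt) + ?\<phi> (Suc x, r) = ?\<phi> (x, r) + ?\<phi> (Suc x, yt)"
          unfolding nyt using yt by simp
        obtain p1 p2 q1 q2 where [simp]: "p = (p1, p2)" "q = (q1, q2)" by (cases p, cases q)
        from f r(3) have "(p1 = x \<and> q1 = Suc x \<or> p1 = Suc x \<and> q1 = x) \<and> (p2 = yt \<and> q2 = r \<or> p2 = r \<and> q2 = yt)"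
          by (auto simp: doubleton_eq_iff)
        moreover define \<psi> where "\<psi> = ?\<phi>"
        ultimately show ?thesis using E unfolding \<psi>_def[symmetric] by auto
      qed
    qed
  qed
  moreover have "finite ?K" using K(1) finite_vertices[OF fin] finite_subset by blast
  moreover have "{(fst v', snd u), (fst u, snd v')} = {v, (xl, snd u)}" if "u \<in> ?K" for u
    using that by (auto simp: v_def v'_def)
  ultimately show "peelable A ?B (?V - {v, v'}) v v' ?K (\<lambda>u. (xl, snd u))"
    unfolding peelable_def using K rK xx by (auto simp: v_def v'_def)
qed

end

lemma rect_swap: "rect (prod.swap ` A) p q \<longleftrightarrow> rect A (prod.swap p) (prod.swap q)"
proof -
  have "(i, j) \<in> prod.swap ` A \<longleftrightarrow> (j, i) \<in> A" for i j by auto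
  then show ?thesis unfolding rect_def by auto
qed

lemma balanced_swap: "balanced (prod.swap ` A) \<phi> \<longleftrightarrow> balanced A (\<phi> \<circ> prod.swap)"
  unfolding balanced_def rect_swap by (simp add: prod.swap_def add.commute) blast

lemma peelable_swap:
  assumes "peelable A B W v v' K g"
  shows "peelable (prod.swap ` A) (prod.swap ` B) (prod.swap ` W) (prod.swap v) (prod.swap v')
    (prod.swap ` K) (prod.swap \<circ> g \<circ> prod.swap)"
proof -
  have e: "prod.swap u = prod.swap u' \<longleftrightarrow> u = u'" "prod.swap u = u' \<longleftrightarrow> u = prod.swap u'"
    "u \<in> prod.swap ` S \<longleftrightarrow> prod.swap u \<in> S" for u u' :: point and S
    by (cases u; cases u'; auto)+
  obtain r0 where r0: "r0 \<in> K" "\<And>\<phi>. balanced B \<phi> \<Longrightarrow> balanced A (\<phi>(v := \<phi> r0, v' := \<phi> (g r0)))"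
    using assms unfolding peelable_def by blast
  have "balanced (prod.swap ` A) (\<phi>(prod.swap v := \<phi> (prod.swap r0), prod.swap v' := \<phi> (prod.swap (g r0))))"
    if "balanced (prod.swap ` B) \<phi>" for \<phi>
  proof -
    have "\<phi>(prod.swap v := \<phi> (prod.swap r0), prod.swap v' := \<phi> (prod.swap (g r0))) \<circ> prod.swap =
      (\<phi> \<circ> prod.swap)(v := (\<phi> \<circ> prod.swap) r0, v' := (\<phi> \<circ> prod.swap) (g r0))"
      by (rule ext) (simp add: e(1))
    then show ?thesis using r0(2) that unfolding balanced_swap by metis
  qed
  then have "\<exists>r1\<in>prod.swap ` K. \<forall>\<phi>. balanced (prod.swap ` B) \<phi> \<longrightarrow>
      balanced (prod.swap ` A) (\<phi>(prod.swap v := \<phi> r1, prod.swap v' := \<phi> ((prod.swap \<circ> g \<circ> prod.swap) r1)))"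
    by (intro bexI[of _ "prod.swap r0"]) (use r0(1) in auto)
  moreover have "balanced (prod.swap ` A) (\<lambda>u. of_bool (u = prod.swap v \<or> u = prod.swap v'))"
    "balanced (prod.swap ` A) (\<lambda>u. of_bool (u = prod.swap v \<or> u \<in> prod.swap ` K))"
    using assms unfolding peelable_def balanced_swap by (simp_all add: comp_def e)
  moreover have "rect (prod.swap ` A) (prod.swap v') r \<and>
      {(fst (prod.swap v'), snd r), (fst r, snd (prod.swap v'))} = {prod.swap v, (prod.swap \<circ> g \<circ> prod.swap) r}"
    if "r \<in> prod.swap ` K" for r
  proof -
    from that obtain r' where r': "r = prod.swap r'" "r' \<in> K" by blast
    then have r: "rect A v' r'" and s: "{(fst v', snd r'), (fst r', snd v')} = {v, g r'}"
      using assms unfolding peelable_def by blast+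
    have "prod.swap ` {(fst v', snd r'), (fst r', snd v')} = {prod.swap v, prod.swap (g r')}"
      unfolding s by simp
    moreover have "{(fst (prod.swap v'), snd r), (fst r, snd (prod.swap v'))} =
        prod.swap ` {(fst v', snd r'), (fst r', snd v')}"
      unfolding r'(1) by (simp add: insert_commute)
    moreover have "rect (prod.swap ` A) (prod.swap v') r"
      unfolding rect_swap r'(1) using r by simp
    ultimately show ?thesis unfolding r'(1) by simp
  qed
  moreover have "B \<subseteq> A" "v \<noteq> v'" "v \<notin> W" "v' \<notin> W" "finite K" "K \<subseteq> W" "g ` K \<subseteq> W"
    using assms unfolding peelable_def by blast+
  then have "prod.swap ` B \<subseteq> prod.swap ` A" "prod.swap v \<noteq> prod.swap v'" "finite (prod.swap ` K)"
    "prod.swap ` K \<subseteq> prod.swap ` W" "(prod.swap \<circ> g \<circ> prod.swap) ` prod.swap ` K \<subseteq> prod.swap ` W"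
    "prod.swap v \<notin> prod.swap ` W" "prod.swap v' \<notin> prod.swap ` W"
    by (auto simp: e(1))[5] (simp_all only: inj_image_mem_iff[OF inj_swap] \<open>v \<notin> W\<close> \<open>v' \<notin> W\<close>, simp_all)
  ultimately show ?thesis
    unfolding peelable_def by blast
qed

lemma vertices_swap: "vertices (cell ` prod.swap ` A) = prod.swap ` vertices (cell ` A)"
proof -
  have "p \<in> vertices (cell ` prod.swap ` A) \<longleftrightarrow> prod.swap p \<in> vertices (cell ` A)" for p
    unfolding vertices_def by (auto simp: cell_iff)
  moreover have "p \<in> prod.swap ` S \<longleftrightarrow> prod.swap p \<in> S" for p :: point and S by (cases p) auto
  ultimately show ?thesis by blast
qed

lemma leaf_peelable:
  assumes A: "finite A" "A \<subseteq> {1..} \<times> {1..}"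
     "\<And>i j. (i, j) \<in> A \<Longrightarrow> (Suc i, Suc j) \<in> A \<Longrightarrow> (Suc i, j) \<in> A \<or> (i, Suc j) \<in> A"
     "\<And>i j. (i, Suc j) \<in> A \<Longrightarrow> (Suc i, j) \<in> A \<Longrightarrow> (i, j) \<in> A \<or> (Suc i, Suc j) \<in> A"
    and l: "leaf A c d" "fst c = fst d" and f: "free_side A c s"
  shows "\<exists>v v' K g. v \<in> vertices (cell ` A) \<and> v' \<in> vertices (cell ` A) \<and>
    peelable A (A - {c}) (vertices (cell ` A) - {v, v'}) v v' K g \<and>
    vertices (cell ` A) - {v, v'} \<subseteq> vertices (cell ` (A - {c}))"
proof -
  obtain x y where cxy: "c = (x, y)" by (cases c)
  have cA: "(x, y) \<in> A" "d \<in> A" "adjacent (x, y) d" and ld: "\<And>q. q \<in> A \<Longrightarrow> adjacent (x, y) q \<Longrightarrow> q = d"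
    using l(1) cxy unfolding leaf_def by blast+
  have xy: "x \<noteq> 0" "y \<noteq> 0" using A(2) cA by auto
  have d: "d = (x, Suc y) \<or> d = (x, y - 1)" using cA(3) l(2) cxy by (cases d) (auto simp: adjacent_def)
  define yt where "yt = (if d = (x, Suc y) then y else Suc y)"
  interpret leaf_column A x y s yt
  proof
    show "(Suc x, y) \<notin> A" using ld[of "(Suc x, y)"] d by (auto simp: adjacent_def)
    show "(x - 1, y) \<notin> A" using ld[of "(x - 1, y)"] d xy by (auto simp: adjacent_def)
    show "yt = Suc y \<and> (x, Suc y) \<notin> A \<or> yt = y \<and> (x, y - 1) \<notin> A"
      using ld[of "(x, Suc y)"] ld[of "(x, y - 1)"] xy by (auto simp: adjacent_def yt_def)
  qed (use A cA f cxy in auto)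
  have "vertices (cell ` A) - {(xr, yt), (xl, yt)} \<subseteq> vertices (cell ` (A - {c}))"
  proof
    fix u assume u: "u \<in> vertices (cell ` A) - {(xr, yt), (xl, yt)}"
    obtain a b where ab: "u = (a, b)" by (cases u)
    from u obtain i j where ij: "(i, j) \<in> A" "i \<le> a" "a \<le> Suc i" "j \<le> b" "b \<le> Suc j"
      unfolding ab by (auto simp: in_vertices_iff)
    show "u \<in> vertices (cell ` (A - {c}))"
    proof (cases "(i, j) = c")
      case False
      then show ?thesis using ij unfolding ab in_vertices_iff by blast
    next
      case True
      have e: "i = x" "j = y" using True cxy by simp_all
      then have "a = x \<or> a = Suc x" using ij by auto
      then have "b \<noteq> yt" using u unfolding ab by (auto simp: xl_def xr_def split: if_splits)
      obtain k where k: "d = (x, k)" using d by blast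
      have "k \<le> b \<and> b \<le> Suc k" using d k \<open>b \<noteq> yt\<close> e ij xy by (auto simp: yt_def split: if_splits)
      moreover have "(x, k) \<in> A - {c}" using cA k cxy by (auto simp: adjacent_def)
      ultimately show ?thesis using ij e unfolding ab in_vertices_iff by blast
    qed
  qed
  then show ?thesis using peel cxy by blast
qed

lemma saturated_mono: "saturated A W \<Longrightarrow> W' \<subseteq> W \<Longrightarrow> saturated A W'"
  unfolding saturated_def monomials_def by blast

lemma saturated_empty: "saturated {} W"
  unfolding saturated_def
proof (intro ballI impI)
  fix a b :: "point monom"
  assume eq: "\<forall>\<phi>. balanced {} \<phi> \<longrightarrow> weight \<phi> a = weight \<phi> b"
  have b: "balanced {} \<phi>" for \<phi>
  proof -
    have "\<not> rect {} p q" for p q using rect_corner_vertices(1)[of "{}" p q] by (auto simp: vertices_def)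
    then show ?thesis by (simp add: balanced_def)
  qed
  have "Poly_Mapping.lookup a v = Poly_Mapping.lookup b v" for v
    using eq[rule_format, OF b, of "\<lambda>u. of_bool (u \<in> {v})"] weight_of_bool[of "{v}"] by simp
  then have "a = b" by (intro poly_mapping_eqI) simp
  then show "swap_equiv {} a b" using swap_equiv.swap_refl by simp
qed

lemma saturated_tree: "tree_grid A \<Longrightarrow> saturated A (vertices (cell ` A))"
proof (induction "card A" arbitrary: A rule: less_induct)
  case less
  have A: "finite A" "A \<noteq> {}" "A \<subseteq> {1..} \<times> {1..}"
     "\<And>i j. (i, j) \<in> A \<Longrightarrow> (Suc i, Suc j) \<in> A \<Longrightarrow> (Suc i, j) \<in> A \<or> (i, Suc j) \<in> A"
     "\<And>i j. (i, Suc j) \<in> A \<Longrightarrow> (Suc i, j) \<in> A \<Longrightarrow> (i, j) \<in> A \<or> (Suc i, Suc j) \<in> A"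
    using less.prems unfolding tree_grid_def by blast+
  let ?V = "\<lambda>A. vertices (cell ` A)"
  have glue: "saturated A (?V A)"
    if "v \<in> ?V A" "v' \<in> ?V A" "peelable A B (?V A - {v, v'}) v v' K g" "saturated B (?V A - {v, v'})"
    for v v' B K g
  proof -
    have "insert v (insert v' (?V A - {v, v'})) = ?V A" using that by blast
    then show ?thesis using saturated_peel[OF that(3,4)] by metis
  qed
  obtain c0 where c0: "c0 \<in> A" using A by blast
  show ?case
  proof (cases "A = {c0}")
    case True
    obtain x y where cxy: "c0 = (x, y)" by (cases c0)
    have "x \<noteq> 0" "y \<noteq> 0" using A(3) c0 cxy by auto
    then interpret leaf_column A x y "Suc x" "Suc y"
      using A True cxy by unfold_locales (auto simp: free_side_def)
    show ?thesis using glue [OF peel] saturated_empty True cxy by simp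
  next
    case False
    obtain c d where l: "leaf A c d" and dir:
      "fst c = fst d \<and> (\<exists>s. free_side A c s) \<or> snd c = snd d \<and> (\<exists>s. free_side (prod.swap ` A) (prod.swap c) s)"
      using good_leaf[OF less.prems False c0] by metis
    have "c \<in> A" using l by (simp add: leaf_def)
    then have IH: "saturated (A - {c}) (?V (A - {c}))"
      using less.hyps[of "A - {c}"] tree_grid_remove_leaf[OF less.prems l] A(1)
      by (metis card_Diff1_less)
    from dir show ?thesis
    proof
      assume "fst c = fst d \<and> (\<exists>s. free_side A c s)"
      then obtain v v' K g where "v \<in> ?V A" "v' \<in> ?V A" "peelable A (A - {c}) (?V A - {v, v'}) v v' K g"
        "?V A - {v, v'} \<subseteq> ?V (A - {c})"
        using leaf_peelable[OF A(1,3,4,5) l] by blast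
      then show ?thesis using glue saturated_mono[OF IH] by blast
    next
      assume "snd c = snd d \<and> (\<exists>s. free_side (prod.swap ` A) (prod.swap c) s)"
      then obtain s where s: "snd c = snd d" "free_side (prod.swap ` A) (prod.swap c) s" by blast
      let ?A = "prod.swap ` A"
      have "\<exists>v v' K g. v \<in> ?V ?A \<and> v' \<in> ?V ?A \<and>
          peelable ?A (?A - {prod.swap c}) (?V ?A - {v, v'}) v v' K g \<and>
          ?V ?A - {v, v'} \<subseteq> ?V (?A - {prod.swap c})"
      proof (rule leaf_peelable[OF _ _ _ _ leaf_swap[OF l] _ s(2)])
        have m: "(i, j) \<in> ?A \<longleftrightarrow> (j, i) \<in> A" for i j by auto
        show "(Suc i, j) \<in> ?A \<or> (i, Suc j) \<in> ?A" if "(i, j) \<in> ?A" "(Suc i, Suc j) \<in> ?A" for i j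
          using that A(4)[of j i] unfolding m by blast
        show "(i, j) \<in> ?A \<or> (Suc i, Suc j) \<in> ?A" if "(i, Suc j) \<in> ?A" "(Suc i, j) \<in> ?A" for i j
          using that A(5)[of j i] unfolding m by blast
      qed (use A s in auto)
      then obtain v v' K g where v: "v \<in> ?V ?A" "v' \<in> ?V ?A"
        "peelable ?A (?A - {prod.swap c}) (?V ?A - {v, v'}) v v' K g"
        "?V ?A - {v, v'} \<subseteq> ?V (?A - {prod.swap c})" by blast
      have W: "prod.swap ` (?V ?A - {v, v'}) = ?V A - {prod.swap v, prod.swap v'}"
        unfolding vertices_swap by (simp add: image_set_diff[OF inj_swap] swap_swap_image)
      have "prod.swap ` (?A - {prod.swap c}) = A - {c}"
        by (simp add: image_set_diff[OF inj_swap] swap_swap_image)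
      then have "peelable A (A - {c}) (?V A - {prod.swap v, prod.swap v'}) (prod.swap v) (prod.swap v')
          (prod.swap ` K) (prod.swap \<circ> g \<circ> prod.swap)"
        using peelable_swap[OF v(3)] unfolding W by (simp add: swap_swap_image)
      moreover have "prod.swap v \<in> ?V A" "prod.swap v' \<in> ?V A"
        using v(1,2) unfolding vertices_swap by auto
      moreover have "?V A - {prod.swap v, prod.swap v'} \<subseteq> ?V (A - {c})"
        using image_mono[OF v(4), of prod.swap] unfolding W
        by (simp add: vertices_swap[symmetric] image_set_diff[OF inj_swap] swap_swap_image)
      ultimately show ?thesis using glue saturated_mono[OF IH] by blast
    qed
  qed
qed

section \<open>Ideals and monomial orders\<close>

lemma poly_ring_ops [simp]:
  "x \<otimes>\<^bsub>poly_ring V\<^esub> y = x * y" "x \<oplus>\<^bsub>poly_ring V\<^esub> y = x + y"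
  "\<one>\<^bsub>poly_ring V\<^esub> = 1" "\<zero>\<^bsub>poly_ring V\<^esub> = 0"
  by (simp_all add: poly_ring_def)

lemma carrier_poly_ring: "p \<in> carrier (poly_ring V) \<longleftrightarrow> Poly_Mapping.keys p \<subseteq> monomials V"
  by (simp add: poly_ring_def)

lemma poly_ring_uminus: "p \<in> carrier (poly_ring V) \<Longrightarrow> - p \<in> carrier (poly_ring V)"
  by (simp add: carrier_poly_ring)

lemma poly_ring_mult:
  "p \<in> carrier (poly_ring V) \<Longrightarrow> q \<in> carrier (poly_ring V) \<Longrightarrow> p * q \<in> carrier (poly_ring V)"
  using cring.cring_simprules(5)[OF cring_poly_ring] by fastforce

lemma poly_ring_add:
  "p \<in> carrier (poly_ring V) \<Longrightarrow> q \<in> carrier (poly_ring V) \<Longrightarrow> p + q \<in> carrier (poly_ring V)"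
  using cring.cring_simprules(1)[OF cring_poly_ring] by fastforce

lemma poly_ring_diff:
  "p \<in> carrier (poly_ring V) \<Longrightarrow> q \<in> carrier (poly_ring V) \<Longrightarrow> p - q \<in> carrier (poly_ring V)"
  using poly_ring_add[of p V "- q"] poly_ring_uminus by fastforce

lemma poly_ring_single: "m \<in> monomials V \<Longrightarrow> Poly_Mapping.single m c \<in> carrier (poly_ring V)"
  by (simp add: carrier_poly_ring)

lemma poly_ring_prod:
  "(\<And>i. i \<in> X \<Longrightarrow> h i \<in> carrier (poly_ring V)) \<Longrightarrow> prod h X \<in> carrier (poly_ring V)"
  by (induction X rule: infinite_finite_induct)
    (auto simp: poly_ring_mult poly_ring_single monomials_def simp flip: single_one)

lemma ideal_polyI:
  assumes "I \<subseteq> carrier (poly_ring V)" "0 \<in> I" "\<And>x y. x \<in> I \<Longrightarrow> y \<in> I \<Longrightarrow> x + y \<in> I"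
    "\<And>c x. c \<in> carrier (poly_ring V) \<Longrightarrow> x \<in> I \<Longrightarrow> c * x \<in> I"
  shows "ideal I (poly_ring V)"
proof (rule idealI)
  interpret cring "poly_ring V :: ('a, 'b) mpoly ring" by (rule cring_poly_ring)
  show "ring (poly_ring V :: ('a, 'b) mpoly ring)" by (rule ring_axioms)
  show "subgroup I (add_monoid (poly_ring V))"
  proof
    fix x assume x: "x \<in> I"
    then have "x \<in> carrier (poly_ring V)" using assms(1) by blast
    then have "\<ominus>\<^bsub>poly_ring V\<^esub> x = - x"
      by (intro minus_equality) (auto simp: poly_ring_uminus)
    moreover have "- 1 \<in> carrier (poly_ring V :: ('a, 'b) mpoly ring)"
      using one_closed poly_ring_uminus by fastforce
    then have "- x \<in> I" using assms(4)[OF _ x] by fastforce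
    ultimately show "inv\<^bsub>add_monoid (poly_ring V)\<^esub> x \<in> I" by (simp add: a_inv_def)
  qed (use assms in auto)
  show "x \<otimes>\<^bsub>poly_ring V\<^esub> a \<in> I" "a \<otimes>\<^bsub>poly_ring V\<^esub> x \<in> I"
    if "a \<in> I" "x \<in> carrier (poly_ring V)" for a x
    using assms(4)[OF that(2,1)] by (simp_all add: mult.commute[of a])
qed

lemma ideal_poly:
  fixes I :: "('v, 'k::field) mpoly set"
  assumes "ideal I (poly_ring V)"
  shows "I \<subseteq> carrier (poly_ring V)" "0 \<in> I" "\<And>x y. x \<in> I \<Longrightarrow> y \<in> I \<Longrightarrow> x + y \<in> I"
    "\<And>c x. c \<in> carrier (poly_ring V) \<Longrightarrow> x \<in> I \<Longrightarrow> c * x \<in> I"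
    "\<And>x. x \<in> I \<Longrightarrow> - x \<in> I" "\<And>x y. x \<in> I \<Longrightarrow> y \<in> I \<Longrightarrow> x - y \<in> I"
proof -
  interpret ideal I "poly_ring V" by fact
  show sub: "I \<subseteq> carrier (poly_ring V)" using Icarr by blast
  show "0 \<in> I" using additive_subgroup.zero_closed[OF additive_subgroup_axioms] by simp
  show add: "\<And>x y. x \<in> I \<Longrightarrow> y \<in> I \<Longrightarrow> x + y \<in> I"
    using additive_subgroup.a_closed[OF additive_subgroup_axioms] by simp
  show mult: "\<And>c x. c \<in> carrier (poly_ring V) \<Longrightarrow> x \<in> I \<Longrightarrow> c * x \<in> I" using I_l_closed by simp
  have "- 1 \<in> carrier (poly_ring V :: ('v, 'k) mpoly ring)"
    using one_closed poly_ring_uminus by fastforce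
  then show neg: "- x \<in> I" if "x \<in> I" for x using mult[OF _ that] by fastforce
  show "x - y \<in> I" if "x \<in> I" "y \<in> I" for x y using add[OF that(1) neg[OF that(2)]] by simp
qed

lemma ideal_poly_sum:
  assumes "ideal I (poly_ring V)" "\<And>i. i \<in> X \<Longrightarrow> h i \<in> I"
  shows "sum h X \<in> I"
  using assms(2) by (induction X rule: infinite_finite_induct) (auto simp: ideal_poly[OF assms(1)])

lemma principal_ideal_iff:
  fixes F :: "('v, 'k::field) mpoly"
  assumes "F \<in> carrier (poly_ring V)"
  shows "p \<in> Idl\<^bsub>poly_ring V\<^esub> {F} \<longleftrightarrow> (\<exists>q\<in>carrier (poly_ring V). p = q * F)"
  using cring.cgenideal_eq_genideal[OF cring_poly_ring assms]
  by (auto simp: cgenideal_def simp flip: Bex_def)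

lemma ideal_Idl: "S \<subseteq> carrier (poly_ring V) \<Longrightarrow> ideal (Idl\<^bsub>poly_ring V\<^esub> S) (poly_ring V)"
  by (rule ring.genideal_ideal[OF cring.axioms(1)[OF cring_poly_ring]])

lemma Idl_self: "S \<subseteq> carrier (poly_ring V) \<Longrightarrow> S \<subseteq> Idl\<^bsub>poly_ring V\<^esub> S"
  by (rule ring.genideal_self[OF cring.axioms(1)[OF cring_poly_ring]])

lemma Idl_minimal: "ideal I (poly_ring V) \<Longrightarrow> S \<subseteq> I \<Longrightarrow> Idl\<^bsub>poly_ring V\<^esub> S \<subseteq> I"
  by (rule ring.genideal_minimal[OF cring.axioms(1)[OF cring_poly_ring]])

lemma colon_principal:
  assumes I: "ideal I (poly_ring V)" and g: "g \<in> carrier (poly_ring V)"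
  shows "colon_ideal (poly_ring V) I (Idl\<^bsub>poly_ring V\<^esub> {g}) = {p \<in> carrier (poly_ring V). p * g \<in> I}"
proof -
  have "g \<in> Idl\<^bsub>poly_ring V\<^esub> {g}" using Idl_self g by blast
  moreover have "p * (q * g) \<in> I" if "q \<in> carrier (poly_ring V)" "p * g \<in> I" for p q
    using ideal_poly(4)[OF I that] by (simp add: ac_simps)
  ultimately show ?thesis
    unfolding colon_ideal_def by (auto simp: principal_ideal_iff[OF g])
qed

lemma ideal_colon_principal:
  assumes I: "ideal I (poly_ring V)" and g: "g \<in> carrier (poly_ring V)"
  shows "ideal {p \<in> carrier (poly_ring V). p * g \<in> I} (poly_ring V)"
proof (rule ideal_polyI)
  show "0 \<in> {p \<in> carrier (poly_ring V). p * g \<in> I}"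
    using ideal_poly(2)[OF I] by (simp add: carrier_poly_ring)
  show "x + y \<in> {p \<in> carrier (poly_ring V). p * g \<in> I}"
    if "x \<in> {p \<in> carrier (poly_ring V). p * g \<in> I}" "y \<in> {p \<in> carrier (poly_ring V). p * g \<in> I}" for x y
    using that poly_ring_add ideal_poly(3)[OF I] by (auto simp: distrib_right)
  show "c * x \<in> {p \<in> carrier (poly_ring V). p * g \<in> I}"
    if "c \<in> carrier (poly_ring V)" "x \<in> {p \<in> carrier (poly_ring V). p * g \<in> I}" for c x
    using that poly_ring_mult ideal_poly(4)[OF I] by (auto simp: mult.assoc)
qed auto

lemma knutson_factor:
  fixes F g :: "('v::linorder, 'k::field) mpoly"
  assumes F: "F \<in> carrier (poly_ring V)" and g: "g \<in> carrier (poly_ring V)" "g \<noteq> 0" and f: "f = g * F"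
  shows "Idl\<^bsub>poly_ring V\<^esub> {F} \<in> knutson_family (poly_ring V) f"
proof -
  have fc: "f \<in> carrier (poly_ring V)" using poly_ring_mult F g f by blast
  have "colon_ideal (poly_ring V) (Idl\<^bsub>poly_ring V\<^esub> {f}) (Idl\<^bsub>poly_ring V\<^esub> {g}) =
      {p \<in> carrier (poly_ring V). p * g \<in> Idl\<^bsub>poly_ring V\<^esub> {f}}"
    using colon_principal[OF ideal_Idl g(1)] fc by blast
  also have "\<dots> = Idl\<^bsub>poly_ring V\<^esub> {F}"
  proof -
    have "p * g = q * f \<longleftrightarrow> p = q * F" for p q
    proof -
      have "q * f = (q * F) * g" by (simp add: f ac_simps)
      then show ?thesis by (simp only: mult_cancel_right g(2) simp_thms)
    qed
    then have "p \<in> {p \<in> carrier (poly_ring V). p * g \<in> Idl\<^bsub>poly_ring V\<^esub> {f}} \<longleftrightarrow>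
        p \<in> Idl\<^bsub>poly_ring V\<^esub> {F}" for p
      using principal_ideal_iff[OF fc] principal_ideal_iff[OF F] poly_ring_mult[OF _ F] by auto
    then show ?thesis by blast
  qed
  finally show ?thesis
    using knutson_family.colon[OF knutson_family.principal ideal_Idl] g(1) by (metis empty_subsetI insert_subset)
qed

lemma knutson_finite_sum:
  fixes h :: "'i \<Rightarrow> ('v, 'k::field) mpoly"
  assumes "finite X" "X \<noteq> {}" "\<And>i. i \<in> X \<Longrightarrow> h i \<in> carrier (poly_ring V)"
    "\<And>i. i \<in> X \<Longrightarrow> Idl\<^bsub>poly_ring V\<^esub> {h i} \<in> knutson_family (poly_ring V) f"
  shows "Idl\<^bsub>poly_ring V\<^esub> (h ` X) \<in> knutson_family (poly_ring V) f"
  using assms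
proof (induction X rule: finite_ne_induct)
  case (singleton i)
  then show ?case by simp
next
  case (insert i X)
  let ?A = "Idl\<^bsub>poly_ring V\<^esub> {h i}" and ?B = "Idl\<^bsub>poly_ring V\<^esub> (h ` X)"
  have c: "{h i} \<subseteq> carrier (poly_ring V)" "h ` X \<subseteq> carrier (poly_ring V)" using insert.prems(1) by auto
  have "Idl\<^bsub>poly_ring V\<^esub> (?A \<union> ?B) = ?A <+>\<^bsub>poly_ring V\<^esub> ?B"
    by (rule ring.union_genideal[OF cring.axioms(1)[OF cring_poly_ring] ideal_Idl[OF c(1)] ideal_Idl[OF c(2)]])
  moreover have "Idl\<^bsub>poly_ring V\<^esub> (?A \<union> ?B) = Idl\<^bsub>poly_ring V\<^esub> (h ` insert i X)"
  proof
    have cc: "h ` insert i X \<subseteq> carrier (poly_ring V)" using c by auto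
    have "?A \<subseteq> Idl\<^bsub>poly_ring V\<^esub> (h ` insert i X)" "?B \<subseteq> Idl\<^bsub>poly_ring V\<^esub> (h ` insert i X)"
      using Idl_self[OF cc] by (intro Idl_minimal[OF ideal_Idl[OF cc]]; blast)+
    then show "Idl\<^bsub>poly_ring V\<^esub> (?A \<union> ?B) \<subseteq> Idl\<^bsub>poly_ring V\<^esub> (h ` insert i X)"
      by (intro Idl_minimal[OF ideal_Idl[OF cc]]) blast
    have ab: "?A \<union> ?B \<subseteq> carrier (poly_ring V)"
      using ideal_poly(1)[OF ideal_Idl[OF c(1)]] ideal_poly(1)[OF ideal_Idl[OF c(2)]] by blast
    show "Idl\<^bsub>poly_ring V\<^esub> (h ` insert i X) \<subseteq> Idl\<^bsub>poly_ring V\<^esub> (?A \<union> ?B)"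
      using Idl_self[OF ab] Idl_self[OF c(1)] Idl_self[OF c(2)]
      by (intro Idl_minimal[OF ideal_Idl[OF ab]]) blast
  qed
  moreover have "?A <+>\<^bsub>poly_ring V\<^esub> ?B \<in> knutson_family (poly_ring V) f"
    using insert by (intro knutson_family.sum) auto
  ultimately show ?case by simp
qed

definition weight_order :: "'v set \<Rightarrow> ('v \<Rightarrow> int) \<Rightarrow> ('v::linorder) monom rel" where
  "weight_order V w =
     {(m, n). m \<in> monomials V \<and> n \<in> monomials V \<and> (weight w m, m) \<le> (weight w n, n)}"

lemma weight_order_add_mono:
  assumes "(weight w m, m) \<le> (weight w n, n)"
  shows "(weight w (m + u), m + u) \<le> (weight w (n + u), n + u)"
  using assms unfolding less_eq_prod_def by (auto simp: weight_add add_right_mono)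

lemma monomial_order_weight_order:
  assumes "\<And>v. v \<in> V \<Longrightarrow> w v \<ge> 0"
  shows "monomial_order V (weight_order V w)"
  unfolding monomial_order_def
proof (intro conjI ballI allI impI)
  show "linear_order_on (monomials V) (weight_order V w)"
    unfolding linear_order_on_def partial_order_on_def preorder_on_def
    by (auto simp: weight_order_def refl_on_def total_on_def intro!: transI antisymI)
next
  fix m assume m: "m \<in> monomials V"
  have "weight w m \<ge> 0"
    unfolding weight_def using m assms by (intro sum_nonneg) (auto simp: monomials_def)
  moreover have "0 \<le> m"
    by (rule ccontr) (auto simp: not_le less_poly_mapping.rep_eq less_fun_def)
  ultimately show "(0, m) \<in> weight_order V w"
    using m by (auto simp: weight_order_def monomials_def less_eq_prod_def weight_def)
next
  fix m n u assume "(m, n) \<in> weight_order V w" "u \<in> monomials V"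
  then show "(m + u, n + u) \<in> weight_order V w"
    using weight_order_add_mono by (auto simp: weight_order_def monomials_add)
qed

definition leads :: "'v monom rel \<Rightarrow> ('v, 'k::field) mpoly \<Rightarrow> 'v monom \<Rightarrow> bool" where
  "leads r p m \<longleftrightarrow> m \<in> Poly_Mapping.keys p \<and> (\<forall>n\<in>Poly_Mapping.keys p. (n, m) \<in> r)"

lemma initial_monomial_eq:
  assumes "leads (weight_order V w) f m"
  shows "initial_monomial (weight_order V w) f = m"
  unfolding initial_monomial_def
proof (rule the_equality)
  show "m \<in> Poly_Mapping.keys f \<and> (\<forall>n\<in>Poly_Mapping.keys f. (n, m) \<in> weight_order V w)"
    using assms by (simp add: leads_def)
  fix m' assume "m' \<in> Poly_Mapping.keys f \<and> (\<forall>n\<in>Poly_Mapping.keys f. (n, m') \<in> weight_order V w)"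
  then have "(weight w m', m') \<le> (weight w m, m)" "(weight w m, m) \<le> (weight w m', m')"
    using assms unfolding leads_def weight_order_def by blast+
  then have "(weight w m', m') = (weight w m, m)" by (rule antisym)
  then show "m' = m" by simp
qed

lemma poly_mapping_sum_single:
  "p = (\<Sum>m\<in>Poly_Mapping.keys p. Poly_Mapping.single m (Poly_Mapping.lookup p m))"
  by (rule poly_mapping_eqI)
    (simp add: lookup_sum lookup_single when_def sum.delta' in_keys_iff)

lemma mult_sum_single:
  fixes p q :: "('v, 'k::field) mpoly"
  shows "p * q = (\<Sum>a\<in>Poly_Mapping.keys p. \<Sum>b\<in>Poly_Mapping.keys q.
    Poly_Mapping.single (a + b) (Poly_Mapping.lookup p a * Poly_Mapping.lookup q b))"
  by (subst (1) poly_mapping_sum_single[of p], subst (1) poly_mapping_sum_single[of q])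
    (simp add: sum_product mult_single)

lemma leads_mult:
  fixes p q :: "('v::linorder, 'k::field) mpoly"
  assumes p: "leads (weight_order V w) p m" and q: "leads (weight_order V w) q n"
  shows "leads (weight_order V w) (p * q) (m + n)"
proof -
  let ?l = Poly_Mapping.lookup
  have le: "(a, m) \<in> weight_order V w" "(b, n) \<in> weight_order V w"
    if "a \<in> Poly_Mapping.keys p" "b \<in> Poly_Mapping.keys q" for a b
    using p q that unfolding leads_def by blast+
  have eq: "a = m \<and> b = n" if ab: "a \<in> Poly_Mapping.keys p" "b \<in> Poly_Mapping.keys q" "a + b = m + n" for a b
  proof -
    have "(weight w a, a) \<le> (weight w m, m)" "(weight w b, b) \<le> (weight w n, n)"
      using le[OF ab(1,2)] by (auto simp: weight_order_def)
    moreover have "weight w a + weight w b = weight w m + weight w n"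
      using arg_cong[OF ab(3), of "weight w"] by (simp add: weight_add)
    ultimately have "a \<le> m" "b \<le> n" unfolding less_eq_prod_def by auto
    then show ?thesis using ab(3) by (metis add_less_le_mono add_le_less_mono order_le_less order_less_irrefl)
  qed
  have mk: "m \<in> Poly_Mapping.keys p" "n \<in> Poly_Mapping.keys q" using p q by (auto simp: leads_def)
  have "?l (p * q) (m + n) = (\<Sum>a\<in>Poly_Mapping.keys p. \<Sum>b\<in>Poly_Mapping.keys q.
      (if a = m then if b = n then ?l p m * ?l q n else 0 else 0))"
    unfolding mult_sum_single[of p q] lookup_sum
    by (intro sum.cong refl) (use eq in \<open>auto simp: lookup_single when_def\<close>)
  also have "\<dots> = (\<Sum>a\<in>Poly_Mapping.keys p. if a = m then ?l p m * ?l q n else 0)"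
  proof (rule sum.cong[OF refl])
    fix a
    show "(\<Sum>b\<in>Poly_Mapping.keys q. (if a = m then if b = n then ?l p m * ?l q n else 0 else 0)) =
        (if a = m then ?l p m * ?l q n else 0)"
      using mk by (cases "a = m") simp_all
  qed
  also have "\<dots> = ?l p m * ?l q n" using mk by simp
  finally have "?l (p * q) (m + n) \<noteq> 0" using mk by (simp add: in_keys_iff)
  moreover have "(k, m + n) \<in> weight_order V w" if "k \<in> Poly_Mapping.keys (p * q)" for k
  proof -
    obtain a b where ab: "a \<in> Poly_Mapping.keys p" "b \<in> Poly_Mapping.keys q" "k = a + b"
      using keys_mult[of p q] \<open>k \<in> _\<close> by blast
    have "(weight w (a + b), a + b) \<le> (weight w (m + b), m + b)"
      using le[OF ab(1,2)] weight_order_add_mono by (auto simp: weight_order_def)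
    also have "\<dots> \<le> (weight w (m + n), m + n)"
      using le[OF ab(1,2)] weight_order_add_mono[of w b n m] by (auto simp: weight_order_def add.commute)
    finally show ?thesis
      using le[OF ab(1,2)] ab(3) by (auto simp: weight_order_def monomials_add)
  qed
  ultimately show ?thesis by (auto simp: leads_def in_keys_iff)
qed

lemma leads_prod:
  fixes h :: "'i \<Rightarrow> ('v::linorder, 'k::field) mpoly"
  assumes "finite X" "\<And>i. i \<in> X \<Longrightarrow> leads (weight_order V w) (h i) (l i)"
  shows "leads (weight_order V w) (prod h X) (sum l X)"
  using assms
proof (induction X rule: finite_induct)
  case empty
  then show ?case by (simp add: leads_def weight_order_def monomials_def)
next
  case (insert i X)
  then show ?case by (simp add: leads_mult)
qed

section \<open>The polyomino ideal is toric\<close>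

definition functional :: "('v monom \<Rightarrow> 'k) \<Rightarrow> ('v, 'k::field) mpoly \<Rightarrow> 'k" where
  "functional \<chi> p = (\<Sum>m\<in>Poly_Mapping.keys p. Poly_Mapping.lookup p m * \<chi> m)"

lemma functional_superset:
  assumes "finite S" "Poly_Mapping.keys p \<subseteq> S"
  shows "functional \<chi> p = (\<Sum>m\<in>S. Poly_Mapping.lookup p m * \<chi> m)"
  unfolding functional_def by (rule sum.mono_neutral_left[OF assms]) (auto simp: in_keys_iff)

lemma functional_add: "functional \<chi> (p + q) = functional \<chi> p + functional \<chi> q"
proof -
  let ?S = "Poly_Mapping.keys p \<union> Poly_Mapping.keys q"
  have "finite ?S" by simp
  note * = functional_superset[OF this]
  show ?thesis
    using *[of "p + q"] *[of p] *[of q] Poly_Mapping.keys_add[of p q]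
    by (simp add: lookup_add algebra_simps sum.distrib)
qed

lemma functional_sum: "functional \<chi> (sum h X) = (\<Sum>i\<in>X. functional \<chi> (h i))"
  by (induction X rule: infinite_finite_induct) (auto simp: functional_add, auto simp: functional_def)

lemma functional_single: "functional \<chi> (Poly_Mapping.single m c) = c * \<chi> m"
  by (simp add: functional_def)

lemma functional_mult:
  "functional \<chi> (q * p) =
    (\<Sum>u\<in>Poly_Mapping.keys q. Poly_Mapping.lookup q u * functional (\<lambda>n. \<chi> (u + n)) p)"
  unfolding mult_sum_single[of q p] functional_sum functional_single
  by (simp add: functional_def sum_distrib_left mult.assoc)

definition indistinguishable :: "point set \<Rightarrow> point monom \<Rightarrow> point monom \<Rightarrow> bool" where
  "indistinguishable A a b \<longleftrightarrow> (\<forall>\<phi>. balanced A \<phi> \<longrightarrow> weight \<phi> a = weight \<phi> b)"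

lemma indistinguishable_add_iff:
  "indistinguishable A (a + u) (b + u) \<longleftrightarrow> indistinguishable A a b"
  by (simp add: indistinguishable_def weight_add)

text \<open>The toric ideal of the grading by all balanced weights, described by the linear functionals
  that vanish on it: those that are constant on the monomials of each degree.\<close>

definition class_function :: "point set \<Rightarrow> point set \<Rightarrow> (point monom \<Rightarrow> 'k) \<Rightarrow> bool" where
  "class_function A V \<chi> \<longleftrightarrow>
     (\<forall>a\<in>monomials V. \<forall>b\<in>monomials V. indistinguishable A a b \<longrightarrow> \<chi> a = \<chi> b)"

definition toric_ideal :: "point set \<Rightarrow> point set \<Rightarrow> (point, 'k::field) mpoly set" where
  "toric_ideal A V = {p \<in> carrier (poly_ring V). \<forall>\<chi>. class_function A V \<chi> \<longrightarrow> functional \<chi> p = 0}"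

lemma ideal_toric_ideal: "ideal (toric_ideal A V :: (point, 'k::field) mpoly set) (poly_ring V)"
proof (rule ideal_polyI)
  show "0 \<in> (toric_ideal A V :: (point, 'k) mpoly set)"
    by (simp add: toric_ideal_def carrier_poly_ring functional_def)
  show "x + y \<in> toric_ideal A V" if "x \<in> toric_ideal A V" "y \<in> toric_ideal A V"
    for x y :: "(point, 'k) mpoly"
    using that by (auto simp: toric_ideal_def poly_ring_add functional_add)
  show "c * x \<in> toric_ideal A V" if c: "c \<in> carrier (poly_ring V)" and x: "x \<in> toric_ideal A V"
    for c x :: "(point, 'k) mpoly"
  proof -
    have "functional \<chi> (c * x) = 0" if \<chi>: "class_function A V \<chi>" for \<chi> :: "point monom \<Rightarrow> 'k"
    proof -
      have "functional (\<lambda>n. \<chi> (u + n)) x = 0" if "u \<in> Poly_Mapping.keys c" for u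
      proof -
        have u: "u \<in> monomials V" using that c by (auto simp: carrier_poly_ring)
        have "class_function A V (\<lambda>n. \<chi> (u + n))"
          unfolding class_function_def
        proof (intro ballI impI)
          fix a b assume ab: "a \<in> monomials V" "b \<in> monomials V" "indistinguishable A a b"
          then have "indistinguishable A (u + a) (u + b)"
            using indistinguishable_add_iff[of A a u b] by (simp add: add.commute)
          then show "\<chi> (u + a) = \<chi> (u + b)"
            using \<chi> monomials_add u ab unfolding class_function_def by blast
        qed
        then show ?thesis using x by (simp add: toric_ideal_def)
      qed
      then show ?thesis unfolding functional_mult by simp
    qed
    then show ?thesis using c x by (auto simp: toric_ideal_def poly_ring_mult)
  qed
qed (auto simp: toric_ideal_def)

lemma toric_ideal_cancel_monomial:
  fixes p :: "(point, 'k::field) mpoly"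
  assumes p: "p \<in> carrier (poly_ring V)" and g: "g \<in> monomials V"
    and pg: "p * Poly_Mapping.single g 1 \<in> toric_ideal A V"
  shows "p \<in> toric_ideal A V"
proof -
  have "functional \<chi> p = 0" if \<chi>: "class_function A V \<chi>" for \<chi> :: "point monom \<Rightarrow> 'k"
  proof -
    let ?Q = "\<lambda>n m. m \<in> monomials V \<and> indistinguishable A n (m + g)"
    define \<psi> where "\<psi> n = (if \<exists>m. ?Q n m then \<chi> (SOME m. ?Q n m) else 0)" for n
    have "class_function A V \<psi>"
      unfolding class_function_def
    proof (intro ballI impI)
      fix a b assume "indistinguishable A a b"
      then have "?Q a = ?Q b" by (auto simp: indistinguishable_def fun_eq_iff)
      then show "\<psi> a = \<psi> b" unfolding \<psi>_def by metis
    qed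
    then have "functional \<psi> (p * Poly_Mapping.single g 1) = 0" using pg by (simp add: toric_ideal_def)
    moreover have "\<psi> (u + g) = \<chi> u" if u: "u \<in> monomials V" for u
    proof -
      have "?Q (u + g) u" using u by (simp add: indistinguishable_def)
      then have ex: "\<exists>m. ?Q (u + g) m" by blast
      from someI_ex[OF ex] have s: "?Q (u + g) (SOME m. ?Q (u + g) m)" .
      then have "indistinguishable A u (SOME m. ?Q (u + g) m)"
        using indistinguishable_add_iff by blast
      then have "\<chi> u = \<chi> (SOME m. ?Q (u + g) m)"
        using \<chi> u s unfolding class_function_def by blast
      then show ?thesis unfolding \<psi>_def using ex by simp
    qed
    then have "functional \<psi> (p * Poly_Mapping.single g 1) = functional \<chi> p"
      unfolding functional_mult functional_single
      by (simp add: functional_def, intro sum.cong refl) (use p in \<open>auto simp: carrier_poly_ring\<close>)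
    ultimately show ?thesis by simp
  qed
  then show ?thesis using p by (simp add: toric_ideal_def)
qed

lemma toric_ideal_subset:
  fixes I :: "(point, 'k::field) mpoly set"
  assumes I: "ideal I (poly_ring V)"
    and eq: "\<And>a b. a \<in> monomials V \<Longrightarrow> b \<in> monomials V \<Longrightarrow> indistinguishable A a b \<Longrightarrow>
      Poly_Mapping.single a 1 - Poly_Mapping.single b 1 \<in> I"
  shows "toric_ideal A V \<subseteq> I"
proof
  fix p :: "(point, 'k) mpoly" assume p: "p \<in> toric_ideal A V"
  have pm: "m \<in> monomials V" if "m \<in> Poly_Mapping.keys p" for m
    using p that by (auto simp: toric_ideal_def carrier_poly_ring)
  let ?Q = "\<lambda>m n. n \<in> monomials V \<and> indistinguishable A m n"
  define rep where "rep m = (SOME n. ?Q m n)" for m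
  have rep: "?Q m (rep m)" if "m \<in> monomials V" for m
    unfolding rep_def by (rule someI[of _ m]) (use that in \<open>simp add: indistinguishable_def\<close>)
  have rep_eq: "rep a = rep b" if "indistinguishable A a b" for a b
  proof -
    have "?Q a = ?Q b" using that by (auto simp: indistinguishable_def fun_eq_iff)
    then show ?thesis unfolding rep_def by simp
  qed
  let ?l = "Poly_Mapping.lookup p"
  have 0: "(\<Sum>m\<in>Poly_Mapping.keys p. Poly_Mapping.single (rep m) (?l m)) = 0"
  proof (rule poly_mapping_eqI)
    fix k
    have "class_function A V (\<lambda>m. of_bool (rep m = k) :: 'k)"
      unfolding class_function_def using rep_eq by auto
    then have "functional (\<lambda>m. of_bool (rep m = k)) p = 0" using p by (simp add: toric_ideal_def)
    then show "Poly_Mapping.lookup (\<Sum>m\<in>Poly_Mapping.keys p. Poly_Mapping.single (rep m) (?l m)) k =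
        Poly_Mapping.lookup 0 k"
      by (simp add: lookup_sum lookup_single when_def functional_def of_bool_def if_distrib cong: if_cong)
  qed
  have "p = (\<Sum>m\<in>Poly_Mapping.keys p. Poly_Mapping.single m (?l m)) -
      (\<Sum>m\<in>Poly_Mapping.keys p. Poly_Mapping.single (rep m) (?l m))"
    unfolding 0 using poly_mapping_sum_single[of p] by simp
  also have "\<dots> = (\<Sum>m\<in>Poly_Mapping.keys p. Poly_Mapping.single 0 (?l m) *
      (Poly_Mapping.single m 1 - Poly_Mapping.single (rep m) 1))"
    by (simp add: sum_subtractf right_diff_distrib mult_single)
  also have "\<dots> \<in> I"
  proof (rule ideal_poly_sum[OF I], rule ideal_poly(4)[OF I])
    fix m assume m: "m \<in> Poly_Mapping.keys p"
    show "Poly_Mapping.single 0 (?l m) \<in> carrier (poly_ring V)"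
      by (rule poly_ring_single) (simp add: monomials_def)
    show "Poly_Mapping.single m 1 - Poly_Mapping.single (rep m) 1 \<in> I"
      using eq[OF pm[OF m]] rep[OF pm[OF m]] by blast
  qed
  finally show "p \<in> I" .
qed

definition corner_binomial :: "point \<Rightarrow> point \<Rightarrow> (point, 'k::field) mpoly" where
  "corner_binomial p q = var p * var q - var (fst p, snd q) * var (fst q, snd p)"

abbreviation pair_monom :: "point \<Rightarrow> point \<Rightarrow> point monom" where
  "pair_monom p q \<equiv> Poly_Mapping.single p 1 + Poly_Mapping.single q 1"

lemma corner_binomial_single:
  "corner_binomial p q =
    Poly_Mapping.single (pair_monom p q) 1 - Poly_Mapping.single (pair_monom (fst p, snd q) (fst q, snd p)) 1"
  by (simp add: corner_binomial_def var_def mult_single)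

lemma pair_monom_in: "p \<in> V \<Longrightarrow> q \<in> V \<Longrightarrow> pair_monom p q \<in> monomials V"
  by (intro monomials_add) (auto simp: monomials_def)

lemma inner_interval_iff:
  "inner_interval (cell ` A) a b \<longleftrightarrow> proper_interval a b \<and> rect A a b"
proof
  assume i: "inner_interval (cell ` A) a b"
  then have p: "proper_interval a b" by (simp add: inner_interval_def)
  have "(i, j) \<in> A" if "fst a \<le> i" "i < fst b" "snd a \<le> j" "j < snd b" for i j
  proof -
    have "cell (i, j) \<subseteq> interval a b" using that by (auto simp: cell_def interval_def)
    then have "cell (i, j) \<in> cell ` A" using i unfolding inner_interval_def cells_def by blast
    then show ?thesis using inj_cell by (auto dest: injD)
  qed
  then show "proper_interval a b \<and> rect A a b"
    using p unfolding rect_def proper_interval_def by auto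
next
  assume r: "proper_interval a b \<and> rect A a b"
  have "C \<in> cell ` A" if "C \<in> cells" "C \<subseteq> interval a b" for C
  proof -
    from that(1) obtain i j where C: "C = cell (i, j)" by (auto simp: cells_def)
    have "(i, j) \<in> interval a b" "(Suc i, Suc j) \<in> interval a b" using that(2) C by (auto simp: cell_iff)
    then have "(i, j) \<in> A" using r unfolding rect_def proper_interval_def interval_def by auto
    then show ?thesis using C by blast
  qed
  then show "inner_interval (cell ` A) a b"
    using r rect_corner_vertices[of A a b] unfolding inner_interval_def by blast
qed

lemma corner_binomial_carrier:
  assumes "rect A p q"
  shows "corner_binomial p q \<in> carrier (poly_ring (vertices (cell ` A)))"
  unfolding corner_binomial_single
  using rect_corner_vertices[OF assms] by (intro poly_ring_diff poly_ring_single pair_monom_in)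

lemma corner_binomial_orientation:
  fixes I :: "(point, 'k::field) mpoly set"
  assumes I: "ideal I (poly_ring V)"
    and gen: "\<And>a b. proper_interval a b \<Longrightarrow> rect A a b \<Longrightarrow> corner_binomial a b \<in> I"
    and r: "rect A p q"
  shows "corner_binomial p q \<in> I"
proof -
  have comm: "corner_binomial p q = (corner_binomial q p :: (point, 'k) mpoly)" for p q
    by (simp add: corner_binomial_def mult.commute)
  have less: "corner_binomial p q \<in> I" if r: "rect A p q" and l: "fst p < fst q" for p q
  proof (cases "snd p < snd q")
    case True
    then show ?thesis using gen r l by (simp add: proper_interval_def)
  next
    case False
    let ?a = "(fst p, snd q)" and ?b = "(fst q, snd p)"
    have "rect A ?a ?b" using r unfolding rect_def by (simp add: min.commute max.commute)
    moreover have "proper_interval ?a ?b" using False l r by (auto simp: proper_interval_def rect_def)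
    ultimately have "- corner_binomial ?a ?b \<in> I" using gen ideal_poly(5)[OF I] by blast
    then show ?thesis by (simp add: corner_binomial_def)
  qed
  show ?thesis
  proof (cases "fst p < fst q")
    case False
    then have "fst q < fst p" using r by (auto simp: rect_def)
    then show ?thesis using less[of q p] r rect_commute comm by metis
  qed (use less r in blast)
qed

lemma swap_equiv_ideal:
  fixes I :: "(point, 'k::field) mpoly set"
  assumes V: "V = vertices (cell ` A)" and I: "ideal I (poly_ring V)"
    and gen: "\<And>a b. proper_interval a b \<Longrightarrow> rect A a b \<Longrightarrow> corner_binomial a b \<in> I"
  shows "swap_equiv A a b \<Longrightarrow> (a \<in> monomials V \<longleftrightarrow> b \<in> monomials V) \<and>
     (a \<in> monomials V \<longrightarrow> Poly_Mapping.single a 1 - Poly_Mapping.single b 1 \<in> I)"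
proof (induction rule: swap_equiv.induct)
  case (swap_refl a)
  then show ?case using ideal_poly(2)[OF I] by simp
next
  case (swap_sym a b)
  then show ?case using ideal_poly(5)[OF I] by (metis minus_diff_eq)
next
  case (swap_trans a b c)
  then show ?case
    using ideal_poly(3)[OF I, of "Poly_Mapping.single a 1 - Poly_Mapping.single b 1"
      "Poly_Mapping.single b 1 - Poly_Mapping.single c 1"] by auto
next
  case (swap_rect p q u)
  let ?a = "u + pair_monom p q" and ?b = "u + pair_monom (fst p, snd q) (fst q, snd p)"
  note c = rect_corner_vertices[OF swap_rect, folded V]
  have a: "?a \<in> monomials V \<longleftrightarrow> u \<in> monomials V"
    using pair_monom_in[OF c(1,2)] monomials_add[of u V] by (auto simp: in_monomials_iff lookup_add)
  have b: "?b \<in> monomials V \<longleftrightarrow> u \<in> monomials V"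
    using pair_monom_in[OF c(3,4)] monomials_add[of u V] by (auto simp: in_monomials_iff lookup_add)
  have "Poly_Mapping.single ?a 1 - Poly_Mapping.single ?b 1 = Poly_Mapping.single u 1 * corner_binomial p q"
    by (simp add: corner_binomial_single right_diff_distrib mult_single)
  moreover have "\<dots> \<in> I" if "u \<in> monomials V"
    using ideal_poly(4)[OF I poly_ring_single[OF that] corner_binomial_orientation[OF I gen swap_rect]] .
  ultimately show ?case using a b by metis
qed

lemma polyomino_ideal_eq:
  "polyomino_ideal (cell ` A) = Idl\<^bsub>poly_ring (vertices (cell ` A))\<^esub>
     {corner_binomial a b | a b. proper_interval a b \<and> rect A a b}"
  unfolding polyomino_ideal_def corner_binomial_def inner_interval_iff ..

lemma polyomino_ideal_toric:
  assumes A: "tree_grid A"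
  shows "(polyomino_ideal (cell ` A) :: (point, 'k::field) mpoly set) = toric_ideal A (vertices (cell ` A))"
proof -
  let ?V = "vertices (cell ` A)"
  let ?G = "{corner_binomial a b | a b. proper_interval a b \<and> rect A a b} :: (point, 'k) mpoly set"
  have G: "?G \<subseteq> carrier (poly_ring ?V)" using corner_binomial_carrier by blast
  have "?G \<subseteq> toric_ideal A ?V"
  proof
    fix x assume "x \<in> ?G"
    then obtain a b where x: "x = corner_binomial a b" and r: "rect A a b" by blast
    note c = rect_corner_vertices[OF r]
    have "indistinguishable A (pair_monom a b) (pair_monom (fst a, snd b) (fst b, snd a))"
      using swap_equiv_weight[OF swap_equiv.swap_rect[OF r, of 0]]
      unfolding indistinguishable_def add_0_left by blast
    then have "functional \<chi> x = 0" if "class_function A ?V \<chi>" for \<chi>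
      using that pair_monom_in[OF c(1,2)] pair_monom_in[OF c(3,4)]
      unfolding x corner_binomial_single class_function_def
      by (simp add: functional_add functional_single diff_conv_add_uminus flip: single_uminus
          del: add_uminus_conv_diff)
    then show "x \<in> toric_ideal A ?V"
      using corner_binomial_carrier[OF r] x by (simp add: toric_ideal_def)
  qed
  moreover have "toric_ideal A ?V \<subseteq> Idl\<^bsub>poly_ring ?V\<^esub> ?G"
  proof (rule toric_ideal_subset[OF ideal_Idl[OF G]])
    fix a b assume ab: "a \<in> monomials ?V" "b \<in> monomials ?V" "indistinguishable A a b"
    then have "swap_equiv A a b"
      using saturated_tree[OF A] unfolding saturated_def indistinguishable_def by blast
    from swap_equiv_ideal[OF refl ideal_Idl[OF G] _ this]
    show "Poly_Mapping.single a 1 - Poly_Mapping.single b 1 \<in> Idl\<^bsub>poly_ring ?V\<^esub> ?G"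
      using Idl_self[OF G] ab by blast
  qed
  ultimately show ?thesis
    unfolding polyomino_ideal_eq using Idl_minimal[OF ideal_toric_ideal] by blast
qed

section \<open>The Knutson family generated by the strips\<close>

definition corner_vector :: "point \<Rightarrow> point \<Rightarrow> point \<Rightarrow>\<^sub>0 int" where
  "corner_vector p q = Poly_Mapping.single p 1 + Poly_Mapping.single q 1 -
     Poly_Mapping.single (fst p, snd q) 1 - Poly_Mapping.single (fst q, snd p) 1"

abbreviation cell_vector :: "point \<Rightarrow> point \<Rightarrow>\<^sub>0 int" where
  "cell_vector c \<equiv> corner_vector c (Suc (fst c), Suc (snd c))"

text \<open>The exponent vectors of the binomials that lie in \<open>J\<close> after inverting the variables.\<close>

definition binomial_vectors :: "point set \<Rightarrow> (point, 'k::field) mpoly set \<Rightarrow> (point \<Rightarrow>\<^sub>0 int) set" where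
  "binomial_vectors V J = {u. \<exists>a\<in>monomials V. \<exists>b\<in>monomials V.
     (\<forall>v. Poly_Mapping.lookup u v = int (Poly_Mapping.lookup a v) - int (Poly_Mapping.lookup b v)) \<and>
     Poly_Mapping.single a 1 - Poly_Mapping.single b 1 \<in> J}"

lemma binomial_vectors_diff:
  fixes J :: "(point, 'k::field) mpoly set"
  assumes J: "ideal J (poly_ring V)"
    and u: "u \<in> binomial_vectors V J" and v: "v \<in> binomial_vectors V J"
  shows "u - v \<in> binomial_vectors V J"
proof -
  let ?x = "\<lambda>m. Poly_Mapping.single m 1 :: (point, 'k) mpoly"
  obtain a b where ab: "a \<in> monomials V" "b \<in> monomials V" "?x a - ?x b \<in> J"
    "\<And>w. Poly_Mapping.lookup u w = int (Poly_Mapping.lookup a w) - int (Poly_Mapping.lookup b w)"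
    using u unfolding binomial_vectors_def by blast
  obtain c d where cd: "c \<in> monomials V" "d \<in> monomials V" "?x c - ?x d \<in> J"
    "\<And>w. Poly_Mapping.lookup v w = int (Poly_Mapping.lookup c w) - int (Poly_Mapping.lookup d w)"
    using v unfolding binomial_vectors_def by blast
  have "?x d * (?x a - ?x b) - ?x b * (?x c - ?x d) \<in> J"
    by (rule ideal_poly(6)[OF J ideal_poly(4)[OF J poly_ring_single[OF cd(2)] ab(3)]
      ideal_poly(4)[OF J poly_ring_single[OF ab(2)] cd(3)]])
  moreover have "?x d * (?x a - ?x b) - ?x b * (?x c - ?x d) = ?x (a + d) - ?x (b + c)"
    by (simp add: right_diff_distrib mult_single add.commute)
  ultimately have "?x (a + d) - ?x (b + c) \<in> J" by simp
  moreover have "Poly_Mapping.lookup (u - v) w =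
      int (Poly_Mapping.lookup (a + d) w) - int (Poly_Mapping.lookup (b + c) w)" for w
    using ab(4) cd(4) by (simp add: lookup_minus lookup_add)
  ultimately show ?thesis
    unfolding binomial_vectors_def using monomials_add ab cd by blast
qed

lemma binomial_vectors_sum:
  assumes J: "ideal J (poly_ring V)" and h: "\<And>i. i \<in> X \<Longrightarrow> h i \<in> binomial_vectors V J"
  shows "sum h X \<in> binomial_vectors V J"
proof -
  have zero: "0 \<in> binomial_vectors V J"
  proof -
    have "(0 :: point monom) \<in> monomials V" by (simp add: monomials_def)
    then show ?thesis
      unfolding binomial_vectors_def using ideal_poly(2)[OF J]
      by (intro CollectI bexI[of _ 0]) simp_all
  qed
  have "u + v \<in> binomial_vectors V J" if "u \<in> binomial_vectors V J" "v \<in> binomial_vectors V J" for u v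
    using binomial_vectors_diff[OF J that(1) binomial_vectors_diff[OF J zero that(2)]] by simp
  then show ?thesis
    using h zero by (induction X rule: infinite_finite_induct) auto
qed

lemma lookup_corner_vector:
  "Poly_Mapping.lookup (corner_vector p q) v = int (Poly_Mapping.lookup (pair_monom p q) v) -
     int (Poly_Mapping.lookup (pair_monom (fst p, snd q) (fst q, snd p)) v)"
  by (simp add: corner_vector_def lookup_add lookup_minus lookup_single when_def)

lemma corner_vector_in:
  assumes "rect A p q" "corner_binomial p q \<in> J"
  shows "corner_vector p q \<in> binomial_vectors (vertices (cell ` A)) J"
  using assms(2) rect_corner_vertices[OF assms(1)] lookup_corner_vector pair_monom_in
  unfolding binomial_vectors_def corner_binomial_single by blast

lemma corner_vector_monomial:
  fixes J :: "(point, 'k::field) mpoly set"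
  assumes J: "ideal J (poly_ring V)" and "V = vertices (cell ` A)" "rect A p q"
    and u: "corner_vector p q \<in> binomial_vectors V J"
  shows "\<exists>m\<in>monomials V. Poly_Mapping.single m 1 * corner_binomial p q \<in> J"
proof -
  let ?x = "\<lambda>m. Poly_Mapping.single m 1 :: (point, 'k) mpoly"
  let ?p = "pair_monom p q" and ?q = "pair_monom (fst p, snd q) (fst q, snd p)"
  obtain a b where ab: "a \<in> monomials V" "b \<in> monomials V" "?x a - ?x b \<in> J"
    "\<And>w. Poly_Mapping.lookup (corner_vector p q) w =
      int (Poly_Mapping.lookup a w) - int (Poly_Mapping.lookup b w)"
    using u unfolding binomial_vectors_def by blast
  have "Poly_Mapping.lookup (b + ?p) w = Poly_Mapping.lookup (a + ?q) w" for w
    using ab(4)[of w] unfolding lookup_corner_vector lookup_add[of b] lookup_add[of a] by linarith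
  then have e: "b + ?p = a + ?q" by (intro poly_mapping_eqI) simp
  have "?q \<in> monomials V" using rect_corner_vertices[OF assms(3)] assms(2) pair_monom_in by blast
  from ideal_poly(4)[OF J poly_ring_single[OF this] ab(3)]
  have "?x ?q * (?x a - ?x b) \<in> J" .
  moreover have "?x b * corner_binomial p q = ?x (b + ?p) - ?x (b + ?q)"
    by (simp add: corner_binomial_single right_diff_distrib mult_single)
  then have "?x b * corner_binomial p q = ?x ?q * (?x a - ?x b)"
    unfolding e by (simp add: right_diff_distrib mult_single add.commute)
  ultimately show ?thesis using ab(2) by metis
qed

lemma sum_cell_vectors:
  assumes "a \<le> b" "c \<le> d"
  shows "sum cell_vector ({a..b} \<times> {c..d}) = corner_vector (a, c) (Suc b, Suc d)"
proof -
  let ?e = "\<lambda>i j. Poly_Mapping.single (i, j) (1 :: int)"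
  have tel: "(\<Sum>i=m..n. f i - f (Suc i)) = f m - f (Suc n)" if "m \<le> n" for f :: "nat \<Rightarrow> point \<Rightarrow>\<^sub>0 int" and m n
    using that by (induction rule: dec_induct) auto
  have "sum cell_vector ({a..b} \<times> {c..d}) =
      (\<Sum>i=a..b. \<Sum>j=c..d. (?e i j - ?e (Suc i) j) - (?e i (Suc j) - ?e (Suc i) (Suc j)))"
    by (simp add: sum.cartesian_product corner_vector_def algebra_simps case_prod_unfold)
  also have "\<dots> = (\<Sum>i=a..b. (?e i c - ?e i (Suc d)) - (?e (Suc i) c - ?e (Suc i) (Suc d)))"
  proof (rule sum.cong[OF refl])
    fix i
    show "(\<Sum>j=c..d. (?e i j - ?e (Suc i) j) - (?e i (Suc j) - ?e (Suc i) (Suc j))) =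
        (?e i c - ?e i (Suc d)) - (?e (Suc i) c - ?e (Suc i) (Suc d))"
      using tel[OF assms(2), of "\<lambda>j. ?e i j - ?e (Suc i) j"] by simp
  qed
  also have "\<dots> = (?e a c - ?e a (Suc d)) - (?e (Suc b) c - ?e (Suc b) (Suc d))"
    by (rule tel[OF assms(1)])
  finally show ?thesis by (simp add: corner_vector_def algebra_simps)
qed

lemma strip_box:
  assumes A: "tree_grid A" and s: "s \<in> hstrips A \<union> vstrips A"
  shows "proper_interval (lo_corner s) (hi_corner s)" "rect A (lo_corner s) (hi_corner s)"
    "sum cell_vector s = corner_vector (lo_corner s) (hi_corner s)"
proof -
  have A': "finite A" "A \<subseteq> {1..} \<times> {1..}" using A unfolding tree_grid_def by blast+
  have "\<exists>a b c d. a \<le> b \<and> c \<le> d \<and> s = {a..b} \<times> {c..d} \<and> s \<subseteq> A"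
    using s
  proof
    assume h: "s \<in> hstrips A"
    show ?thesis by (rule hstrips_box[OF A' h]) blast
  next
    assume v: "s \<in> vstrips A"
    show ?thesis by (rule vstrips_box[OF A' v]) blast
  qed
  then obtain a b c d where b: "a \<le> b" "c \<le> d" "s = {a..b} \<times> {c..d}" "s \<subseteq> A" by blast
  have c: "lo_corner s = (a, c)" "hi_corner s = (Suc b, Suc d)"
    unfolding b(3) using corners_box[OF b(1,2)] by blast+
  show "proper_interval (lo_corner s) (hi_corner s)" "rect A (lo_corner s) (hi_corner s)"
    using b c by (auto simp: proper_interval_def rect_def)
  show "sum cell_vector s = corner_vector (lo_corner s) (hi_corner s)"
    unfolding c using sum_cell_vectors[OF b(1,2)] b(3) by simp
qed

lemma strips_generate_cells:
  fixes J :: "(point, 'k::field) mpoly set"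
  assumes A: "tree_grid A" and J: "ideal J (poly_ring (vertices (cell ` A)))"
    and gen: "\<And>s. s \<in> hstrips A \<union> (vstrips A - {r}) \<Longrightarrow> corner_binomial (lo_corner s) (hi_corner s) \<in> J"
    and c: "c \<in> A"
  shows "cell_vector c \<in> binomial_vectors (vertices (cell ` A)) J"
proof -
  let ?G = "binomial_vectors (vertices (cell ` A)) J"
  have st: "strip_tree (hstrips A) (vstrips A)" using strip_tree_grid[OF A] .
  have s: "sum cell_vector s \<in> ?G" if "s \<in> hstrips A \<union> (vstrips A - {r})" for s
  proof -
    have "s \<in> hstrips A \<union> vstrips A" using that by blast
    from strip_box[OF A this] show ?thesis using corner_vector_in gen[OF that] by simp
  qed
  have "sum cell_vector r \<in> ?G" if "r \<in> vstrips A"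
  proof -
    have fin: "finite (vstrips A)" using strip_tree_finite[OF st] by blast
    have "(\<Sum>s\<in>hstrips A. sum cell_vector s) = (\<Sum>s\<in>vstrips A. sum cell_vector s)"
      by (rule strip_tree_sum_eq[OF st])
    also have "\<dots> = sum cell_vector r + (\<Sum>s\<in>vstrips A - {r}. sum cell_vector s)"
      by (rule sum.remove[OF fin that])
    finally have eq: "sum cell_vector r = (\<Sum>s\<in>hstrips A. sum cell_vector s) - (\<Sum>s\<in>vstrips A - {r}. sum cell_vector s)"
      by simp
    have h: "(\<Sum>s\<in>hstrips A. sum cell_vector s) \<in> ?G"
      by (rule binomial_vectors_sum[OF J s]) simp
    have v: "(\<Sum>s\<in>vstrips A - {r}. sum cell_vector s) \<in> ?G"
      by (rule binomial_vectors_sum[OF J s]) simp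
    show ?thesis unfolding eq by (rule binomial_vectors_diff[OF J h v])
  qed
  then have "sum cell_vector s \<in> ?G" if "s \<in> hstrips A \<union> vstrips A" for s
    using s that by blast
  from strip_tree_generate[OF binomial_vectors_diff[OF J] st this] show ?thesis
    using c Union_hstrips by blast
qed

lemma leads_binomial:
  assumes "m \<in> monomials V" "n \<in> monomials V" "weight w n < weight w m"
  shows "leads (weight_order V w) (Poly_Mapping.single m 1 - Poly_Mapping.single n 1 :: (_, 'k::field) mpoly) m"
    "leads (weight_order V w) (Poly_Mapping.single n 1 - Poly_Mapping.single m 1 :: (_, 'k::field) mpoly) m"
proof -
  have "m \<noteq> n" using assms(3) by auto
  then have "Poly_Mapping.keys (Poly_Mapping.single m 1 - Poly_Mapping.single n 1 :: (_, 'k) mpoly) = {m, n}"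
    "Poly_Mapping.keys (Poly_Mapping.single n 1 - Poly_Mapping.single m 1 :: (_, 'k) mpoly) = {m, n}"
    by (auto simp: in_keys_iff lookup_minus lookup_single when_def split: if_splits)
  then show "leads (weight_order V w) (Poly_Mapping.single m 1 - Poly_Mapping.single n 1 :: (_, 'k) mpoly) m"
    "leads (weight_order V w) (Poly_Mapping.single n 1 - Poly_Mapping.single m 1 :: (_, 'k) mpoly) m"
    using assms by (auto simp: leads_def weight_order_def less_eq_prod_def)
qed

lemma sum_lookup_pair_monom:
  assumes "finite S"
  shows "(\<Sum>s\<in>S. Poly_Mapping.lookup (pair_monom (p s) (q s)) v) = card {s \<in> S. p s = v} + card {s \<in> S. q s = v}"
proof -
  have 1: "(\<Sum>s\<in>S. Poly_Mapping.lookup (Poly_Mapping.single (h s) 1) v) = card {s \<in> S. h s = v}" for h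
  proof -
    have "(\<Sum>s\<in>S. Poly_Mapping.lookup (Poly_Mapping.single (h s) 1) v) = (\<Sum>s\<in>S. if h s = v then 1 else (0 :: nat))"
      by (intro sum.cong refl) (simp add: lookup_single when_def)
    then show ?thesis using assms by (simp add: sum.If_cases Collect_conj_eq Int_commute)
  qed
  then show ?thesis by (simp only: lookup_add sum.distrib)
qed

text \<open>The flag (\<open>False\<close> for horizontal, \<open>True\<close> for vertical strips) is needed because the two kinds
  of strips coincide if \<open>A\<close> is a single cell.\<close>

definition strip_index :: "point set \<Rightarrow> point set \<Rightarrow> (bool \<times> point set) set" where
  "strip_index A r = Pair False ` hstrips A \<union> Pair True ` (vstrips A - {r})"

definition strip_binomial :: "bool \<times> point set \<Rightarrow> (point, 'k::field) mpoly" where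
  "strip_binomial i = corner_binomial (lo_corner (snd i)) (hi_corner (snd i))"

definition strip_monom :: "bool \<times> point set \<Rightarrow> point monom" where
  "strip_monom i = (if fst i then pair_monom (lo_corner (snd i)) (hi_corner (snd i))
     else pair_monom (ul_corner (snd i)) (lr_corner (snd i)))"

lemma strip_order:
  assumes A: "tree_grid A" and r: "r \<in> vstrips A"
  defines "V \<equiv> vertices (cell ` A)"
  obtains w where "monomial_order V (weight_order V w)"
    "\<And>i. i \<in> strip_index A r \<Longrightarrow> leads (weight_order V w) (strip_binomial i :: (point, 'k::field) mpoly) (strip_monom i)"
proof -
  have finV: "finite V" unfolding V_def using A finite_vertices unfolding tree_grid_def by blast
  obtain w :: "point \<Rightarrow> int" where w:
    "\<And>s. s \<in> hstrips A \<Longrightarrow> w (lo_corner s) + w (hi_corner s) < w (ul_corner s) + w (lr_corner s)"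
    "\<And>s. s \<in> vstrips A - {r} \<Longrightarrow> w (ul_corner s) + w (lr_corner s) < w (lo_corner s) + w (hi_corner s)"
    using strip_weights[OF A r] by blast
  define w' where "w' v = w v + (\<Sum>u\<in>V. \<bar>w u\<bar>)" for v
  have "w' v \<ge> 0" if "v \<in> V" for v
  proof -
    have "\<bar>w v\<bar> \<le> (\<Sum>u\<in>V. \<bar>w u\<bar>)" by (rule member_le_sum[OF that _ finV]) simp
    then show ?thesis unfolding w'_def by linarith
  qed
  then have order: "monomial_order V (weight_order V w')" by (rule monomial_order_weight_order)
  have "leads (weight_order V w') (strip_binomial i :: (point, 'k) mpoly) (strip_monom i)"
    if i: "i \<in> strip_index A r" for i
  proof -
    obtain b s where bs: "i = (b, s)" by (cases i)
    have s: "s \<in> hstrips A \<union> vstrips A" using i bs by (auto simp: strip_index_def)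
    note c = rect_corner_vertices[OF strip_box(2)[OF A s], folded V_def]
    have m: "pair_monom (lo_corner s) (hi_corner s) \<in> monomials V"
      "pair_monom (ul_corner s) (lr_corner s) \<in> monomials V"
      using pair_monom_in[OF c(1,2)] pair_monom_in[OF c(3,4)] .
    have wt: "weight w' (pair_monom p q) = w p + w q + 2 * (\<Sum>u\<in>V. \<bar>w u\<bar>)" for p q
      by (simp add: weight_add weight_single w'_def)
    show ?thesis
    proof (cases b)
      case True
      then have "s \<in> vstrips A - {r}" using i bs by (auto simp: strip_index_def)
      then have "weight w' (pair_monom (ul_corner s) (lr_corner s)) < weight w' (pair_monom (lo_corner s) (hi_corner s))"
        unfolding wt using w(2) by simp
      from leads_binomial(1)[OF m this] show ?thesis
        using True bs by (simp only: strip_binomial_def strip_monom_def corner_binomial_single prod.sel if_True)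
    next
      case False
      then have "s \<in> hstrips A" using i bs by (auto simp: strip_index_def)
      then have "weight w' (pair_monom (lo_corner s) (hi_corner s)) < weight w' (pair_monom (ul_corner s) (lr_corner s))"
        unfolding wt using w(1) by simp
      from leads_binomial(2)[OF m(2,1) this] show ?thesis
        using False bs by (simp only: strip_binomial_def strip_monom_def corner_binomial_single prod.sel if_False)
    qed
  qed
  then show thesis using that order by blast
qed

lemma strip_monom_squarefree:
  assumes A: "tree_grid A"
  shows "squarefree_monomial (sum strip_monom (strip_index A r))"
  unfolding squarefree_monomial_def
proof
  fix v :: point
  let ?l = "\<lambda>m. Poly_Mapping.lookup m v"
  have fin: "finite (hstrips A)" "finite (vstrips A)"
    using strip_tree_finite[OF strip_tree_grid[OF A]] by blast+
  have "?l (sum strip_monom (strip_index A r)) = (\<Sum>i\<in>strip_index A r. ?l (strip_monom i))"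
    by (rule lookup_sum)
  also have "\<dots> = (\<Sum>i\<in>Pair False ` hstrips A. ?l (strip_monom i)) + (\<Sum>i\<in>Pair True ` (vstrips A - {r}). ?l (strip_monom i))"
    unfolding strip_index_def by (rule sum.union_disjoint) (use fin in auto)
  also have "\<dots> \<le> (\<Sum>i\<in>Pair False ` hstrips A. ?l (strip_monom i)) + (\<Sum>i\<in>Pair True ` vstrips A. ?l (strip_monom i))"
    by (intro add_left_mono sum_mono2) (use fin in auto)
  also have "\<dots> = (\<Sum>s\<in>hstrips A. ?l (pair_monom (ul_corner s) (lr_corner s))) +
      (\<Sum>s\<in>vstrips A. ?l (pair_monom (lo_corner s) (hi_corner s)))"
    by (subst (1 2) sum.reindex) (auto simp: inj_on_def strip_monom_def)
  also have "\<dots> \<le> 1"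
    unfolding sum_lookup_pair_monom[OF fin(1)] sum_lookup_pair_monom[OF fin(2)]
    using corners_disjoint[OF A, of v] by linarith
  finally show "?l (sum strip_monom (strip_index A r)) \<le> 1" .
qed

lemma knutson_tree_grid:
  assumes A: "tree_grid A"
  shows "knutson_ideal (vertices (cell ` A)) (polyomino_ideal (cell ` A) :: (point, 'k::field) mpoly set)"
proof -
  define V where "V = vertices (cell ` A)"
  let ?R = "poly_ring V :: (point, 'k) mpoly ring"
  let ?I = "polyomino_ideal (cell ` A) :: (point, 'k) mpoly set"
  obtain c0 where c0: "c0 \<in> A" using A unfolding tree_grid_def by blast
  obtain r where r: "r \<in> vstrips A" using c0 by (auto simp: vstrips_def)
  let ?X = "strip_index A r"
  let ?f = "prod strip_binomial ?X :: (point, 'k) mpoly"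
  have finV: "finite V" unfolding V_def using A finite_vertices unfolding tree_grid_def by blast
  have fin: "finite ?X"
    using strip_tree_finite[OF strip_tree_grid[OF A]] by (auto simp: strip_index_def)
  have "hstrips A \<noteq> {}" using c0 Union_hstrips by blast
  then have ne: "?X \<noteq> {}" by (simp add: strip_index_def)
  obtain w where order: "monomial_order V (weight_order V w)"
    and lead: "\<And>i. i \<in> ?X \<Longrightarrow> leads (weight_order V w) (strip_binomial i :: (point, 'k) mpoly) (strip_monom i)"
    using strip_order[OF A r, folded V_def] by blast
  have F: "strip_binomial i \<in> carrier ?R" "strip_binomial i \<noteq> (0 :: (point, 'k) mpoly)" if "i \<in> ?X" for i
  proof -
    have "snd i \<in> hstrips A \<union> vstrips A" using that by (auto simp: strip_index_def)
    then show "strip_binomial i \<in> carrier ?R"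
      unfolding strip_binomial_def V_def by (intro corner_binomial_carrier strip_box(2)[OF A])
    show "strip_binomial i \<noteq> (0 :: (point, 'k) mpoly)" using lead[OF that] by (auto simp: leads_def)
  qed
  have fc: "?f \<in> carrier ?R" using F by (intro poly_ring_prod)
  have f0: "?f \<noteq> 0" using F fin by simp
  have "initial_monomial (weight_order V w) ?f = sum strip_monom ?X"
    by (rule initial_monomial_eq[OF leads_prod[OF fin lead]])
  then have sqf: "squarefree_monomial (initial_monomial (weight_order V w) ?f)"
    using strip_monom_squarefree[OF A] by simp
  have fam: "Idl\<^bsub>?R\<^esub> {strip_binomial i} \<in> knutson_family ?R ?f" if "i \<in> ?X" for i
  proof (rule knutson_factor)
    show "?f = prod strip_binomial (?X - {i}) * strip_binomial i"
      using prod.remove[OF fin that, of strip_binomial] by (simp add: mult.commute)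
    show "prod strip_binomial (?X - {i}) \<noteq> (0 :: (point, 'k) mpoly)" using F fin by simp
    show "prod strip_binomial (?X - {i}) \<in> carrier ?R" using F by (intro poly_ring_prod) auto
  qed (use F that in blast)
  define J where "J = Idl\<^bsub>?R\<^esub> (strip_binomial ` ?X)"
  have Jfam: "J \<in> knutson_family ?R ?f"
    unfolding J_def by (rule knutson_finite_sum[OF fin ne F(1) fam])
  have JX: "strip_binomial ` ?X \<subseteq> carrier ?R" using F by blast
  have J: "ideal J ?R" unfolding J_def by (rule ideal_Idl[OF JX])
  have I: "ideal ?I ?R" "?I = toric_ideal A V"
    unfolding V_def polyomino_ideal_toric[OF A] by (simp_all add: ideal_toric_ideal)
  let ?G = "{corner_binomial a b | a b. proper_interval a b \<and> rect A a b} :: (point, 'k) mpoly set"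
  have G: "?G \<subseteq> carrier ?R" using corner_binomial_carrier unfolding V_def by blast
  have I_eq: "?I = Idl\<^bsub>?R\<^esub> ?G" unfolding V_def by (rule polyomino_ideal_eq)
  have JI: "J \<subseteq> ?I"
    unfolding J_def
  proof (rule Idl_minimal[OF I(1)])
    have "strip_binomial i \<in> ?G" if "i \<in> ?X" for i
    proof -
      have "snd i \<in> hstrips A \<union> vstrips A" using that by (auto simp: strip_index_def)
      then show ?thesis unfolding strip_binomial_def using strip_box(1,2)[OF A] by blast
    qed
    then show "strip_binomial ` ?X \<subseteq> ?I" using Idl_self[OF G] I_eq by blast
  qed
  have sJ: "corner_binomial (lo_corner s) (hi_corner s) \<in> J" if "s \<in> hstrips A \<union> (vstrips A - {r})" for s
  proof -
    have "\<exists>b. (b, s) \<in> ?X" using that by (auto simp: strip_index_def)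
    then obtain b where "(b, s) \<in> ?X" by blast
    then have "strip_binomial (b, s) \<in> J" unfolding J_def using Idl_self[OF JX] by blast
    then show ?thesis by (simp add: strip_binomial_def)
  qed
  have cell: "cell_vector c \<in> binomial_vectors V J" if "c \<in> A" for c
    unfolding V_def by (rule strips_generate_cells[OF A J[unfolded V_def] sJ that])
  have mon: "\<exists>m\<in>monomials V. Poly_Mapping.single m 1 * corner_binomial a b \<in> J"
    if ab: "proper_interval a b" "rect A a b" for a b
  proof -
    let ?s = "{fst a..fst b - 1} \<times> {snd a..snd b - 1}"
    have "sum cell_vector ?s = corner_vector (fst a, snd a) (Suc (fst b - 1), Suc (snd b - 1))"
      by (rule sum_cell_vectors) (use ab(1) in \<open>auto simp: proper_interval_def\<close>)
    then have "sum cell_vector ?s = corner_vector a b" using ab(1) by (simp add: proper_interval_def)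
    moreover have "?s \<subseteq> A" using ab unfolding proper_interval_def rect_def by auto
    then have "sum cell_vector ?s \<in> binomial_vectors V J"
      by (intro binomial_vectors_sum[OF J cell]) blast
    ultimately show ?thesis using corner_vector_monomial[OF J V_def ab(2)] by simp
  qed
  define mu where "mu ab = (SOME m. m \<in> monomials V \<and>
    Poly_Mapping.single m 1 * (corner_binomial (fst ab) (snd ab) :: (point, 'k) mpoly) \<in> J)" for ab
  let ?B = "{(a, b). proper_interval a b \<and> rect A a b}"
  have mu: "mu (a, b) \<in> monomials V" "Poly_Mapping.single (mu (a, b)) 1 * corner_binomial a b \<in> J"
    if "proper_interval a b" "rect A a b" for a b
    using someI_ex[of "\<lambda>m. m \<in> monomials V \<and>
      Poly_Mapping.single m 1 * (corner_binomial a b :: (point, 'k) mpoly) \<in> J"] mon[OF that]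
    unfolding mu_def by auto
  have finB: "finite ?B"
  proof (rule finite_subset)
    show "?B \<subseteq> V \<times> V" using rect_corner_vertices(1,2) unfolding V_def by blast
  qed (use finV in simp)
  define g where "g = sum mu ?B"
  have mus: "sum mu S \<in> monomials V" if "S \<subseteq> ?B" for S
    using that mu(1) by (induction S rule: infinite_finite_induct)
      (auto simp: monomials_add, auto simp: monomials_def)
  have gV: "g \<in> monomials V" unfolding g_def by (rule mus) simp
  let ?xg = "Poly_Mapping.single g 1 :: (point, 'k) mpoly"
  have xg: "?xg \<in> carrier ?R" by (rule poly_ring_single[OF gV])
  have "?I \<subseteq> {p \<in> carrier ?R. p * ?xg \<in> J}"
    unfolding I_eq
  proof (rule Idl_minimal[OF ideal_colon_principal[OF J xg]], safe)
    fix a b :: point assume ab: "proper_interval a b" "rect A a b"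
    show "corner_binomial a b \<in> carrier ?R" using G ab by blast
    have "g = sum mu (?B - {(a, b)}) + mu (a, b)"
      unfolding g_def using sum.remove[OF finB, of "(a, b)" mu] ab by (simp add: add.commute)
    then have "?xg = Poly_Mapping.single (sum mu (?B - {(a, b)})) 1 * Poly_Mapping.single (mu (a, b)) 1"
      by (simp add: mult_single)
    then have "corner_binomial a b * ?xg = Poly_Mapping.single (sum mu (?B - {(a, b)})) 1 *
        (Poly_Mapping.single (mu (a, b)) 1 * corner_binomial a b)"
      by (simp only: ac_simps)
    moreover have "\<dots> \<in> J"
      by (rule ideal_poly(4)[OF J poly_ring_single[OF mus] mu(2)[OF ab]]) blast
    ultimately show "corner_binomial a b * ?xg \<in> J" by (simp only:)
  qed
  moreover have "{p \<in> carrier ?R. p * ?xg \<in> J} \<subseteq> ?I"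
    using JI toric_ideal_cancel_monomial[OF _ gV] unfolding I(2) by blast
  ultimately have "?I = colon_ideal ?R J (Idl\<^bsub>?R\<^esub> {?xg})"
    unfolding colon_principal[OF J xg] by blast
  moreover have "colon_ideal ?R J (Idl\<^bsub>?R\<^esub> {?xg}) \<in> knutson_family ?R ?f"
    using knutson_family.colon[OF Jfam ideal_Idl] xg by blast
  ultimately show ?thesis
    unfolding knutson_ideal_def V_def[symmetric] using order fc f0 sqf by metis
qed

theorem corollary3p7:
  fixes P :: "point set set"
  assumes "polyomino P" and "simple_polyomino P" and "thin_polyomino P"
  shows "knutson_ideal (vertices P) (polyomino_ideal P :: (point, 'k::field) mpoly set)"
proof -
  have "P \<subseteq> range cell" using assms(1) unfolding polyomino_def by blast
  then have "cell ` {c. cell c \<in> P} = P" by blast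
  then show ?thesis using knutson_tree_grid[OF tree_grid_polyomino[OF assms]] by simp
qed

end
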